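(* Fix $I,J\in\mathbb{S}$ with $I$ orthogonal to $J$. Let $U$ be a unitary operator on a right linear quaternionic Hilbert space $\mathcal{H}$ and let $E(t)=E_J(t)$ be its spectral measure. Let $\sigma^0_S(U)\subseteq\sigma_S(U)$ be a spectral set and assume that $\sigma^0_S(U)\cap\mathbb{C}_I$ is contained in the arc of the unit circle in $\mathbb{C}_I$ with endpoints $t_0$ and $t_1$ (i.e. with endpoints $e^{It_0}$ and $e^{It_1}$). Then $$\mathcal{P}(\sigma^0_S(U))=E(t_1)-E(t_0).$$
   Context: $\mathbb{H}$ is the skew field of quaternions, $\mathbb{S}=\{q\in\mathbb{H}:\mathrm{Re}(q)=0,|q|=1\}$, $\mathbb{C}_I=\{u+Iv:u,v\in\mathbb{R}\}$ for $I\in\mathbb{S}$, and $I$ orthogonal to $J$ means $IJ=-JI$. A right linear quaternionic Hilbert space $\mathcal{H}$ has an $\mathbb{H}$-valued inner product with $\langle x,y\rangle=\overline{\langle y,x\rangle}$, $\|x\|^2:=\langle x,x\rangle\ge0$ with equality iff $x=0$, $\langle x\alpha+y\beta,z\rangle=\langle x,z\rangle\alpha+\langle y,z\rangle\beta$, $\langle x,y\alpha+z\beta\rangle=\overline\alpha\langle x,y\rangle+\overline\beta\langle x,z\rangle$; $\mathcal{H}$ is also made into a left linear space by fixing a Hilbert basis, and $s\mathcal{I}$ denotes left multiplication by $s$. A right linear $U:\mathcal{H}\to\mathcal{H}$ is unitary if $U^{-1}=U^*$. $S$-spectrum: $\sigma_S(U)=\{s\in\mathbb{H}:U^2-2\mathrm{Re}(s)U+|s|^2\mathcal{I}\text{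 is not invertible}\}$ and $\rho_S(U)=\mathbb{H}\setminus\sigma_S(U)$. $S$-resolvent operators, for $s\in\rho_S(U)$: $S_L^{-1}(s,U)=-(U^2-2\mathrm{Re}(s)U+|s|^2\mathcal{I})^{-1}(U-\overline{s}\mathcal{I})$, $S_R^{-1}(s,U)=-(U-\overline{s}\mathcal{I})(U^2-2\mathrm{Re}(s)U+|s|^2\mathcal{I})^{-1}$. A set in $\mathbb{H}$ is axially symmetric if with each $u+Iv$ it contains $u+I'v$ for all $I'\in\mathbb{S}$. A spectral set is an axially symmetric subset $\sigma\subseteq\sigma_S(U)$ that is both open and closed in the relative topology of $\sigma_S(U)$. An s-domain is a domain $\Omega\subseteq\mathbb{H}$ with $\Omega\cap\mathbb{R}\neq\emptyset$ and $\Omega\cap\mathbb{C}_I$ a domain in $\mathbb{C}_I$ for all $I\in\mathbb{S}$. The Riesz projector of a spectral set $\sigma$ is $$\mathcal{P}(\sigma)=\frac{1}{2\pi}\int_{\partial(\Omega_\sigma\cap\mathbb{C}_I)}S_L^{-1}(s,U)\,ds_I=\frac{1}{2\pi}\int_{\partial(\Omega_\sigma\cap\mathbb{C}_I)}ds_I\,S_R^{-1}(s,U),\qquad ds_I=-ds\,I,$$ where $\Omega_\sigma$ is an axially symmetric s-domain containing $\sigma$ but no other points of $\sigma_S(U)$, such that the Jordan curves $\partial(\Omega_\sigma\cap\mathbb{C}_I)$ lie in $\rho_S(U)$ for every $I\in\mathbb{S}$. Spectral measure $E_J$: for $x,y\in\mathcal{H}$ let $\nu^{(J)}_{x,y}$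 be the unique $\mathbb{H}$-valued measure on the Borel sets of $[0,2\pi)$ with $\langle U^nx,y\rangle=\int_0^{2\pi}e^{Int}\,d\nu^{(J)}_{x,y}(t)$ for all $n\in\mathbb{Z}$; $E_J(\sigma)$ is given by $\nu^{(J)}_{x,y}(\sigma)=\langle E_J(\sigma)x,y\rangle$ for all $x,y\in\mathcal{H}$ and Borel $\sigma\subseteq[0,2\pi)$ (identified with Borel sets of the unit circle in $\mathbb{C}_I$ via $t\mapsto e^{It}$). The notation $E(t_1)-E(t_0)$ stands for $\int_0^{2\pi}\mathbf{1}_{[t_0,t_1]}\,dE(t)$, the spectral measure of the arc $[t_0,t_1]$.
   Formalization: Adds that the arc contains no points of the S-spectrum in C_I other than those of the spectral set; otherwise the claim fails, e.g. U=diag(1,-1), spectral set {1}, t_0=0, t_1=pi, where the projector is onto one coordinate but E(t_1)-E(t_0) is the identity. *)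

theory Defs
  imports "HOL-Complex_Analysis.Complex_Analysis"
begin

section \<open>The skew field of quaternions\<close>

datatype quat = Quat (qre: real) (qi: real) (qj: real) (qk: real)

lemma quat_eq_iff: "p = q \<longleftrightarrow> qre p = qre q \<and> qi p = qi q \<and> qj p = qj q \<and> qk p = qk q"
  by (cases p; cases q) simp

instantiation quat :: ab_group_add
begin

definition zero_quat :: quat where "0 = Quat 0 0 0 0"
definition plus_quat :: "quat \<Rightarrow> quat \<Rightarrow> quat" where
  "p + q = Quat (qre p + qre q) (qi p + qi q) (qj p + qj q) (qk p + qk q)"
definition uminus_quat :: "quat \<Rightarrow> quat" where
  "- p = Quat (- qre p) (- qi p) (- qj p) (- qk p)"
definition minus_quat :: "quat \<Rightarrow> quat \<Rightarrow> quat" where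
  "p - q = Quat (qre p - qre q) (qi p - qi q) (qj p - qj q) (qk p - qk q)"

instance
  by standard (simp_all add: zero_quat_def plus_quat_def uminus_quat_def minus_quat_def)

end

lemma quat_sel_add [simp]:
  "qre 0 = 0" "qi 0 = 0" "qj 0 = 0" "qk 0 = 0"
  "qre (p + q) = qre p + qre q" "qi (p + q) = qi p + qi q"
  "qj (p + q) = qj p + qj q" "qk (p + q) = qk p + qk q"
  "qre (- p) = - qre p" "qi (- p) = - qi p" "qj (- p) = - qj p" "qk (- p) = - qk p"
  "qre (p - q) = qre p - qre q" "qi (p - q) = qi p - qi q"
  "qj (p - q) = qj p - qj q" "qk (p - q) = qk p - qk q"
  by (simp_all add: zero_quat_def plus_quat_def uminus_quat_def minus_quat_def)

instantiation quat :: real_div_algebra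
begin

definition one_quat :: quat where "1 = Quat 1 0 0 0"
definition times_quat :: "quat \<Rightarrow> quat \<Rightarrow> quat" where
  "p * q = Quat
     (qre p * qre q - qi p * qi q - qj p * qj q - qk p * qk q)
     (qre p * qi q + qi p * qre q + qj p * qk q - qk p * qj q)
     (qre p * qj q - qi p * qk q + qj p * qre q + qk p * qi q)
     (qre p * qk q + qi p * qj q - qj p * qi q + qk p * qre q)"
definition scaleR_quat :: "real \<Rightarrow> quat \<Rightarrow> quat" where
  "scaleR r p = Quat (r * qre p) (r * qi p) (r * qj p) (r * qk p)"
definition inverse_quat :: "quat \<Rightarrow> quat" where
  "inverse p = (let d = (qre p)\<^sup>2 + (qi p)\<^sup>2 + (qj p)\<^sup>2 + (qk p)\<^sup>2 in
     Quat (qre p / d) (- qi p / d) (- qj p / d) (- qk p / d))"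
definition divide_quat :: "quat \<Rightarrow> quat \<Rightarrow> quat" where
  "p div q = p * inverse q" for p q :: quat

instance
proof
  fix p q r :: quat and a b :: real
  show "p * q * r = p * (q * r)"
    by (simp add: times_quat_def algebra_simps)
  show "(p + q) * r = p * r + q * r" "p * (q + r) = p * q + p * r"
    by (simp_all add: times_quat_def quat_eq_iff algebra_simps)
  show "1 * p = p" "p * 1 = p"
    by (simp_all add: times_quat_def one_quat_def)
  show "(0::quat) \<noteq> 1"
    by (simp add: zero_quat_def one_quat_def)
  show "a *\<^sub>R (p + q) = a *\<^sub>R p + a *\<^sub>R q" "(a + b) *\<^sub>R p = a *\<^sub>R p + b *\<^sub>R p"
    "a *\<^sub>R b *\<^sub>R p = (a * b) *\<^sub>R p" "1 *\<^sub>R p = p"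
    "a *\<^sub>R p * q = a *\<^sub>R (p * q)" "p * a *\<^sub>R q = a *\<^sub>R (p * q)"
    by (simp_all add: scaleR_quat_def times_quat_def quat_eq_iff algebra_simps)
  show "p div q = p * inverse q"
    by (simp add: divide_quat_def)
  show "inverse (0::quat) = 0"
    by (simp add: inverse_quat_def zero_quat_def)
  assume "p \<noteq> 0"
  define d where "d = (qre p)\<^sup>2 + (qi p)\<^sup>2 + (qj p)\<^sup>2 + (qk p)\<^sup>2"
  have "d \<noteq> 0"
  proof
    assume "d = 0"
    then have "(qre p)\<^sup>2 = 0 \<and> (qi p)\<^sup>2 = 0 \<and> (qj p)\<^sup>2 = 0 \<and> (qk p)\<^sup>2 = 0"
      unfolding d_def
      using zero_le_power2[of "qre p"] zero_le_power2[of "qi p"]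
        zero_le_power2[of "qj p"] zero_le_power2[of "qk p"] by linarith
    then show False using \<open>p \<noteq> 0\<close> by (simp add: quat_eq_iff)
  qed
  then show "inverse p * p = 1" "p * inverse p = 1"
    unfolding inverse_quat_def times_quat_def one_quat_def Let_def d_def[symmetric]
    by (simp_all add: field_simps) (simp_all add: d_def power2_eq_square)
qed

end

lemma quat_sel_mult [simp]:
  "qre 1 = 1" "qi 1 = 0" "qj 1 = 0" "qk 1 = 0"
  "qre (r *\<^sub>R p) = r * qre p" "qi (r *\<^sub>R p) = r * qi p"
  "qj (r *\<^sub>R p) = r * qj p" "qk (r *\<^sub>R p) = r * qk p"
  "qre (p * q) = qre p * qre q - qi p * qi q - qj p * qj q - qk p * qk q"
  "qi (p * q) = qre p * qi q + qi p * qre q + qj p * qk q - qk p * qj q"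
  "qj (p * q) = qre p * qj q - qi p * qk q + qj p * qre q + qk p * qi q"
  "qk (p * q) = qre p * qk q + qi p * qj q - qj p * qi q + qk p * qre q"
  by (simp_all add: one_quat_def times_quat_def scaleR_quat_def)

lemma quat_sel_of_real [simp]:
  "qre (of_real r) = r" "qi (of_real r) = 0" "qj (of_real r) = 0" "qk (of_real r) = 0"
  by (simp_all add: of_real_def)

instantiation quat :: real_normed_div_algebra
begin

definition norm_quat :: "quat \<Rightarrow> real" where
  "norm p = sqrt ((qre p)\<^sup>2 + (qi p)\<^sup>2 + (qj p)\<^sup>2 + (qk p)\<^sup>2)"
definition sgn_quat :: "quat \<Rightarrow> quat" where
  "sgn p = p /\<^sub>R norm p" for p :: quat
definition dist_quat :: "quat \<Rightarrow> quat \<Rightarrow> real" where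
  "dist p q = norm (p - q)" for p q :: quat
definition uniformity_quat :: "(quat \<times> quat) filter" where
  "(uniformity :: (quat \<times> quat) filter) = (INF e\<in>{0 <..}. principal {(x, y). dist x y < e})"
definition open_quat :: "quat set \<Rightarrow> bool" where
  "open S \<longleftrightarrow> (\<forall>x\<in>S. eventually (\<lambda>(x', y). x' = x \<longrightarrow> y \<in> S) uniformity)" for S :: "quat set"

instance
proof
  fix p q :: quat and a :: real
  have norm_pair: "norm p = norm (Complex (qre p) (qi p), Complex (qj p) (qk p))" for p :: quat
    by (simp add: norm_quat_def norm_Pair cmod_def algebra_simps)
  show "norm p = 0 \<longleftrightarrow> p = 0"
    by (auto simp: norm_pair quat_eq_iff zero_prod_def complex_eq_iff)
  show "norm (p + q) \<le> norm p + norm q"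
    using norm_triangle_ineq[of "(Complex (qre p) (qi p), Complex (qj p) (qk p))"
        "(Complex (qre q) (qi q), Complex (qj q) (qk q))"]
    by (simp add: norm_pair complex_add)
  have "(a *\<^sub>R Complex (qre p) (qi p), a *\<^sub>R Complex (qj p) (qk p)) =
      a *\<^sub>R (Complex (qre p) (qi p), Complex (qj p) (qk p))"
    by simp
  then show "norm (a *\<^sub>R p) = \<bar>a\<bar> * norm p"
    unfolding norm_pair using norm_scaleR by (metis complex_scaleR quat_sel_mult(5-8))
  have "(qre (p * q))\<^sup>2 + (qi (p * q))\<^sup>2 + (qj (p * q))\<^sup>2 + (qk (p * q))\<^sup>2 =
      ((qre p)\<^sup>2 + (qi p)\<^sup>2 + (qj p)\<^sup>2 + (qk p)\<^sup>2) *
      ((qre q)\<^sup>2 + (qi q)\<^sup>2 + (qj q)\<^sup>2 + (qk q)\<^sup>2)"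
    unfolding quat_sel_mult by (simp add: power2_eq_square algebra_simps)
  then show "norm (p * q) = norm p * norm q"
    by (simp only: norm_quat_def real_sqrt_mult)
qed (simp_all add: sgn_quat_def dist_quat_def uniformity_quat_def open_quat_def)

end

instantiation quat :: real_inner
begin

definition inner_quat :: "quat \<Rightarrow> quat \<Rightarrow> real" where
  "inner p q = qre p * qre q + qi p * qi q + qj p * qj q + qk p * qk q"

instance
proof
  fix p q r :: quat and a :: real
  show "inner p q = inner q p"
    "inner (p + q) r = inner p r + inner q r"
    "inner (a *\<^sub>R p) q = a * inner p q"
    "0 \<le> inner p p"
    by (simp_all add: inner_quat_def algebra_simps)
  show eq: "norm p = sqrt (inner p p)"
    by (simp add: inner_quat_def norm_quat_def power2_eq_square)
  show "inner p p = 0 \<longleftrightarrow> p = 0"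
    by (metis eq norm_eq_zero real_sqrt_eq_0_iff)
qed

end

instantiation quat :: euclidean_space
begin

definition Basis_quat :: "quat set" where
  "Basis = {Quat 1 0 0 0, Quat 0 1 0 0, Quat 0 0 1 0, Quat 0 0 0 1}"

instance
proof
  fix u v x :: quat
  show "(Basis :: quat set) \<noteq> {}" "finite (Basis :: quat set)"
    by (simp_all add: Basis_quat_def)
  show "inner u v = (if u = v then 1 else 0)" if "u \<in> Basis" "v \<in> Basis"
    using that unfolding Basis_quat_def by (elim insertE emptyE) (simp_all add: inner_quat_def)
  show "(\<forall>u\<in>Basis. inner x u = 0) \<longleftrightarrow> x = 0"
    unfolding quat_eq_iff by (simp add: Basis_quat_def inner_quat_def)
qed

end

definition qcnj :: "quat \<Rightarrow> quat" where
  "qcnj q = Quat (qre q) (- qi q) (- qj q) (- qk q)"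

definition imag_sphere :: "quat set" where
  "imag_sphere = {q. qre q = 0 \<and> norm q = 1}"

text \<open>For \<open>K\<close> in \<open>imag_sphere\<close>, \<open>emb K\<close> is the identification \<open>u + \<i>v \<mapsto> u + Kv\<close> of the complex
  numbers with the plane spanned by \<open>1\<close> and \<open>K\<close>; \<open>emb K (cis t)\<close> is the exponential of \<open>Kt\<close>, and
  \<open>slice K \<Omega>\<close> is the intersection of \<open>\<Omega>\<close> with that plane.\<close>

definition emb :: "quat \<Rightarrow> complex \<Rightarrow> quat" where
  "emb K z = of_real (Re z) + K * of_real (Im z)"

definition slice :: "quat \<Rightarrow> quat set \<Rightarrow> complex set" where
  "slice K \<Omega> = {z. emb K z \<in> \<Omega>}"

definition axially_symmetric :: "quat set \<Rightarrow> bool" where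
  "axially_symmetric \<Omega> \<longleftrightarrow>
     (\<forall>K\<in>imag_sphere. \<forall>K'\<in>imag_sphere. \<forall>z. emb K z \<in> \<Omega> \<longrightarrow> emb K' z \<in> \<Omega>)"

definition s_domain :: "quat set \<Rightarrow> bool" where
  "s_domain \<Omega> \<longleftrightarrow> open \<Omega> \<and> connected \<Omega> \<and> \<Omega> \<inter> range of_real \<noteq> {} \<and>
     (\<forall>K\<in>imag_sphere. open (slice K \<Omega>) \<and> connected (slice K \<Omega>))"


section \<open>Right linear quaternionic Hilbert spaces\<close>

text \<open>The remaining sesquilinearity law, conjugate linearity in the second argument, follows from
  \<open>qinner_cnj\<close>; \<open>qinner_self\<close> says that the value of the form at \<open>(x, x)\<close> is the squared norm,
  so it is nonnegative and vanishes only at \<open>x = 0\<close>. Completeness is part of \<open>banach\<close>.\<close>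

class quat_hilbert = banach +
  fixes scaleQ :: "'a \<Rightarrow> quat \<Rightarrow> 'a"  (infixl \<open>*\<^sub>Q\<close> 75)
    and qinner :: "'a \<Rightarrow> 'a \<Rightarrow> quat"
  assumes scaleQ_add_left: "(x + y) *\<^sub>Q a = x *\<^sub>Q a + y *\<^sub>Q a"
    and scaleQ_add_right: "x *\<^sub>Q (a + b) = x *\<^sub>Q a + x *\<^sub>Q b"
    and scaleQ_scaleQ: "(x *\<^sub>Q a) *\<^sub>Q b = x *\<^sub>Q (a * b)"
    and scaleQ_of_real: "x *\<^sub>Q of_real r = r *\<^sub>R x"
    and qinner_cnj: "qinner x y = qcnj (qinner y x)"
    and qinner_add_left: "qinner (x + y) z = qinner x z + qinner y z"
    and qinner_scaleQ_left: "qinner (x *\<^sub>Q a) y = qinner x y * a"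
    and qinner_self: "qinner x x = of_real ((norm x)\<^sup>2)"

instantiation quat :: quat_hilbert
begin

definition scaleQ_quat :: "quat \<Rightarrow> quat \<Rightarrow> quat" where "scaleQ_quat x a = x * a"
definition qinner_quat :: "quat \<Rightarrow> quat \<Rightarrow> quat" where "qinner_quat x y = qcnj y * x"

instance
proof
  fix x y z a b :: quat and r :: real
  show "(x + y) *\<^sub>Q a = x *\<^sub>Q a + y *\<^sub>Q a" "x *\<^sub>Q (a + b) = x *\<^sub>Q a + x *\<^sub>Q b"
    "(x *\<^sub>Q a) *\<^sub>Q b = x *\<^sub>Q (a * b)" "x *\<^sub>Q of_real r = r *\<^sub>R x"
    "qinner x y = qcnj (qinner y x)" "qinner (x + y) z = qinner x z + qinner y z"
    "qinner (x *\<^sub>Q a) y = qinner x y * a"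
    by (simp_all add: scaleQ_quat_def qinner_quat_def qcnj_def quat_eq_iff algebra_simps)
  show "qinner x x = of_real ((norm x)\<^sup>2)"
    by (simp add: qinner_quat_def qcnj_def quat_eq_iff norm_quat_def inner_quat_def
        power2_eq_square algebra_simps)
qed

end

definition hilbert_basis :: "'a::quat_hilbert set \<Rightarrow> bool" where
  "hilbert_basis B \<longleftrightarrow>
     (\<forall>b\<in>B. \<forall>b'\<in>B. qinner b b' = (if b = b' then 1 else 0)) \<and>
     (\<forall>x. ((\<lambda>b. b *\<^sub>Q qinner x b) has_sum x) B)"

text \<open>The left multiplication induced by a Hilbert basis: the unique right linear bounded operator
  with \<open>b \<mapsto> b s\<close> for \<open>b\<close> in \<open>B\<close>.\<close>

definition left_mult :: "'a::quat_hilbert set \<Rightarrow> quat \<Rightarrow> 'a \<Rightarrow> 'a" where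
  "left_mult B s x = (\<Sum>\<^sub>\<infinity>b\<in>B. b *\<^sub>Q (s * qinner x b))"

definition right_linear :: "('a::quat_hilbert \<Rightarrow> 'a) \<Rightarrow> bool" where
  "right_linear T \<longleftrightarrow> (\<forall>x y. T (x + y) = T x + T y) \<and> (\<forall>x a. T (x *\<^sub>Q a) = T x *\<^sub>Q a)"

text \<open>The last conjunct says that the inverse of \<open>U\<close> is its adjoint.\<close>

definition unitary :: "('a::quat_hilbert \<Rightarrow> 'a) \<Rightarrow> bool" where
  "unitary U \<longleftrightarrow> right_linear U \<and> bij U \<and> (\<forall>x y. qinner (U x) y = qinner x (inv U y))"

definition op_invertible :: "('a::quat_hilbert \<Rightarrow> 'a) \<Rightarrow> bool" where
  "op_invertible T \<longleftrightarrow>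
     (\<exists>S. right_linear S \<and> bounded_linear S \<and> (\<forall>x. S (T x) = x) \<and> (\<forall>x. T (S x) = x))"

definition op_int_power :: "('a \<Rightarrow> 'a) \<Rightarrow> int \<Rightarrow> 'a \<Rightarrow> 'a" where
  "op_int_power U n = (if 0 \<le> n then U ^^ nat n else inv U ^^ nat (- n))"


section \<open>S-spectrum, S-resolvents and Riesz projectors\<close>

definition S_pencil :: "('a::quat_hilbert \<Rightarrow> 'a) \<Rightarrow> quat \<Rightarrow> 'a \<Rightarrow> 'a" where
  "S_pencil U s x = U (U x) - (2 * qre s) *\<^sub>R U x + (norm s)\<^sup>2 *\<^sub>R x"

definition S_spectrum :: "('a::quat_hilbert \<Rightarrow> 'a) \<Rightarrow> quat set" where
  "S_spectrum U = {s. \<not> op_invertible (S_pencil U s)}"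

definition S_resolvent_set :: "('a::quat_hilbert \<Rightarrow> 'a) \<Rightarrow> quat set" where
  "S_resolvent_set U = - S_spectrum U"

definition S_resolvent_left ::
    "'a::quat_hilbert set \<Rightarrow> ('a \<Rightarrow> 'a) \<Rightarrow> quat \<Rightarrow> 'a \<Rightarrow> 'a" where
  "S_resolvent_left B U s x = - inv (S_pencil U s) (U x - left_mult B (qcnj s) x)"

definition S_resolvent_right ::
    "'a::quat_hilbert set \<Rightarrow> ('a \<Rightarrow> 'a) \<Rightarrow> quat \<Rightarrow> 'a \<Rightarrow> 'a" where
  "S_resolvent_right B U s x =
     - (U (inv (S_pencil U s) x) - left_mult B (qcnj s) (inv (S_pencil U s) x))"

definition spectral_set :: "('a::quat_hilbert \<Rightarrow> 'a) \<Rightarrow> quat set \<Rightarrow> bool" where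
  "spectral_set U \<sigma> \<longleftrightarrow> axially_symmetric \<sigma> \<and> \<sigma> \<subseteq> S_spectrum U \<and>
     openin (top_of_set (S_spectrum U)) \<sigma> \<and> closedin (top_of_set (S_spectrum U)) \<sigma>"

text \<open>The boundary of \<open>D\<close> consists of finitely many piecewise \<open>C1\<close> Jordan curves. The winding
  number condition expresses their positive orientation with respect to \<open>D\<close> (outer curve
  counterclockwise, inner curves clockwise); it also forces \<open>D\<close> to be bounded.\<close>

definition jordan_boundary :: "(real \<Rightarrow> complex) set \<Rightarrow> complex set \<Rightarrow> bool" where
  "jordan_boundary \<Gamma> D \<longleftrightarrow> finite \<Gamma> \<and>
     (\<forall>\<gamma>\<in>\<Gamma>. valid_path \<gamma> \<and> simple_path \<gamma> \<and> pathfinish \<gamma> = pathstart \<gamma>) \<and>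
     (\<forall>\<gamma>\<in>\<Gamma>. \<forall>\<delta>\<in>\<Gamma>. \<gamma> \<noteq> \<delta> \<longrightarrow> path_image \<gamma> \<inter> path_image \<delta> = {}) \<and>
     (\<Union>\<gamma>\<in>\<Gamma>. path_image \<gamma>) = frontier D \<and>
     (\<forall>z. z \<notin> frontier D \<longrightarrow> (\<Sum>\<gamma>\<in>\<Gamma>. winding_number \<gamma> z) = (if z \<in> D then 1 else 0))"

definition riesz_domain :: "('a::quat_hilbert \<Rightarrow> 'a) \<Rightarrow> quat set \<Rightarrow> quat set \<Rightarrow> bool" where
  "riesz_domain U \<sigma> \<Omega> \<longleftrightarrow> axially_symmetric \<Omega> \<and> s_domain \<Omega> \<and> \<Omega> \<inter> S_spectrum U = \<sigma> \<and>
     (\<forall>K\<in>imag_sphere. (\<exists>\<Gamma>. jordan_boundary \<Gamma> (slice K \<Omega>)) \<and>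
        emb K ` frontier (slice K \<Omega>) \<subseteq> S_resolvent_set U)"

text \<open>In the next two definitions \<open>\<Gamma>\<close> parametrises the boundary of the slice of the domain, and
  \<open>slice_form I \<gamma> \<tau>\<close> is the density of \<open>- ds I\<close> in the parameter. Operator integrals are evaluated
  pointwise.\<close>

definition slice_form :: "quat \<Rightarrow> (real \<Rightarrow> complex) \<Rightarrow> real \<Rightarrow> quat" where
  "slice_form I \<gamma> \<tau> = - (emb I (vector_derivative \<gamma> (at \<tau> within {0..1})) * I)"

definition riesz_projector_left ::
    "'a::quat_hilbert set \<Rightarrow> quat \<Rightarrow> ('a \<Rightarrow> 'a) \<Rightarrow> (real \<Rightarrow> complex) set \<Rightarrow> 'a \<Rightarrow> 'a" where
  "riesz_projector_left B I U \<Gamma> x = (1 / (2 * pi)) *\<^sub>R (\<Sum>\<gamma>\<in>\<Gamma>. integral {0..1}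
     (\<lambda>\<tau>. S_resolvent_left B U (emb I (\<gamma> \<tau>)) (left_mult B (slice_form I \<gamma> \<tau>) x)))"

definition riesz_projector_right ::
    "'a::quat_hilbert set \<Rightarrow> quat \<Rightarrow> ('a \<Rightarrow> 'a) \<Rightarrow> (real \<Rightarrow> complex) set \<Rightarrow> 'a \<Rightarrow> 'a" where
  "riesz_projector_right B I U \<Gamma> x = (1 / (2 * pi)) *\<^sub>R (\<Sum>\<gamma>\<in>\<Gamma>. integral {0..1}
     (\<lambda>\<tau>. left_mult B (slice_form I \<gamma> \<tau>) (S_resolvent_right B U (emb I (\<gamma> \<tau>)) x)))"


section \<open>Quaternion-valued measures\<close>

definition quat_measure :: "'b measure \<Rightarrow> ('b set \<Rightarrow> quat) \<Rightarrow> bool" where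
  "quat_measure M \<nu> \<longleftrightarrow> (\<forall>A::nat \<Rightarrow> 'b set. range A \<subseteq> sets M \<longrightarrow> disjoint_family A \<longrightarrow>
     (\<lambda>i. \<nu> (A i)) sums \<nu> (\<Union>i. A i))"

text \<open>Integration against a signed measure \<open>m\<close> uses its Jordan decomposition;
  \<open>upper_variation M m\<close> is the positive part of \<open>m\<close>, and that of \<open>- m\<close> is the negative part.\<close>

definition upper_variation :: "'b measure \<Rightarrow> ('b set \<Rightarrow> real) \<Rightarrow> 'b measure" where
  "upper_variation M m =
     measure_of (space M) (sets M) (\<lambda>A. SUP S\<in>{S \<in> sets M. S \<subseteq> A}. ennreal (m S))"

definition signed_integral :: "'b measure \<Rightarrow> ('b set \<Rightarrow> real) \<Rightarrow> ('b \<Rightarrow> quat) \<Rightarrow> quat" where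
  "signed_integral M m f =
     integral\<^sup>L (upper_variation M m) f - integral\<^sup>L (upper_variation M (\<lambda>A. - m A)) f"

text \<open>The integrand stands to the left of the measure.\<close>

definition quat_integral :: "'b measure \<Rightarrow> ('b set \<Rightarrow> quat) \<Rightarrow> ('b \<Rightarrow> quat) \<Rightarrow> quat" where
  "quat_integral M \<nu> f =
     signed_integral M (\<lambda>A. qre (\<nu> A)) f
     + signed_integral M (\<lambda>A. qi (\<nu> A)) f * Quat 0 1 0 0
     + signed_integral M (\<lambda>A. qj (\<nu> A)) f * Quat 0 0 1 0
     + signed_integral M (\<lambda>A. qk (\<nu> A)) f * Quat 0 0 0 1"


section \<open>The spectral measure of a unitary operator\<close>

abbreviation circle_borel :: "real measure" where
  "circle_borel \<equiv> restrict_space borel {0..<2 * pi}"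

text \<open>\<open>moment_measure I U x y \<nu>\<close> is the property that determines the measure of the pair \<open>x, y\<close>.
  It does not involve the unit \<open>J\<close> orthogonal to \<open>I\<close>, which only serves to split \<open>\<nu>\<close> into two
  measures with values in the plane of \<open>I\<close>.\<close>

definition moment_measure ::
    "quat \<Rightarrow> ('a::quat_hilbert \<Rightarrow> 'a) \<Rightarrow> 'a \<Rightarrow> 'a \<Rightarrow> (real set \<Rightarrow> quat) \<Rightarrow> bool" where
  "moment_measure I U x y \<nu> \<longleftrightarrow> quat_measure circle_borel \<nu> \<and>
     (\<forall>n::int. qinner (op_int_power U n x) y =
        quat_integral circle_borel \<nu> (\<lambda>t. emb I (cis (of_int n * t))))"

text \<open>The definite description is taken for each set separately: an operator representing
  \<open>\<nu>\<close> on \<open>A\<close> is unique, but when \<open>A\<close> does not correspond to a conjugation invariant part of the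
  spectrum there need not be one, since \<open>\<nu> x y A\<close> is conjugate linear in \<open>y\<close> only over the plane
  of \<open>I\<close>.\<close>

definition spectral_measure ::
    "('a::quat_hilbert \<Rightarrow> 'a \<Rightarrow> real set \<Rightarrow> quat) \<Rightarrow> real set \<Rightarrow> 'a \<Rightarrow> 'a" where
  "spectral_measure \<nu> A = (THE T. \<forall>x y. \<nu> x y A = qinner (T x) y)"

text \<open>Borel subsets of the unit circle are identified with Borel subsets of \<open>[0, 2\<pi>)\<close>. The end
  points are arbitrary reals, so that arcs through \<open>1\<close> and the whole circle are covered; for
  \<open>0 \<le> t0 \<le> t1 < 2\<pi>\<close> the parameter set is just \<open>{t0..t1}\<close>.\<close>

definition circle_arc :: "real \<Rightarrow> real \<Rightarrow> complex set" where
  "circle_arc t0 t1 = cis ` {t0..t1}"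

definition arc_params :: "real \<Rightarrow> real \<Rightarrow> real set" where
  "arc_params t0 t1 = {t \<in> {0..<2 * pi}. cis t \<in> circle_arc t0 t1}"

lemma arc_params_eq:
  assumes "0 \<le> t0" "t1 < 2 * pi"
  shows "arc_params t0 t1 = {t0..t1}"
proof -
  have "t = s" if "cis t = cis s" "t \<in> {0..<2 * pi}" "s \<in> {t0..t1}" for t s
  proof -
    have "\<bar>t - s\<bar> < 2 * pi" using that assms by auto
    moreover have "cos t = cos s" "sin t = sin s"
      using that(1) by (simp_all add: complex_eq_iff)
    then have "\<exists>n::int. t = s + 2 * of_int n * pi"
      using sin_cos_eq_iff[of t s] by (simp add: mult_ac)
    then obtain n :: int where n: "t = s + 2 * of_int n * pi" ..
    ultimately have "\<bar>of_int n :: real\<bar> * (2 * pi) < 1 * (2 * pi)"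
      by (simp add: abs_mult)
    then have "\<bar>of_int n :: real\<bar> < 1"
      using mult_less_cancel_right_pos[of "2 * pi"] by simp
    then have "n = 0" by linarith
    with n show ?thesis by simp
  qed
  with assms show ?thesis by (fastforce simp: arc_params_def circle_arc_def)
qed

end

theory Submission
  imports Defs
begin

text \<open>
  The idea is to complexify. For \<open>z\<close> off the spectrum let \<open>Q\<close> be the pencil
  \<open>U\<^sup>2 - 2 Re z U + \<bar>z\<bar>\<^sup>2\<close>. The real operators \<open>Q\<inverse> (U - Re z)\<close> and \<open>Im z Q\<inverse>\<close> are the real
  and the imaginary part of the ordinary resolvent \<open>R(z) = (U - z)\<inverse>\<close> of \<open>U\<close> on the complexification
  of the underlying real Hilbert space. Left multiplication by \<open>u + Iv\<close> is \<open>u + v L\<close>, where \<open>L\<close> is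
  left multiplication by \<open>I\<close>. Writing \<open>- \<i> R(z) dz = A + \<i> B\<close> with real operator valued forms \<open>A\<close>
  and \<open>B\<close>, the integrands of the two Riesz projectors at \<open>x\<close> become \<open>- (A x + B L x)\<close> and
  \<open>- (A x + L B x)\<close> (\<open>resolvent_forms\<close>). Hence both projectors equal the spectral measure of the arc
  once \<open>B\<close> integrates to zero and \<open>A\<close> integrates to \<open>- 2\<pi>\<close> times that spectral measure.

  These two integrals are scalar questions. For a quaternion \<open>p\<close> the map
  \<open>q \<mapsto> Re (q p) - \<i> Re (I q p)\<close> is complex linear for multiplication from the left by elements of
  the plane of \<open>I\<close>. It turns \<open>\<nu> x y\<close> into a complex measure \<open>\<lambda>\<close> on the unit circle and the matrix coefficient of \<open>R(z)\<close> into a function \<open>f\<close>. The moments of \<open>\<lambda>\<close> are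
  those of \<open>U\<close>, so \<open>f\<close> is the Cauchy transform of \<open>\<lambda>\<close> off the circle
  (\<open>resolvent_pairing_eq_Lam\<close>). Since the resolvent is continuous across the gaps of the spectrum,
  the jump of the Cauchy transform, which is a Poisson integral of the measure \<open>cnj w d\<lambda>(w)\<close>, tends to zero there, and
  \<open>\<lambda>\<close> has no mass outside the spectrum (\<open>Lam_vanishes_off_K\<close>). Interchanging the two
  integrations, the integral of \<open>f\<close> over the boundary is \<open>- 2\<pi>\<i> \<lambda>(arc)\<close>
  (\<open>sum_contour_integral_eq_Lam\<close>). The spectrum and the domain are invariant under conjugation,
  so the integral of \<open>z \<mapsto> cnj (f (cnj z))\<close> is \<open>- 2\<pi>\<i>\<close> times the conjugate of \<open>\<lambda>(arc)\<close>. The mean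
  of the two functions is the coefficient of \<open>R(z)\<close> with respect to \<open>q \<mapsto> Re (q p)\<close>, and its integral is \<open>- 2\<pi>\<i>\<close> times a real number
  (\<open>pairing_contour\<close>). That it is purely imaginary says that \<open>B\<close> integrates to zero, and its value
  gives the integral of \<open>A\<close>.

  A path that is continuous and piecewise \<open>C1\<close> may have an unbounded derivative and infinite length
  near its corners. Therefore the interchange of integrations is carried out on polynomial
  approximations of the boundary, and the vector valued integrals exist because the integrands are
  locally exact (\<open>one_form_integrable_along_valid_path\<close>), not by absolute convergence.
\<close>

section \<open>Jordan decomposition of signed measures\<close>

definition signed_measure :: "'b measure \<Rightarrow> ('b set \<Rightarrow> real) \<Rightarrow> bool" where
  "signed_measure M m \<longleftrightarrow> (\<forall>A::nat \<Rightarrow> 'b set. range A \<subseteq> sets M \<longrightarrow> disjoint_family A \<longrightarrow>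
     (\<lambda>i. m (A i)) sums m (\<Union>i. A i))"

lemma signed_measure_empty:
  assumes "signed_measure M m" shows "m {} = 0"
proof -
  have "(\<lambda>i::nat. m {}) sums m (\<Union>i::nat. {})"
    using assms[unfolded signed_measure_def, rule_format, of "\<lambda>_. {}"]
    by (simp add: disjoint_family_on_def)
  then have "summable (\<lambda>i::nat. m {})" by (rule sums_summable)
  then show ?thesis by (simp add: summable_const_iff)
qed

lemma signed_measure_Un:
  assumes "signed_measure M m" "A \<in> sets M" "B \<in> sets M" "A \<inter> B = {}"
  shows "m (A \<union> B) = m A + m B"
proof -
  have "(\<lambda>i. m (binaryset A B i)) sums m (\<Union>i. binaryset A B i)"
    using assms by (intro assms(1)[unfolded signed_measure_def, rule_format])
      (auto simp: range_binaryset_eq disjoint_family_on_def binaryset_def)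
  moreover have "(\<lambda>i. m (binaryset A B i)) sums (m A + m B)"
    by (rule binaryset_sums) (rule signed_measure_empty[OF assms(1)])
  ultimately show ?thesis
    by (simp add: UN_binaryset_eq sums_unique2)
qed

lemma signed_measure_Diff:
  assumes "signed_measure M m" "A \<in> sets M" "B \<in> sets M" "B \<subseteq> A"
  shows "m (A - B) = m A - m B"
proof -
  have "B \<union> (A - B) = A" using assms by auto
  with signed_measure_Un[OF assms(1,3), of "A - B"] assms show ?thesis by auto
qed

lemma signed_measure_uminus: "signed_measure M m \<Longrightarrow> signed_measure M (\<lambda>A. - m A)"
  unfolding signed_measure_def by (auto intro: sums_minus)

text \<open>If the values on subsets of a set are unbounded, the set splits into two pieces of measure at
  least one in absolute value, one of which again has unbounded subsets. Iterating this would
  produce a disjoint sequence of sets whose measures do not tend to zero.\<close>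

lemma signed_measure_bounded:
  assumes m: "signed_measure M m"
  obtains C where "\<And>A. A \<in> sets M \<Longrightarrow> \<bar>m A\<bar> \<le> C"
proof -
  define bad where "bad A \<longleftrightarrow> A \<in> sets M \<and> (\<forall>C. \<exists>S\<in>sets M. S \<subseteq> A \<and> \<bar>m S\<bar> > C)" for A
  have bounded: "\<exists>C. \<forall>T\<in>sets M. T \<subseteq> A \<longrightarrow> \<bar>m T\<bar> \<le> C" if "A \<in> sets M" "\<not> bad A" for A
  proof -
    have "\<not> (\<forall>C. \<exists>S\<in>sets M. S \<subseteq> A \<and> \<bar>m S\<bar> > C)"
        using that unfolding bad_def by blast
    then show ?thesis by (simp add: not_less)
  qed
  have step: "\<exists>A'. bad A' \<and> A' \<subseteq> A \<and> \<bar>m (A - A')\<bar> \<ge> 1" if "bad A" for A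
  proof -
    have A: "A \<in> sets M" and "\<forall>C. \<exists>S\<in>sets M. S \<subseteq> A \<and> \<bar>m S\<bar> > C"
      using that unfolding bad_def by blast+
    from this(2)[THEN spec, of "1 + \<bar>m A\<bar>"]
    obtain S where S: "S \<in> sets M" "S \<subseteq> A" "\<bar>m S\<bar> > 1 + \<bar>m A\<bar>"
      by blast
    have d: "m (A - S) = m A - m S" by (rule signed_measure_Diff) (use m A S in auto)
    have "bad S \<or> bad (A - S)"
    proof (rule ccontr)
      assume "\<not> ?thesis"
      then have nb: "\<not> bad S" "\<not> bad (A - S)" by blast+
      have "A - S \<in> sets M" using A S by auto
      obtain C where C: "\<forall>T\<in>sets M. T \<subseteq> S \<longrightarrow> \<bar>m T\<bar> \<le> C"
        using bounded[OF S(1) nb(1)] by blast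
      obtain D where D: "\<forall>T\<in>sets M. T \<subseteq> A - S \<longrightarrow> \<bar>m T\<bar> \<le> D"
        using bounded[OF \<open>A - S \<in> sets M\<close> nb(2)] by blast
      have "\<bar>m T\<bar> \<le> C + D" if T: "T \<in> sets M" "T \<subseteq> A" for T
      proof -
        have "m T = m (T \<inter> S) + m (T - S)"
          using signed_measure_Un[OF m, of "T \<inter> S" "T - S"] T S
          by (simp add: Int_Diff_Un Int_Diff_disjoint)
        moreover have "\<bar>m (T \<inter> S)\<bar> \<le> C" using C[rule_format, of "T \<inter> S"] T S by auto
        moreover have "\<bar>m (T - S)\<bar> \<le> D" using D[rule_format, of "T - S"] T S by auto
        ultimately show ?thesis by linarith
      qed
      moreover obtain T where "T \<in> sets M" "T \<subseteq> A" "\<bar>m T\<bar> > C + D"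
        using \<open>bad A\<close> unfolding bad_def by blast
      ultimately show False by force
    qed
    then show ?thesis
    proof
      assume "bad S"
      then show ?thesis using S d by (intro exI[of _ S]) auto
    next
      assume "bad (A - S)"
      moreover have "A - (A - S) = S" using S by auto
      ultimately show ?thesis using S by (intro exI[of _ "A - S"]) auto
    qed
  qed
  have "\<not> bad (space M)"
  proof
    assume b: "bad (space M)"
    have "\<exists>R. \<forall>n::nat. bad (R n) \<and> (R (Suc n) \<subseteq> R n \<and> \<bar>m (R n - R (Suc n))\<bar> \<ge> 1)"
    proof (rule dependent_nat_choice)
      show "\<exists>A. bad A" using b ..
      show "\<exists>A'. bad A' \<and> A' \<subseteq> A \<and> \<bar>m (A - A')\<bar> \<ge> 1" if "bad A" for A
        using step[OF that] .
    qed
    then obtain R where R: "bad (R n)" "R (Suc n) \<subseteq> R n" "\<bar>m (R n - R (Suc n))\<bar> \<ge> 1" for n :: nat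
      by blast
    have dec: "R n \<subseteq> R k" if "k \<le> n" for k n
      by (rule lift_Suc_antimono_le[of R, OF R(2) that])
    have "disjoint_family (\<lambda>n. R n - R (Suc n))"
      unfolding disjoint_family_on_def
    proof (intro ballI impI)
      fix i j :: nat assume "i \<noteq> j"
      then show "(R i - R (Suc i)) \<inter> (R j - R (Suc j)) = {}"
        using dec[of "Suc i" j] dec[of "Suc j" i] by (cases "i < j") auto
    qed
    moreover have "range (\<lambda>n. R n - R (Suc n)) \<subseteq> sets M"
      using R(1) by (auto simp: bad_def)
    ultimately have "(\<lambda>n. m (R n - R (Suc n))) sums m (\<Union>n. R n - R (Suc n))"
      using m unfolding signed_measure_def by blast
    then have "summable (\<lambda>n. m (R n - R (Suc n)))" by (rule sums_summable)
    then have "(\<lambda>n. m (R n - R (Suc n))) \<longlonglongrightarrow> 0" by (rule summable_LIMSEQ_zero)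
    from tendstoD[OF this zero_less_one]
    have "eventually (\<lambda>n. \<bar>m (R n - R (Suc n))\<bar> < 1) sequentially"
      by (simp add: dist_real_def)
    then obtain n where "\<bar>m (R n - R (Suc n))\<bar> < 1"
      unfolding eventually_sequentially by blast
    then show False using R(3)[of n] by simp
  qed
  then obtain C where "\<forall>S\<in>sets M. S \<subseteq> space M \<longrightarrow> \<bar>m S\<bar> \<le> C"
    using bounded[OF sets.top] by blast
  then show ?thesis using that[of C] sets.sets_into_space by (metis (no_types))
qed

text \<open>The content is that the supremum over subsets is countably additive. Intersecting a competitor
  with the pieces gives one inequality; uniting competitors of finitely many pieces gives the
  other, where a competitor of negative measure is replaced by the empty set.\<close>

lemma emeasure_upper_variation:
  assumes m: "signed_measure M m" and A: "A \<in> sets M"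
  shows "emeasure (upper_variation M m) A = (SUP S\<in>{S \<in> sets M. S \<subseteq> A}. ennreal (m S))"
  unfolding upper_variation_def
proof (rule emeasure_measure_of_sigma)
  let ?v = "\<lambda>A. SUP S\<in>{S \<in> sets M. S \<subseteq> A}. ennreal (m S)"
  note m0 = signed_measure_empty[OF m]
  show "sigma_algebra (space M) (sets M)" by (rule sets.sigma_algebra_axioms)
  show "A \<in> sets M" by (rule A)
  have "{S \<in> sets M. S \<subseteq> {}} = {{}}" by auto
  then show "positive (sets M) ?v"
    unfolding positive_def using m0 by simp
  show "countably_additive (sets M) ?v"
  proof (rule countably_additiveI)
    fix A :: "nat \<Rightarrow> 'a set"
    assume rA: "range A \<subseteq> sets M" and dA: "disjoint_family A" and UA: "(\<Union>i. A i) \<in> sets M"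
    show "(\<Sum>i. ?v (A i)) = ?v (\<Union>i. A i)"
    proof (rule antisym)
      show "?v (\<Union>i. A i) \<le> (\<Sum>i. ?v (A i))"
      proof (rule SUP_least)
        fix S assume S: "S \<in> {S \<in> sets M. S \<subseteq> (\<Union>i. A i)}"
        have "(\<lambda>i. m (S \<inter> A i)) sums m (\<Union>i. S \<inter> A i)"
          using S rA dA
          by (intro m[unfolded signed_measure_def, rule_format]) (auto simp: disjoint_family_on_def)
        moreover have "(\<Union>i. S \<inter> A i) = S" using S by auto
        ultimately have sm: "(\<lambda>i. m (S \<inter> A i)) sums m S" by simp
        have le: "ennreal (m (S \<inter> A i)) \<le> ?v (A i)" for i
          by (rule SUP_upper) (use S rA in auto)
        show "ennreal (m S) \<le> (\<Sum>i. ?v (A i))"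
        proof (rule LIMSEQ_le_const2)
          show "(\<lambda>n. ennreal (\<Sum>i<n. m (S \<inter> A i))) \<longlonglongrightarrow> ennreal (m S)"
            using sm unfolding sums_def by (intro tendsto_ennrealI)
          have "ennreal (\<Sum>i<n. m (S \<inter> A i)) \<le> (\<Sum>i. ?v (A i))" for n
          proof -
            have "ennreal (\<Sum>i<n. m (S \<inter> A i)) \<le> ennreal (\<Sum>i<n. max 0 (m (S \<inter> A i)))"
              by (intro ennreal_leI sum_mono) auto
            also have "\<dots> = (\<Sum>i<n. ennreal (max 0 (m (S \<inter> A i))))"
              by (rule sum_ennreal[symmetric]) auto
            also have "\<dots> \<le> (\<Sum>i<n. ?v (A i))"
            proof (rule sum_mono)
              fix i
              have "ennreal (max 0 (m (S \<inter> A i))) = ennreal (m (S \<inter> A i))"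
                by (simp add: max_def ennreal_neg)
              then show "ennreal (max 0 (m (S \<inter> A i))) \<le> ?v (A i)" using le[of i] by simp
            qed
            also have "\<dots> \<le> (\<Sum>i. ?v (A i))"
              by (rule sum_le_suminf) auto
            finally show ?thesis .
          qed
          then show "\<exists>N. \<forall>n\<ge>N. ennreal (\<Sum>i<n. m (S \<inter> A i)) \<le> (\<Sum>i. ?v (A i))" by auto
        qed
      qed
      have fin: "(\<Sum>i<n. ?v (A i)) \<le> ?v (\<Union>i<n. A i)" for n
      proof (induction n)
        case 0
        then show ?case by simp
      next
        case (Suc n)
        have "?v P + ?v Q \<le> ?v (P \<union> Q)" if PQ: "P \<in> sets M" "Q \<in> sets M" "P \<inter> Q = {}" for P Q
        proof -
          have "ennreal (m X) + ennreal (m Y) \<le> ?v (P \<union> Q)"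
            if "X \<in> sets M" "X \<subseteq> P" "Y \<in> sets M" "Y \<subseteq> Q" for X Y
          proof -
            define X' where "X' = (if m X \<ge> 0 then X else {})"
            define Y' where "Y' = (if m Y \<ge> 0 then Y else {})"
            have "ennreal (m X) + ennreal (m Y) = ennreal (m X' + m Y')"
            proof -
              have "ennreal (m X) = ennreal (m X')" "0 \<le> m X'" "ennreal (m Y) = ennreal (m Y')" "0 \<le> m Y'"
                unfolding X'_def Y'_def using m0 by (simp_all add: ennreal_neg)
              then show ?thesis by simp
            qed
            also have "m X' + m Y' = m (X' \<union> Y')"
              by (rule signed_measure_Un[OF m, symmetric]) (use that PQ in \<open>auto simp: X'_def Y'_def\<close>)
            also have "ennreal (m (X' \<union> Y')) \<le> ?v (P \<union> Q)"
              by (rule SUP_upper) (use that in \<open>auto simp: X'_def Y'_def\<close>)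
            finally show ?thesis .
          qed
          note le = this
          have neP: "{S \<in> sets M. S \<subseteq> P} \<noteq> {}" and neQ: "{S \<in> sets M. S \<subseteq> Q} \<noteq> {}" by auto
          show ?thesis
            unfolding ennreal_SUP_add_left[OF neP, symmetric]
          proof (rule SUP_least)
            fix X assume X: "X \<in> {S \<in> sets M. S \<subseteq> P}"
            show "ennreal (m X) + ?v Q \<le> ?v (P \<union> Q)"
              unfolding ennreal_SUP_add_right[OF neQ]
              by (rule SUP_least, rule le) (use X in auto)
          qed
        qed
        note add = this
        have "(\<Sum>i<Suc n. ?v (A i)) \<le> ?v (\<Union>i<n. A i) + ?v (A n)"
          unfolding sum.lessThan_Suc by (rule add_right_mono[OF Suc])
        also have "\<dots> \<le> ?v ((\<Union>i<n. A i) \<union> A n)"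
        proof (rule add)
          have "A i \<inter> A n = {}" if "i < n" for i
            using dA that by (intro disjoint_family_onD) auto
          then show "(\<Union>i<n. A i) \<inter> A n = {}" by blast
          have AM: "A i \<in> sets M" for i using rA by auto
          show "A n \<in> sets M" by (rule AM)
          show "(\<Union>i<n. A i) \<in> sets M" using AM by (intro sets.finite_UN) simp_all
        qed
        also have "(\<Union>i<n. A i) \<union> A n = (\<Union>i<Suc n. A i)"
          by (simp add: lessThan_Suc Un_commute)
        finally show ?case .
      qed
      show "(\<Sum>i. ?v (A i)) \<le> ?v (\<Union>i. A i)"
      proof (rule suminf_le_const)
        show "(\<Sum>i<n. ?v (A i)) \<le> ?v (\<Union>i. A i)" for n
          by (rule order_trans[OF fin]) (rule SUP_subset_mono, auto)
      qed auto
    qed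
  qed
qed

lemma sets_upper_variation [simp]: "sets (upper_variation M m) = sets M"
  unfolding upper_variation_def by (simp add: sets.space_closed sets.sigma_sets_eq)

lemma space_upper_variation [simp]: "space (upper_variation M m) = space M"
  unfolding upper_variation_def by (simp add: sets.space_closed space_measure_of)

lemma finite_upper_variation:
  assumes m: "signed_measure M m"
  shows "finite_measure (upper_variation M m)"
proof
  obtain C where C: "\<And>A. A \<in> sets M \<Longrightarrow> \<bar>m A\<bar> \<le> C" using signed_measure_bounded[OF m] by blast
  have "emeasure (upper_variation M m) (space M) \<le> ennreal C"
    unfolding emeasure_upper_variation[OF m sets.top]
    by (rule SUP_least) (use C in \<open>auto intro!: ennreal_leI simp: abs_le_iff\<close>)
  then show "emeasure (upper_variation M m) (space (upper_variation M m)) \<noteq> \<infinity>"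
    by (auto simp: top_unique)
qed

text \<open>Passing to the complement in \<open>A\<close> turns a competitor for \<open>- m\<close> into one
  for \<open>m\<close>, up to the constant \<open>m A\<close>; as both suprema are finite they may
  be subtracted.\<close>

lemma Jordan_decomposition:
  assumes m: "signed_measure M m" and A: "A \<in> sets M"
  shows "m A = measure (upper_variation M m) A - measure (upper_variation M (\<lambda>A. - m A)) A"
proof -
  obtain C where C: "\<And>S. S \<in> sets M \<Longrightarrow> \<bar>m S\<bar> \<le> C" using signed_measure_bounded[OF m] by blast
  let ?F = "{S \<in> sets M. S \<subseteq> A}"
  have ne: "?F \<noteq> {}" by auto
  have bdd: "bdd_above (m ` ?F)" "bdd_above ((\<lambda>S. - m S) ` ?F)"
    using C by (auto simp: abs_le_iff intro!: bdd_aboveI2[where M = C])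
  have meas: "measure (upper_variation M m') A = (SUP S\<in>?F. m' S)"
    if m': "signed_measure M m'" and b: "bdd_above (m' ` ?F)" for m'
  proof -
    have "0 \<le> (SUP S\<in>?F. m' S)"
      using cSUP_upper[OF _ b, of "{}"] signed_measure_empty[OF m'] by auto
    moreover have "emeasure (upper_variation M m') A = ennreal (SUP S\<in>?F. m' S)"
      unfolding emeasure_upper_variation[OF m' A]
    proof (rule antisym)
      show "(SUP S\<in>?F. ennreal (m' S)) \<le> ennreal (SUP S\<in>?F. m' S)"
        by (intro SUP_least ennreal_leI cSUP_upper b)
      show "ennreal (SUP S\<in>?F. m' S) \<le> (SUP S\<in>?F. ennreal (m' S))"
      proof (rule ennreal_le_epsilon)
        fix \<epsilon> :: real assume "0 < \<epsilon>"
        then have "(SUP S\<in>?F. m' S) - \<epsilon> < (SUP S\<in>?F. m' S)" by simp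
        then obtain T where T: "T \<in> ?F" "(SUP S\<in>?F. m' S) - \<epsilon> < m' T"
          using less_cSUP_iff[OF ne b] by blast
        have "ennreal (SUP S\<in>?F. m' S) \<le> ennreal (max 0 (m' T) + \<epsilon>)"
          using T by (intro ennreal_leI) auto
        also have "\<dots> = ennreal (m' T) + ennreal \<epsilon>"
          using \<open>0 < \<epsilon>\<close> by (simp add: max_def ennreal_neg)
        also have "\<dots> \<le> (SUP S\<in>?F. ennreal (m' S)) + ennreal \<epsilon>"
          by (intro add_right_mono SUP_upper T)
        finally show "ennreal (SUP S\<in>?F. m' S) \<le> (SUP S\<in>?F. ennreal (m' S)) + ennreal \<epsilon>" .
      qed
    qed
    ultimately show ?thesis by (simp add: measure_def)
  qed
  have eq: "(SUP S\<in>?F. - m S) = (SUP S\<in>?F. m S) - m A"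
  proof (rule antisym)
    show "(SUP S\<in>?F. - m S) \<le> (SUP S\<in>?F. m S) - m A"
    proof (rule cSUP_least[OF ne])
      fix S assume S: "S \<in> ?F"
      have "m (A - S) \<le> (SUP S\<in>?F. m S)"
        by (rule cSUP_upper[OF _ bdd(1)]) (use S A in auto)
      then show "- m S \<le> (SUP S\<in>?F. m S) - m A"
        using signed_measure_Diff[OF m A, of S] S by auto
    qed
    have "(SUP S\<in>?F. m S) \<le> (SUP S\<in>?F. - m S) + m A"
    proof (rule cSUP_least[OF ne])
      fix S assume S: "S \<in> ?F"
      have "- m (A - S) \<le> (SUP S\<in>?F. - m S)"
        by (rule cSUP_upper[OF _ bdd(2)]) (use S A in auto)
      then show "m S \<le> (SUP S\<in>?F. - m S) + m A"
        using signed_measure_Diff[OF m A, of S] S by auto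
    qed
    then show "(SUP S\<in>?F. m S) - m A \<le> (SUP S\<in>?F. - m S)" by simp
  qed
  show ?thesis
    using meas[OF m bdd(1)] meas[OF signed_measure_uminus[OF m] bdd(2)] eq by simp
qed

section \<open>The Poisson kernel\<close>

definition poisson_kernel :: "real \<Rightarrow> complex \<Rightarrow> complex \<Rightarrow> real" where
  "poisson_kernel r w \<zeta> = (1 - r\<^sup>2) / (norm (w - of_real r * \<zeta>))\<^sup>2"

lemma poisson_kernel_denom:
  fixes w \<zeta> :: complex
  assumes "0 \<le> r" "r < 1" "norm w = 1" "norm \<zeta> = 1"
  shows "1 - r \<le> norm (w - of_real r * \<zeta>)"
proof -
  have "norm w - norm (of_real r * \<zeta>) \<le> norm (w - of_real r * \<zeta>)" by (rule norm_triangle_ineq2)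
  then show ?thesis using assms by (simp add: norm_mult)
qed

lemma poisson_kernel_nonneg: "0 \<le> r \<Longrightarrow> r < 1 \<Longrightarrow> 0 \<le> poisson_kernel r w \<zeta>"
  unfolding poisson_kernel_def by (intro divide_nonneg_nonneg) (auto simp: power_le_one)

lemma continuous_poisson_kernel:
  assumes "0 \<le> r" "r < 1" "norm w = 1"
  shows "continuous_on A (\<lambda>s. poisson_kernel r w (cis s))"
proof -
  have "w - of_real r * cis s \<noteq> 0" for s
    using poisson_kernel_denom[OF assms, of "cis s"] assms by auto
  then show ?thesis
    unfolding poisson_kernel_def by (intro continuous_intros) auto
qed

lemma poisson_kernel_eq_Re:
  assumes "0 \<le> r" "r < 1" "norm w = 1" "norm \<zeta> = 1"
  shows "poisson_kernel r w \<zeta> = Re (1 + 2 * of_real r * \<zeta> / (w - of_real r * \<zeta>))"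
proof -
  define v where "v = w - of_real r * \<zeta>"
  have v0: "v \<noteq> 0" using poisson_kernel_denom[OF assms] assms by (auto simp: v_def)
  have "1 + 2 * of_real r * \<zeta> / v = (w + of_real r * \<zeta>) / v"
    using v0 by (simp add: field_simps v_def)
  also have "\<dots> = (w + of_real r * \<zeta>) * cnj v / (v * cnj v)"
    using v0 by simp
  also have "v * cnj v = of_real ((norm v)\<^sup>2)" by (rule complex_norm_square[symmetric])
  finally have "Re (1 + 2 * of_real r * \<zeta> / v) = Re ((w + of_real r * \<zeta>) * cnj v) / (norm v)\<^sup>2"
    by (simp only: Re_divide_of_real)
  moreover have "Re ((w + of_real r * \<zeta>) * cnj v) = (norm w)\<^sup>2 - r\<^sup>2 * (norm \<zeta>)\<^sup>2"
    unfolding v_def cmod_power2 by (simp add: power2_eq_square algebra_simps)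
  ultimately show ?thesis
    using assms by (simp add: poisson_kernel_def v_def)
qed

text \<open>The kernel is the real part of \<open>1 + 2r\<zeta> / (w - r\<zeta>)\<close>, a holomorphic
  function of \<open>\<zeta>\<close> on the closed disc with value one at the origin, so this is
  the mean value property.\<close>

lemma poisson_kernel_integral:
  assumes r: "0 \<le> r" "r < 1" and w: "norm w = 1"
  shows "((\<lambda>s. poisson_kernel r w (cis s)) has_integral 2 * pi) {0..2 * pi}"
proof -
  define F where "F \<zeta> = 1 + 2 * of_real r * \<zeta> / (w - of_real r * \<zeta>)" for \<zeta>
  have "w - of_real r * \<zeta> \<noteq> 0" if "norm \<zeta> \<le> 1" for \<zeta>
  proof
    assume "w - of_real r * \<zeta> = 0"
    then have "1 = r * norm \<zeta>" using w r by (metis abs_of_nonneg eq_iff_diff_eq_0 norm_mult norm_of_real)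
    then show False using that r mult_left_le[of "norm \<zeta>" r] by linarith
  qed
  then have "F holomorphic_on cball 0 1"
    unfolding F_def by (intro holomorphic_intros) auto
  from Cauchy_integral_circlepath_simple[OF this, of 0]
  have "((\<lambda>u. F u / u) has_contour_integral (2 * of_real pi * \<i> * F 0)) (part_circlepath 0 1 0 (2 * pi))"
    by (simp add: circlepath_def)
  then have "((\<lambda>s. F (cis s) * \<i>) has_integral (2 * of_real pi * \<i>)) {0..2 * pi}"
    by (subst (asm) has_contour_integral_part_circlepath_iff) (auto simp: F_def)
  from has_integral_mult_right[OF this, of "- \<i>"]
  have "((\<lambda>s. F (cis s)) has_integral (2 * of_real pi)) {0..2 * pi}"
    by (simp add: algebra_simps)
  from has_integral_Re[OF this]
  have "((\<lambda>s. Re (F (cis s))) has_integral 2 * pi) {0..2 * pi}" by simp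
  then show ?thesis
    unfolding F_def by (subst poisson_kernel_eq_Re) (use r w in auto)
qed

text \<open>The kernel is a nonnegative approximate identity. Pointwise convergence with a uniform bound is
  what dominated convergence needs when \<open>w\<close> is integrated out afterwards.\<close>

lemma poisson_integral_tendsto:
  fixes \<psi> :: "complex \<Rightarrow> complex" and r :: "nat \<Rightarrow> real"
  assumes \<psi>: "continuous_on (sphere 0 1) \<psi>" and M: "\<And>z. norm z = 1 \<Longrightarrow> norm (\<psi> z) \<le> M"
    and r: "\<And>n. 0 \<le> r n" "\<And>n. r n < 1" "r \<longlonglongrightarrow> 1" and w: "norm w = 1"
  shows "(\<lambda>n. integral {0..2 * pi} (\<lambda>s. \<psi> (cis s) * of_real (poisson_kernel (r n) w (cis s))))
    \<longlonglongrightarrow> 2 * of_real pi * \<psi> w" (is ?thesis1)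
    and "norm (integral {0..2 * pi} (\<lambda>s. \<psi> (cis s) * of_real (poisson_kernel (r n) w (cis s)))) \<le> 2 * pi * M"
proof -
  let ?H = "\<lambda>n. integral {0..2 * pi} (\<lambda>s. \<psi> (cis s) * of_real (poisson_kernel (r n) w (cis s)))"
  let ?P = "\<lambda>n s. poisson_kernel (r n) w (cis s)"
  have cont: "continuous_on {0..2 * pi} (\<lambda>s. \<psi> (cis s))"
    by (rule continuous_on_compose2[OF \<psi>]) (auto intro!: continuous_intros)
  have contP: "continuous_on {0..2 * pi} (\<lambda>s. ?P n s)" for n
    by (rule continuous_poisson_kernel) (use r w in auto)
  have int1: "(\<lambda>s. \<psi> (cis s) * of_real (?P n s)) integrable_on {0..2 * pi}" for n
    by (intro integrable_continuous_real continuous_on_mult cont continuous_on_of_real contP)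
  have M0: "0 \<le> M" using order_trans[OF norm_ge_zero M[of 1]] by simp
  have pos: "0 \<le> ?P n s" for n s using poisson_kernel_nonneg r by blast
  note P_int = poisson_kernel_integral[OF r(1,2) w]
  have "norm (?H n) \<le> integral {0..2 * pi} (\<lambda>s. M * ?P n s)"
  proof (rule integral_norm_bound_integral[OF int1])
    show "(\<lambda>s. M * ?P n s) integrable_on {0..2 * pi}"
      by (intro integrable_continuous_real continuous_on_mult contP continuous_on_const)
    show "norm (\<psi> (cis s) * of_real (?P n s)) \<le> M * ?P n s" for s
      using mult_right_mono[OF M[of "cis s"] pos[of n s]] pos[of n s] by (simp add: norm_mult)
  qed
  also have "\<dots> = 2 * pi * M" using P_int[of n] by (simp add: integral_unique)
  finally show "norm (?H n) \<le> 2 * pi * M" .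
  show ?thesis1
  proof (rule tendstoI)
    fix \<epsilon> :: real assume "0 < \<epsilon>"
    \<comment> \<open>The error is at most \<open>\<eta>\<close> times the kernel near \<open>w\<close> and at most \<open>\<eta>\<close> elsewhere, in total \<open>4\<pi>\<eta> < \<epsilon>\<close>.\<close>
    define \<eta> where "\<eta> = \<epsilon> / (8 * pi)"
    have \<eta>: "0 < \<eta>" using \<open>0 < \<epsilon>\<close> by (simp add: \<eta>_def)
    obtain \<delta> where \<delta>: "0 < \<delta>" "\<And>z. norm z = 1 \<Longrightarrow> dist z w < \<delta> \<Longrightarrow> dist (\<psi> z) (\<psi> w) < \<eta>"
      using \<psi> w \<eta> unfolding continuous_on_iff by force
    have "(\<lambda>n. 2 * M * ((1 - (r n)\<^sup>2) / (\<delta> / 2)\<^sup>2)) \<longlonglongrightarrow> 2 * M * ((1 - 1\<^sup>2) / (\<delta> / 2)\<^sup>2)"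
      by (intro tendsto_intros r) (use \<delta> in auto)
    then have "eventually (\<lambda>n. 2 * M * ((1 - (r n)\<^sup>2) / (\<delta> / 2)\<^sup>2) < \<eta>) sequentially"
      by (rule order_tendstoD) (use \<eta> in simp)
    moreover have "eventually (\<lambda>n. 1 - \<delta> / 2 < r n) sequentially"
      by (rule order_tendstoD[OF r(3)]) (use \<delta> in simp)
    ultimately show "eventually (\<lambda>n. dist (?H n) (2 * of_real pi * \<psi> w) < \<epsilon>) sequentially"
    proof eventually_elim
      case (elim n)
      have diff: "((\<lambda>s. (\<psi> (cis s) - \<psi> w) * of_real (?P n s)) has_integral
          (?H n - 2 * of_real pi * \<psi> w)) {0..2 * pi}"
      proof -
        have "((\<lambda>s. \<psi> w * of_real (?P n s)) has_integral (\<psi> w * of_real (2 * pi))) {0..2 * pi}"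
          by (intro has_integral_mult_right has_integral_of_real P_int)
        from has_integral_diff[OF integrable_integral[OF int1[of n]] this]
        show ?thesis by (simp add: algebra_simps)
      qed
      have "norm (?H n - 2 * of_real pi * \<psi> w) \<le> integral {0..2 * pi} (\<lambda>s. \<eta> * ?P n s + \<eta>)"
        unfolding integral_unique[OF diff, symmetric]
      proof (rule integral_norm_bound_integral)
        show "(\<lambda>s. (\<psi> (cis s) - \<psi> w) * of_real (?P n s)) integrable_on {0..2 * pi}"
          using diff by blast
        show "(\<lambda>s. \<eta> * ?P n s + \<eta>) integrable_on {0..2 * pi}"
          by (intro integrable_continuous_real continuous_on_add continuous_on_mult contP continuous_on_const)
        show "norm ((\<psi> (cis s) - \<psi> w) * of_real (?P n s)) \<le> \<eta> * ?P n s + \<eta>" for s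
        proof (cases "dist (cis s) w < \<delta>")
          case True
          then have "norm (\<psi> (cis s) - \<psi> w) \<le> \<eta>" using \<delta>(2)[of "cis s"] by (simp add: dist_norm)
          from mult_right_mono[OF this pos[of n s]] show ?thesis
            using pos[of n s] \<eta> by (simp add: norm_mult)
        next
          case False
          have "dist (cis s) w \<le> dist (cis s) (of_real (r n) * cis s) + dist (of_real (r n) * cis s) w"
            by (rule dist_triangle)
          moreover {
          have "dist (cis s) (of_real (r n) * cis s) = norm ((1 - of_real (r n)) * cis s)"
            by (simp add: dist_norm algebra_simps)
          also have "(1 - of_real (r n)) * cis s = of_real (1 - r n) * cis s" by simp
          also have "norm (of_real (1 - r n) * cis s) = 1 - r n"
            using r(2)[of n] unfolding norm_mult norm_of_real by simp
          finally have "dist (cis s) (of_real (r n) * cis s) = 1 - r n" . }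
          ultimately have far: "\<delta> / 2 \<le> norm (w - of_real (r n) * cis s)"
            using False elim(2) by (simp add: dist_norm norm_minus_commute)
          have "(\<delta> / 2)\<^sup>2 \<le> (norm (w - of_real (r n) * cis s))\<^sup>2"
            by (rule power_mono[OF far]) (use \<delta> in simp)
          then have "?P n s \<le> (1 - (r n)\<^sup>2) / (\<delta> / 2)\<^sup>2"
            unfolding poisson_kernel_def
            by (intro divide_left_mono) (use \<delta> r(1)[of n] r(2)[of n] far in \<open>auto simp: power_le_one less_imp_le intro!: mult_pos_pos\<close>)
          moreover have "norm (\<psi> (cis s) - \<psi> w) \<le> 2 * M"
            using norm_triangle_ineq4[of "\<psi> (cis s)" "\<psi> w"] M[of "cis s"] M[OF w] by simp
          ultimately have "norm (\<psi> (cis s) - \<psi> w) * ?P n s \<le> 2 * M * ((1 - (r n)\<^sup>2) / (\<delta> / 2)\<^sup>2)"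
            by (intro mult_mono pos) (use M0 in auto)
          also have "\<dots> \<le> \<eta>" using elim by simp
          finally show ?thesis using pos[of n s] \<eta> by (simp add: norm_mult add_increasing)
        qed
      qed
      also have "((\<lambda>s. \<eta> * ?P n s + \<eta>) has_integral (\<eta> * (2 * pi) + (2 * pi - 0) *\<^sub>R \<eta>)) {0..2 * pi}"
        using has_integral_const_real[of \<eta> 0 "2 * pi"]
        by (intro has_integral_add has_integral_mult_right P_int) simp
      then have "integral {0..2 * pi} (\<lambda>s. \<eta> * ?P n s + \<eta>) = 4 * pi * \<eta>"
        by (simp add: integral_unique)
      also have "\<dots> < \<epsilon>" using \<open>0 < \<epsilon>\<close> by (simp add: \<eta>_def)
      finally show ?case by (simp add: dist_norm)
    qed
  qed
qed

section \<open>Cauchy transforms of measures on the unit circle\<close>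

text \<open>A complex measure on the unit circle, presented as a linear combination of finitely many finite
  measures that are pushed forward by a map \<open>e\<close> into the circle. The map is kept as a
  parameter because both an angle parametrisation and its complex conjugate are needed.\<close>

locale circle_functional =
  fixes S :: "'i set" and wgt :: "'i \<Rightarrow> complex" and \<mu> :: "'i \<Rightarrow> 'b measure" and e :: "'b \<Rightarrow> complex"
  assumes finite_S: "finite S"
    and finite_\<mu>: "\<And>i. i \<in> S \<Longrightarrow> finite_measure (\<mu> i)"
    and e_measurable: "\<And>i. i \<in> S \<Longrightarrow> e \<in> borel_measurable (\<mu> i)"
    and norm_e: "\<And>i t. i \<in> S \<Longrightarrow> t \<in> space (\<mu> i) \<Longrightarrow> norm (e t) = 1"
begin

definition Lam :: "(complex \<Rightarrow> complex) \<Rightarrow> complex" where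
  "Lam g = (\<Sum>i\<in>S. wgt i * (\<integral>t. g (e t) \<partial>\<mu> i))"

lemma integrable_on_circle:
  fixes g :: "complex \<Rightarrow> complex"
  assumes "i \<in> S" "g \<in> borel_measurable borel" "\<And>z. norm z = 1 \<Longrightarrow> norm (g z) \<le> C"
  shows "integrable (\<mu> i) (\<lambda>t. g (e t))"
proof -
  interpret finite_measure "\<mu> i" using finite_\<mu> assms(1) .
  show ?thesis
  proof (rule integrable_const_bound[where B = C])
    show "AE t in \<mu> i. norm (g (e t)) \<le> C"
      using assms norm_e by auto
    show "(\<lambda>t. g (e t)) \<in> borel_measurable (\<mu> i)"
      using measurable_compose[OF e_measurable[OF assms(1)] assms(2)] .
  qed
qed

lemma Lam_cong:
  assumes "\<And>z. norm z = 1 \<Longrightarrow> g z = h z"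
  shows "Lam g = Lam h"
  unfolding Lam_def
  by (intro sum.cong refl arg_cong2[where f = "(*)"] Bochner_Integration.integral_cong) (auto simp: assms norm_e)

lemma Lam_diff:
  assumes "g \<in> borel_measurable borel" "\<And>z. norm z = 1 \<Longrightarrow> norm (g z) \<le> C"
    and "h \<in> borel_measurable borel" "\<And>z. norm z = 1 \<Longrightarrow> norm (h z) \<le> D"
  shows "Lam (\<lambda>z. g z - h z) = Lam g - Lam h"
  unfolding Lam_def sum_subtractf[symmetric] right_diff_distrib[symmetric]
  by (intro sum.cong refl arg_cong2[where f = "(*)"] Bochner_Integration.integral_diff
      integrable_on_circle[where C = C] integrable_on_circle[where C = D]) (use assms in auto)

lemma Lam_add:
  assumes "g \<in> borel_measurable borel" "\<And>z. norm z = 1 \<Longrightarrow> norm (g z) \<le> C"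
    and "h \<in> borel_measurable borel" "\<And>z. norm z = 1 \<Longrightarrow> norm (h z) \<le> D"
  shows "Lam (\<lambda>z. g z + h z) = Lam g + Lam h"
  unfolding Lam_def sum.distrib[symmetric] distrib_left[symmetric]
  by (intro sum.cong refl arg_cong2[where f = "(*)"] Bochner_Integration.integral_add
      integrable_on_circle[where C = C] integrable_on_circle[where C = D]) (use assms in auto)

lemma Lam_cmult: "Lam (\<lambda>z. c * g z) = c * Lam g"
  unfolding Lam_def by (simp add: sum_distrib_left mult_ac)

definition mass :: real where
  "mass = (\<Sum>i\<in>S. norm (wgt i) * measure (\<mu> i) (space (\<mu> i)))"

lemma norm_Lam_le:
  assumes "g \<in> borel_measurable borel" "\<And>z. norm z = 1 \<Longrightarrow> norm (g z) \<le> C"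
  shows "norm (Lam g) \<le> mass * C"
proof -
  have "norm (\<integral>t. g (e t) \<partial>\<mu> i) \<le> measure (\<mu> i) (space (\<mu> i)) * C" if "i \<in> S" for i
  proof -
    interpret finite_measure "\<mu> i" using finite_\<mu> that .
    have "norm (\<integral>t. g (e t) \<partial>\<mu> i) \<le> (\<integral>t. norm (g (e t)) \<partial>\<mu> i)"
      by (rule integral_norm_bound)
    also have "\<dots> \<le> (\<integral>t. C \<partial>\<mu> i)"
      by (intro Bochner_Integration.integral_mono integrable_norm integrable_on_circle[where C = C] that assms
          integrable_const) (use assms norm_e that in auto)
    finally show ?thesis by simp
  qed
  then have "norm (Lam g) \<le> (\<Sum>i\<in>S. norm (wgt i) * (measure (\<mu> i) (space (\<mu> i)) * C))"
    unfolding Lam_def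
    by (intro order_trans[OF norm_sum] sum_mono) (auto simp: norm_mult intro!: mult_left_mono)
  also have "\<dots> = mass * C"
    by (simp add: mass_def sum_distrib_right mult.assoc)
  finally show ?thesis .
qed

lemma Lam_tendsto:
  assumes "\<And>n. G n \<in> borel_measurable borel" "\<And>n z. norm z = 1 \<Longrightarrow> norm (G n z) \<le> C"
    and "g \<in> borel_measurable borel" "\<And>z. norm z = 1 \<Longrightarrow> (\<lambda>n. G n z) \<longlonglongrightarrow> g z"
  shows "(\<lambda>n. Lam (G n)) \<longlonglongrightarrow> Lam g"
  unfolding Lam_def
proof (intro tendsto_sum tendsto_mult tendsto_const)
  fix i assume i: "i \<in> S"
  interpret finite_measure "\<mu> i" using finite_\<mu> i .
  show "(\<lambda>n. \<integral>t. G n (e t) \<partial>\<mu> i) \<longlonglongrightarrow> (\<integral>t. g (e t) \<partial>\<mu> i)"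
  proof (rule integral_dominated_convergence[where w = "\<lambda>_. C"])
    show "(\<lambda>t. g (e t)) \<in> borel_measurable (\<mu> i)"
      "(\<lambda>t. G n (e t)) \<in> borel_measurable (\<mu> i)" for n
      using measurable_compose[OF e_measurable[OF i]] assms by auto
  qed (use assms norm_e i in auto)
qed

text \<open>All measures are finite and the integrand is bounded, so the product integrals converge
  absolutely.\<close>

lemma Lam_Fubini:
  fixes k :: "complex \<Rightarrow> real \<Rightarrow> complex"
  assumes meas: "case_prod k \<in> borel_measurable (borel \<Otimes>\<^sub>M borel)"
    and bound: "\<And>z s. norm z = 1 \<Longrightarrow> s \<in> {a..b} \<Longrightarrow> norm (k z s) \<le> C"
  shows "(LINT s:{a..b}|lborel. Lam (\<lambda>z. k z s)) = Lam (\<lambda>z. LINT s:{a..b}|lborel. k z s)"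
    and "set_integrable lborel {a..b} (\<lambda>s. Lam (\<lambda>z. k z s))"
proof -
  define N where "N = restrict_space lborel {a..b}"
  have N: "finite_measure N"
    unfolding N_def by (rule finite_measureI) (simp add: space_restrict_space emeasure_restrict_space emeasure_lborel_Icc_eq)
  have sp: "space N = {a..b}"
    unfolding N_def by (simp add: space_restrict_space)
  have idN: "(\<lambda>s. s) \<in> N \<rightarrow>\<^sub>M borel"
    unfolding N_def by (intro measurable_restrict_space1) simp
  have LN: "(LINT s:{a..b}|lborel. u s) = integral\<^sup>L N u" for u :: "real \<Rightarrow> complex"
    unfolding N_def set_lebesgue_integral_def
    by (subst integral_restrict_space) (auto simp: indicator_def)
  have SN: "set_integrable lborel {a..b} u \<longleftrightarrow> integrable N u" for u :: "real \<Rightarrow> complex"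
    unfolding N_def set_integrable_def
    by (subst integrable_restrict_space) (auto simp: indicator_def)
  have prod: "integrable (\<mu> i \<Otimes>\<^sub>M N) (\<lambda>(t, s). k (e t) s)" if i: "i \<in> S" for i
  proof (rule finite_measure.integrable_const_bound[of _ _ C])
    show "finite_measure (\<mu> i \<Otimes>\<^sub>M N)"
      by (rule finite_measure_pair_measure[OF N finite_\<mu>[OF i]])
    show "AE p in \<mu> i \<Otimes>\<^sub>M N. norm (case p of (t, s) \<Rightarrow> k (e t) s) \<le> C"
      by (rule AE_I2) (use bound norm_e i sp in \<open>auto simp: space_pair_measure\<close>)
    have "(\<lambda>p. (e (fst p), snd p)) \<in> \<mu> i \<Otimes>\<^sub>M N \<rightarrow>\<^sub>M borel \<Otimes>\<^sub>M borel"
      by (intro measurable_Pair measurable_compose[OF measurable_fst e_measurable[OF i]]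
          measurable_compose[OF measurable_snd idN])
    from measurable_compose[OF this meas]
    show "(\<lambda>(t, s). k (e t) s) \<in> borel_measurable (\<mu> i \<Otimes>\<^sub>M N)"
      by (simp add: case_prod_beta')
  qed
  have psf: "pair_sigma_finite (\<mu> i) N" if "i \<in> S" for i
    unfolding pair_sigma_finite_def using finite_\<mu>[OF that] N
    by (auto simp: finite_measure_def)
  have swap: "integral\<^sup>L N (\<lambda>s. \<integral>t. k (e t) s \<partial>\<mu> i) = (\<integral>t. integral\<^sup>L N (k (e t)) \<partial>\<mu> i)"
    if i: "i \<in> S" for i
    using pair_sigma_finite.Fubini_integral[OF psf[OF i] prod[OF i]] by simp
  have int: "integrable N (\<lambda>s. \<integral>t. k (e t) s \<partial>\<mu> i)" if i: "i \<in> S" for i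
    using pair_sigma_finite.integrable_snd[OF psf[OF i] prod[OF i]] by simp
  show "(LINT s:{a..b}|lborel. Lam (\<lambda>z. k z s)) = Lam (\<lambda>z. LINT s:{a..b}|lborel. k z s)"
    unfolding LN Lam_def
    by (subst Bochner_Integration.integral_sum) (use int swap in \<open>auto intro!: sum.cong\<close>)
  show "set_integrable lborel {a..b} (\<lambda>s. Lam (\<lambda>z. k z s))"
    unfolding SN Lam_def using int by auto
qed

end

text \<open>The points \<open>r\<zeta>\<close> and \<open>\<zeta>/r\<close> are reflections of each other in
  the unit circle; the jump of the Cauchy kernel between them is the Poisson kernel up to the
  factor \<open>cnj w\<close>.\<close>

lemma circle_cauchy_difference:
  fixes w \<zeta> :: complex and r :: real
  assumes "0 < r" "r < 1" "norm w = 1" "norm \<zeta> = 1"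
  shows "1 / (w - of_real r * \<zeta>) - 1 / (w - \<zeta> / of_real r) = cnj w * of_real (poisson_kernel r w \<zeta>)"
proof -
  define v where "v = w - of_real r * \<zeta>"
  have ne: "v \<noteq> 0" using poisson_kernel_denom[of r w \<zeta>] assms by (auto simp: v_def)
  have ww: "w * cnj w = 1" and zz: "\<zeta> * cnj \<zeta> = 1"
    using assms complex_norm_square[of w] complex_norm_square[of \<zeta>] by simp_all
  have w0: "w \<noteq> 0" "\<zeta> \<noteq> 0" using assms by auto
  have "w * \<zeta> * cnj v = (w * cnj w) * \<zeta> - of_real r * w * (\<zeta> * cnj \<zeta>)"
    by (simp add: v_def algebra_simps)
  then have "w * \<zeta> * cnj v = \<zeta> - of_real r * w"
    unfolding ww zz by simp
  then have "w - \<zeta> / of_real r = - (w * \<zeta> * cnj v) / of_real r"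
    using assms by (simp only:) (simp add: field_simps)
  then have "1 / v - 1 / (w - \<zeta> / of_real r) = 1 / v + of_real r / (w * \<zeta> * cnj v)"
    by simp
  also have "\<dots> = (w * \<zeta> * cnj v + of_real r * v) / (w * \<zeta> * (v * cnj v))"
    using ne w0 by (simp add: field_simps)
  also have "w * \<zeta> * cnj v + of_real r * v = (w * cnj w) * \<zeta> - of_real r * w * (\<zeta> * cnj \<zeta>) + of_real r * v"
    by (simp add: v_def algebra_simps)
  also have "\<dots> = \<zeta> * of_real (1 - r\<^sup>2)"
    unfolding ww zz by (simp add: v_def algebra_simps power2_eq_square)
  also have "v * cnj v = of_real ((norm v)\<^sup>2)" by (rule complex_norm_square[symmetric])
  also have "\<zeta> * of_real (1 - r\<^sup>2) / (w * \<zeta> * of_real ((norm v)\<^sup>2)) = (1 / w) * of_real (poisson_kernel r w \<zeta>)"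
    using w0 by (simp add: poisson_kernel_def v_def)
  also have "1 / w = cnj w" using ww w0 by (simp add: field_simps)
  finally show ?thesis by (simp add: v_def)
qed

lemma measurable_cauchy: "(\<lambda>w::complex. 1 / (w - z)) \<in> borel_measurable borel"
  by measurable

lemma norm_cauchy_le:
  fixes w z :: complex
  assumes "norm w = 1" "norm z \<noteq> 1"
  shows "norm (1 / (w - z)) \<le> 1 / \<bar>1 - norm z\<bar>"
proof -
  have "\<bar>norm w - norm z\<bar> \<le> norm (w - z)" by (rule norm_triangle_ineq3)
  then show ?thesis
    unfolding norm_divide norm_one by (intro frac_le) (use assms in auto)
qed

context circle_functional
begin

context
  fixes K :: "complex set" and f :: "complex \<Rightarrow> complex"
  assumes closed_K: "closed K" and K_circle: "K \<subseteq> sphere 0 1"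
    and cont_f: "continuous_on (- K) f"
    and f_eq: "\<And>z. norm z \<noteq> 1 \<Longrightarrow> f z = Lam (\<lambda>w. 1 / (w - z))"
begin

text \<open>Test the jump \<open>f (r\<zeta>) - f (\<zeta>/r)\<close> against \<open>\<zeta>
  \<psi>(\<zeta>)\<close> over the circle. As \<open>r\<close> tends to one it tends to zero,
  because \<open>f\<close> is continuous on the support of \<open>\<psi>\<close>; on the other
  hand it is the integral of \<open>cnj w\<close> times the Poisson integral of \<open>\<zeta>
  \<psi>(\<zeta>)\<close> with respect to the complex measure, which tends to the integral of
  \<open>\<psi>\<close> up to the factor \<open>2\<pi>\<close>.\<close>

lemma Lam_vanishes_off_K:
  assumes \<psi>: "continuous_on (sphere 0 1) \<psi>" "\<psi> \<in> borel_measurable borel"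
    and C: "closed C" "C \<subseteq> sphere 0 1" "C \<inter> K = {}"
    and supp: "\<And>z. norm z = 1 \<Longrightarrow> z \<notin> C \<Longrightarrow> \<psi> z = 0"
  shows "Lam \<psi> = 0"
proof -
  \<comment> \<open>The factor \<open>z\<close> cancels the \<open>cnj w\<close> in front of the Poisson kernel.\<close>
  define \<phi> where "\<phi> z = z * \<psi> z" for z
  have \<phi>: "continuous_on (sphere 0 1) \<phi>" unfolding \<phi>_def by (intro continuous_intros \<psi>)
  have "bounded (\<phi> ` sphere 0 1)" by (intro compact_imp_bounded compact_continuous_image \<phi>) simp
  then obtain M where M: "\<And>z. norm z = 1 \<Longrightarrow> norm (\<phi> z) \<le> M"
    unfolding bounded_iff by force
  have M0: "0 \<le> M" using order_trans[OF norm_ge_zero M[of 1]] by simp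
  have cont_cis: "continuous_on A (\<lambda>s. \<phi> (cis s))" for A
    by (rule continuous_on_compose2[OF \<phi>]) (auto intro!: continuous_intros)
  define r :: "nat \<Rightarrow> real" where "r n = 1 - inverse (real (Suc (Suc n)))" for n
  have r: "1 / 2 \<le> r n" "0 < r n" "r n < 1" for n
    by (auto simp: r_def field_simps)
  have r1: "r \<longlonglongrightarrow> 1" unfolding r_def
    using tendsto_diff[OF tendsto_const LIMSEQ_Suc[OF LIMSEQ_inverse_real_of_nat], of 1] by simp
  define k where "k n w s = \<phi> (cis s) * (1 / (w - of_real (r n) * cis s) - 1 / (w - cis s / of_real (r n)))"
    for n w s
  define H where "H n s = \<phi> (cis s) * (f (of_real (r n) * cis s) - f (cis s / of_real (r n)))" for n s
  have nr_1: "norm (of_real (r n) * cis s) = r n" for n s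
    using r[of n] by (simp add: norm_mult)
  have nr_2: "norm (cis s / of_real (r n)) = 1 / r n" for n s
    using r[of n] by (simp add: norm_divide)
  have nr1: "r n \<noteq> 1" "1 / r n \<noteq> 1" for n using r[of n] by auto
  have k_eq: "k n w s = cnj w * (\<phi> (cis s) * of_real (poisson_kernel (r n) w (cis s)))" if "norm w = 1" for n w s
    unfolding k_def using circle_cauchy_difference[of "r n" w "cis s"] r[of n] that by simp
  have k_meas: "case_prod (k n) \<in> borel_measurable (borel \<Otimes>\<^sub>M borel)" for n
  proof -
    have [measurable]: "(\<lambda>s. \<phi> (cis s)) \<in> borel_measurable borel" "cis \<in> borel_measurable borel"
      by (auto intro!: borel_measurable_continuous_onI cont_cis continuous_intros)
    show ?thesis unfolding k_def by measurable
  qed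
  have k_bound: "norm (k n w s) \<le> M * (1 / \<bar>1 - r n\<bar> + 1 / \<bar>1 - 1 / r n\<bar>)" if "norm w = 1" for n w s
  proof -
    have "norm (1 / (w - of_real (r n) * cis s) - 1 / (w - cis s / of_real (r n)))
        \<le> 1 / \<bar>1 - r n\<bar> + 1 / \<bar>1 - 1 / r n\<bar>"
      using norm_cauchy_le[OF that, of "of_real (r n) * cis s"] norm_cauchy_le[OF that, of "cis s / of_real (r n)"]
        nr_1[of n s] nr_2[of s n] nr1[of n]
      by (intro order_trans[OF norm_triangle_ineq4] add_mono) simp_all
    then show ?thesis unfolding k_def norm_mult using M[of "cis s"] M0 by (intro mult_mono) auto
  qed
  have H_eq: "H n s = Lam (\<lambda>w. k n w s)" for n s
    unfolding k_def H_def Lam_cmult using nr_1[of n s] nr_2[of s n] nr1[of n]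
    by (subst Lam_diff[where C = "1 / \<bar>1 - r n\<bar>" and D = "1 / \<bar>1 - 1 / r n\<bar>"])
      (use norm_cauchy_le in \<open>auto simp: f_eq intro!: measurable_cauchy norm_cauchy_le[THEN order_trans]\<close>)
  define P where "P n w = (LINT s:{0..2 * pi}|lborel. k n w s)" for n w
  have LH: "(LINT s:{0..2 * pi}|lborel. H n s) = Lam (P n)" for n
    unfolding H_eq P_def by (rule Lam_Fubini(1)[OF k_meas k_bound])
  have P_meas: "P n \<in> borel_measurable borel" for n
  proof -
    have "(\<lambda>(w, s). indicator {0..2 * pi} s *\<^sub>R k n w s) \<in> borel_measurable (borel \<Otimes>\<^sub>M lborel)"
      using k_meas[of n] by measurable
    from lborel.borel_measurable_lebesgue_integral[OF this]
    show ?thesis unfolding P_def[abs_def] set_lebesgue_integral_def .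
  qed
  have P_eq: "P n w = cnj w * integral {0..2 * pi} (\<lambda>s. \<phi> (cis s) * of_real (poisson_kernel (r n) w (cis s)))"
    if w: "norm w = 1" for n w
  proof -
    have "continuous_on {0..2 * pi} (\<lambda>s. \<phi> (cis s) * of_real (poisson_kernel (r n) w (cis s)))"
      using r[of n] w by (intro continuous_on_mult cont_cis continuous_on_of_real continuous_poisson_kernel) auto
    from set_borel_integral_eq_integral(2)[OF borel_integrable_atLeastAtMost'[OF this]]
    show ?thesis unfolding P_def k_eq[OF w] by simp
  qed
  have lim1: "(\<lambda>n. Lam (P n)) \<longlonglongrightarrow> Lam (\<lambda>w. 2 * of_real pi * \<psi> w)"
  proof (rule Lam_tendsto[where C = "2 * pi * M"])
    show "norm (P n z) \<le> 2 * pi * M" if "norm z = 1" for n z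
      using poisson_integral_tendsto(2)[OF \<phi> M _ _ r1 that, of n] r that
      by (simp add: P_eq norm_mult less_imp_le)
    show "(\<lambda>n. P n z) \<longlonglongrightarrow> 2 * of_real pi * \<psi> z" if z: "norm z = 1" for z
    proof -
      have "(\<lambda>n. P n z) \<longlonglongrightarrow> cnj z * (2 * of_real pi * \<phi> z)"
        unfolding P_eq[OF z]
        by (intro tendsto_mult tendsto_const poisson_integral_tendsto(1)[OF \<phi> M _ _ r1 z]) (use r in \<open>auto simp: less_imp_le\<close>)
      moreover have "z * cnj z = 1" using complex_norm_square[of z] z by simp
      then have "cnj z * (2 * of_real pi * \<phi> z) = 2 * of_real pi * \<psi> z"
        by (simp add: \<phi>_def mult.assoc mult.left_commute[of "cnj z"])
      ultimately show ?thesis by simp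
    qed
  qed (use P_meas \<psi> in auto)
  \<comment> \<open>Radial segments through the support stay away from \<open>K\<close>, so \<open>f\<close> is bounded on their compact union.\<close>
  have notK: "of_real \<rho> * z \<notin> K" if "norm z = 1" "z \<in> C" "0 < \<rho>" for \<rho> z
  proof
    assume "of_real \<rho> * z \<in> K"
    then have "norm (of_real \<rho> * z) = 1" using K_circle by auto
    then have "\<rho> = 1" using that by (simp add: norm_mult)
    with \<open>of_real \<rho> * z \<in> K\<close> that C show False by auto
  qed
  define X where "X = (\<lambda>(\<rho>, z). of_real \<rho> * z) ` ({1 / 2..2} \<times> C)"
  have "compact X"
    unfolding X_def
  proof (intro compact_continuous_image compact_Times compact_Icc)
    show "compact C" using compact_Int_closed[OF compact_sphere C(1), of 0 1] C(2) by (simp add: Int_absorb1)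
  qed (auto intro!: continuous_intros simp: case_prod_beta')
  moreover have "X \<subseteq> - K"
    unfolding X_def using notK C by fastforce
  ultimately have "bounded (f ` X)"
    by (intro compact_imp_bounded compact_continuous_image continuous_on_subset[OF cont_f])
  then obtain L where L: "\<And>\<rho> z. 1 / 2 \<le> \<rho> \<Longrightarrow> \<rho> \<le> 2 \<Longrightarrow> z \<in> C \<Longrightarrow> norm (f (of_real \<rho> * z)) \<le> L"
    unfolding bounded_iff X_def by fastforce
  have inv_r: "cis s / of_real (r n) = of_real (1 / r n) * cis s" for n s by simp
  have lim2: "(\<lambda>n. LINT s:{0..2 * pi}|lborel. H n s) \<longlonglongrightarrow> (LINT s:{0..2 * pi}|lborel. 0)"
    unfolding set_lebesgue_integral_def
  proof (rule integral_dominated_convergence[where w = "\<lambda>s. indicator {0..2 * pi} s *\<^sub>R (M * (\<bar>L\<bar> + \<bar>L\<bar>))"])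
    show "(\<lambda>s. indicator {0..2 * pi} s *\<^sub>R H n s) \<in> borel_measurable lborel" for n
    proof -
      have "continuous_on UNIV (\<lambda>s. f (of_real (r n) * cis s))"
        by (rule continuous_on_compose2[OF cont_f])
          (use K_circle nr_1[of n] nr_2[of _ n] nr1[of n] in \<open>auto intro!: continuous_intros\<close>)
      moreover have "continuous_on UNIV (\<lambda>s. f (cis s / of_real (r n)))"
        by (rule continuous_on_compose2[OF cont_f])
          (use K_circle nr_1[of n] nr_2[of _ n] nr1[of n] r[of n] in \<open>auto intro!: continuous_intros\<close>)
      ultimately have "continuous_on UNIV (H n)"
        unfolding H_def[abs_def] by (intro continuous_on_mult continuous_on_diff cont_cis)
      then have "H n \<in> borel_measurable borel" by (rule borel_measurable_continuous_onI)
      then show ?thesis by simp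
    qed
    show "integrable lborel (\<lambda>s. indicator {0..2 * pi} s *\<^sub>R (M * (\<bar>L\<bar> + \<bar>L\<bar>)))"
      using borel_integrable_atLeastAtMost'[of 0 "2 * pi" "\<lambda>_. M * (\<bar>L\<bar> + \<bar>L\<bar>)"]
      by (simp add: set_integrable_def)
    show "AE s in lborel. (\<lambda>n. indicator {0..2 * pi} s *\<^sub>R H n s) \<longlonglongrightarrow> indicator {0..2 * pi} s *\<^sub>R 0"
    proof (intro AE_I2 tendsto_scaleR tendsto_const)
      fix s
      show "(\<lambda>n. H n s) \<longlonglongrightarrow> 0"
      proof (cases "cis s \<in> C")
        case True
        then have "cis s \<in> - K" using C by auto
        then have iso: "isCont f (cis s)"
          using cont_f closed_K by (simp add: continuous_on_eq_continuous_at open_Compl)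
        have "(\<lambda>n. of_real (r n) * cis s) \<longlonglongrightarrow> of_real 1 * cis s"
          "(\<lambda>n. cis s / of_real (r n)) \<longlonglongrightarrow> cis s / of_real 1"
          by (intro tendsto_intros r1; simp)+
        then have "(\<lambda>n. f (of_real (r n) * cis s)) \<longlonglongrightarrow> f (cis s)"
          "(\<lambda>n. f (cis s / of_real (r n))) \<longlonglongrightarrow> f (cis s)"
          using isCont_tendsto_compose[OF iso] by auto
        from tendsto_mult[OF tendsto_const tendsto_diff[OF this], of "\<phi> (cis s)"]
        show ?thesis by (simp add: H_def)
      next
        case False
        then show ?thesis using supp by (simp add: H_def \<phi>_def)
      qed
    qed
    show "AE s in lborel. norm (indicator {0..2 * pi} s *\<^sub>R H n s) \<le> indicator {0..2 * pi} s *\<^sub>R (M * (\<bar>L\<bar> + \<bar>L\<bar>))" for n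
    proof (intro AE_I2)
      fix s
      have "norm (H n s) \<le> M * (\<bar>L\<bar> + \<bar>L\<bar>)"
      proof (cases "cis s \<in> C")
        case True
        have "norm (f (of_real (r n) * cis s)) \<le> \<bar>L\<bar>" "norm (f (cis s / of_real (r n))) \<le> \<bar>L\<bar>"
          unfolding inv_r using L[OF _ _ True, of "r n"] L[OF _ _ True, of "1 / r n"] r[of n]
          by (force simp: field_simps)+
        then have "norm (f (of_real (r n) * cis s) - f (cis s / of_real (r n))) \<le> \<bar>L\<bar> + \<bar>L\<bar>"
          by (intro order_trans[OF norm_triangle_ineq4] add_mono)
        then show ?thesis unfolding H_def norm_mult using M[of "cis s"] M0 by (intro mult_mono) auto
      next
        case False
        then show ?thesis using supp M0 by (simp add: H_def \<phi>_def)
      qed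
      then show "norm (indicator {0..2 * pi} s *\<^sub>R H n s) \<le> indicator {0..2 * pi} s *\<^sub>R (M * (\<bar>L\<bar> + \<bar>L\<bar>))"
        by (simp add: indicator_def)
    qed
  qed simp
  have "Lam (\<lambda>w. 2 * of_real pi * \<psi> w) = 0"
    using LIMSEQ_unique[OF lim1 lim2[unfolded LH]] by (simp add: set_lebesgue_integral_def)
  then show ?thesis unfolding Lam_cmult by simp
qed

lemma K_borel: "K \<in> sets borel"
  using closed_K by simp

text \<open>Cut \<open>\<psi>\<close> off by a function of the distance to \<open>K\<close>. Inserting the
  origin into \<open>K\<close> only serves to have a nonempty set, for which the distance is
  meaningful; no point of the circle is affected.\<close>

lemma Lam_restrict_continuous:
  assumes \<psi>: "continuous_on (sphere 0 1) \<psi>" "\<psi> \<in> borel_measurable borel"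
  shows "Lam (\<lambda>z. if z \<in> K then 0 else \<psi> z) = 0"
proof -
  define K' where "K' = insert 0 K"
  have K': "closed K'" "K' \<noteq> {}" using closed_K by (auto simp: K'_def)
  define cut where "cut n z = min 1 (max 0 (real (Suc n) * infdist z K' - 1))" for n and z :: complex
  have cut01: "0 \<le> cut n z" "cut n z \<le> 1" for n z by (auto simp: cut_def)
  have cut_cont: "continuous_on A (cut n)" for A n
    unfolding cut_def[abs_def] by (intro continuous_intros)
  have "bounded (\<psi> ` sphere 0 1)" by (intro compact_imp_bounded compact_continuous_image \<psi>) simp
  then obtain M where M: "\<And>z. norm z = 1 \<Longrightarrow> norm (\<psi> z) \<le> M"
    unfolding bounded_iff by force
  have zero: "Lam (\<lambda>z. of_real (cut n z) * \<psi> z) = 0" for n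
  proof (rule Lam_vanishes_off_K)
    define C where "C = {z \<in> sphere 0 1. 1 / real (Suc n) \<le> infdist z K'}"
    show "continuous_on (sphere 0 1) (\<lambda>z. of_real (cut n z) * \<psi> z)"
      by (intro continuous_intros cut_cont \<psi>)
    have "cut n \<in> borel_measurable borel" by (rule borel_measurable_continuous_onI[OF cut_cont])
    then show "(\<lambda>z. of_real (cut n z) * \<psi> z) \<in> borel_measurable borel"
      using \<psi>(2) by measurable
    have "C = sphere 0 1 \<inter> {z. 1 / real (Suc n) \<le> infdist z K'}" by (auto simp: C_def)
    then show "closed C" by (auto intro!: closed_Int closed_Collect_le continuous_intros)
    show "C \<subseteq> sphere 0 1" by (auto simp: C_def)
    have "infdist z K' = 0" if "z \<in> K" for z using that by (intro infdist_zero) (simp add: K'_def)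
    then show "C \<inter> K = {}" by (fastforce simp: C_def)
    show "of_real (cut n z) * \<psi> z = 0" if "norm z = 1" "z \<notin> C" for z
    proof -
      have "infdist z K' < 1 / real (Suc n)" using that by (auto simp: C_def)
      then have "real (Suc n) * infdist z K' < 1" by (simp add: field_simps)
      then show ?thesis by (simp add: cut_def)
    qed
  qed
  have "(\<lambda>n. Lam (\<lambda>z. of_real (cut n z) * \<psi> z)) \<longlonglongrightarrow> Lam (\<lambda>z. if z \<in> K then 0 else \<psi> z)"
  proof (rule Lam_tendsto[where C = M])
    have "cut n \<in> borel_measurable borel" for n by (rule borel_measurable_continuous_onI[OF cut_cont])
    then show "(\<lambda>z. of_real (cut n z) * \<psi> z) \<in> borel_measurable borel" for n
      using \<psi>(2) by measurable
    show "norm (of_real (cut n z) * \<psi> z) \<le> M" if "norm z = 1" for n z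
      using mult_mono[OF cut01(2) M[OF that], of n z] cut01(1)[of n z] by (simp add: norm_mult)
    show "(\<lambda>z. if z \<in> K then 0 else \<psi> z) \<in> borel_measurable borel"
      using K_borel \<psi>(2) by measurable
    show "(\<lambda>n. of_real (cut n z) * \<psi> z) \<longlonglongrightarrow> (if z \<in> K then 0 else \<psi> z)" if z: "norm z = 1" for z
    proof (cases "z \<in> K")
      case True
      then have "infdist z K' = 0" by (intro infdist_zero) (simp add: K'_def)
      with True show ?thesis by (simp add: cut_def)
    next
      case False
      moreover have "z \<noteq> 0" using z by auto
      ultimately have "0 < infdist z K'"
        by (intro infdist_pos_not_in_closed K') (simp add: K'_def)
      then obtain N where N: "2 / infdist z K' < real N" using reals_Archimedean2 by blast
      have "cut n z = 1" if "N \<le> n" for n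
      proof -
        have "2 / infdist z K' < real (Suc n)" using N that by linarith
        then have "2 < real (Suc n) * infdist z K'"
          using \<open>0 < infdist z K'\<close> by (simp add: field_simps)
        then show ?thesis by (simp add: cut_def)
      qed
      then have "eventually (\<lambda>n. of_real (cut n z) * \<psi> z = \<psi> z) sequentially"
        unfolding eventually_sequentially by (intro exI[of _ N]) simp
      with False show ?thesis by (simp add: tendsto_eventually)
    qed
  qed
  then show ?thesis unfolding zero by (simp add: LIMSEQ_const_iff)
qed

text \<open>The indicator of a closed set is a bounded pointwise limit of continuous functions, for which
  the measure outside \<open>K\<close> is already known to vanish.\<close>

lemma Lam_restrict_closed:
  assumes A: "closed A" "A \<noteq> {}"
  shows "Lam (\<lambda>z. if z \<in> A then 1 else 0) = Lam (\<lambda>z. if z \<in> K \<inter> A then 1 else 0)"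
proof -
  define c where "c n z = max 0 (1 - real n * infdist z A)" for n and z :: complex
  have c_cont: "continuous_on S (c n)" for S n
    unfolding c_def[abs_def] by (intro continuous_intros)
  have c_meas: "(\<lambda>z. of_real (c n z) :: complex) \<in> borel_measurable borel" for n
    by (rule borel_measurable_continuous_onI) (intro continuous_intros c_cont)
  have c01: "0 \<le> c n z" "c n z \<le> 1" for n z
    using infdist_nonneg[of z A] by (auto simp: c_def)
  have AK: "A \<in> sets borel" "K \<in> sets borel" using A K_borel by auto
  have "(\<lambda>n. Lam (\<lambda>z. if z \<in> K then 0 else of_real (c n z)))
      \<longlonglongrightarrow> Lam (\<lambda>z. if z \<in> K then 0 else if z \<in> A then 1 else 0)"
  proof (rule Lam_tendsto[where C = 1])
    show "(\<lambda>z. if z \<in> K then 0 else of_real (c n z) :: complex) \<in> borel_measurable borel" for n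
      using c_meas[of n] AK by measurable
    show "(\<lambda>z. if z \<in> K then 0 else if z \<in> A then 1 else 0 :: complex) \<in> borel_measurable borel"
      using AK by measurable
    show "norm (if z \<in> K then 0 else of_real (c n z) :: complex) \<le> 1" for n z
      using c01[of n z] by simp
    show "(\<lambda>n. if z \<in> K then 0 else of_real (c n z)) \<longlonglongrightarrow> (if z \<in> K then 0 else if z \<in> A then 1 else 0 :: complex)" for z
    proof (cases "z \<in> A")
      case True
      then show ?thesis by (simp add: c_def)
    next
      case False
      then have pos: "0 < infdist z A" using infdist_pos_not_in_closed[OF A] by blast
      then obtain N where N: "1 / infdist z A < real N" using reals_Archimedean2 by blast
      have "c n z = 0" if "N \<le> n" for n
      proof -
        have "1 / infdist z A < real n" using N that by linarith
        then have "1 < real n * infdist z A" using pos by (simp add: field_simps)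
        then show ?thesis by (simp add: c_def)
      qed
      then have "eventually (\<lambda>n. (if z \<in> K then 0 else of_real (c n z)) = (0 :: complex)) sequentially"
        unfolding eventually_sequentially by (intro exI[of _ N]) simp
      with False show ?thesis by (simp only: if_False if_cancel) (rule tendsto_eventually)
    qed
  qed
  moreover have "Lam (\<lambda>z. if z \<in> K then 0 else of_real (c n z)) = 0" for n
    by (rule Lam_restrict_continuous) (intro continuous_intros c_cont c_meas)+
  ultimately have zero: "Lam (\<lambda>z. if z \<in> K then 0 else if z \<in> A then 1 else 0) = 0"
    by (simp add: LIMSEQ_const_iff)
  have "(\<lambda>z. if z \<in> A then 1 else 0 :: complex) =
      (\<lambda>z. (if z \<in> K \<inter> A then 1 else 0) + (if z \<in> K then 0 else if z \<in> A then 1 else 0))"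
    by auto
  then have "Lam (\<lambda>z. if z \<in> A then 1 else 0) =
      Lam (\<lambda>z. (if z \<in> K \<inter> A then 1 else 0) + (if z \<in> K then 0 else if z \<in> A then 1 else 0))"
    by simp
  also have "\<dots> = Lam (\<lambda>z. if z \<in> K \<inter> A then 1 else 0) +
      Lam (\<lambda>z. if z \<in> K then 0 else if z \<in> A then 1 else 0)"
  proof (rule Lam_add[where C = 1 and D = 1])
    have "K \<inter> A \<in> sets borel" using AK by auto
    then show "(\<lambda>z. if z \<in> K \<inter> A then 1 else 0 :: complex) \<in> borel_measurable borel" by measurable
    show "(\<lambda>z. if z \<in> K then 0 else if z \<in> A then 1 else 0 :: complex) \<in> borel_measurable borel"
      using AK by measurable
  qed auto
  finally show ?thesis unfolding zero by simp
qed

text \<open>The Cauchy transform of the part of the measure carried by \<open>K\<close>. Unlike the full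
  transform it is visibly holomorphic across the arcs of the circle outside \<open>K\<close>.\<close>

definition cauchy_K :: "complex \<Rightarrow> complex" where
  "cauchy_K z = Lam (\<lambda>w. if w \<in> K then 1 / (w - z) else 0)"

lemma measurable_if_K: "g \<in> borel_measurable borel \<Longrightarrow> (\<lambda>w. if w \<in> K then g w else 0 :: complex) \<in> borel_measurable borel"
  by (rule measurable_If_set) (use K_borel in auto)

lemma cauchy_K_field_differentiable:
  assumes z0: "z0 \<notin> K"
  shows "cauchy_K field_differentiable (at z0)"
proof -
  obtain d where d: "0 < d" "\<And>w. w \<in> K \<Longrightarrow> 2 * d \<le> norm (w - z0)"
  proof -
    have "open (- K)" "z0 \<in> - K" using closed_K z0 by auto
    then obtain e where e: "0 < e" "ball z0 e \<subseteq> - K" using open_contains_ball by blast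
    have "2 * (e / 2) \<le> norm (w - z0)" if "w \<in> K" for w
      using e that by (force simp: dist_norm norm_minus_commute)
    then show ?thesis using that[of "e / 2"] e by auto
  qed
  define D where "D = Lam (\<lambda>w. if w \<in> K then 1 / (w - z0)\<^sup>2 else 0)"
  have bd: "norm (if w \<in> K then 1 / (w - z) else 0) \<le> 1 / d"
    "w \<in> K \<Longrightarrow> d \<le> norm (w - z)" if "norm (z - z0) < d" for w z
  proof -
    show *: "d \<le> norm (w - z)" if "w \<in> K"
      using d(2)[OF that] norm_triangle_ineq[of "w - z" "z - z0"] \<open>norm (z - z0) < d\<close> by simp
    show "norm (if w \<in> K then 1 / (w - z) else 0) \<le> 1 / d"
      using * d(1) by (auto simp: norm_divide intro!: frac_le)
  qed
  have bd2: "norm (if w \<in> K then 1 / (w - z0)\<^sup>2 else 0) \<le> 1 / d\<^sup>2" for w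
    using d(1) d(2)[of w] by (auto simp: norm_divide norm_power intro!: frac_le power_mono)
  have est: "norm (cauchy_K z - cauchy_K z0 - D * (z - z0)) \<le> mass * (1 / d ^ 3) * (norm (z - z0))\<^sup>2"
    if z: "norm (z - z0) < d" for z
  proof -
    \<comment> \<open>The second order remainder of the Cauchy kernel at \<open>z0\<close>.\<close>
    define q where "q w = (if w \<in> K then (z - z0)\<^sup>2 / ((w - z) * (w - z0)\<^sup>2) else 0)" for w
    have q: "q = (\<lambda>w. ((if w \<in> K then 1 / (w - z) else 0) - (if w \<in> K then 1 / (w - z0) else 0))
        - (z - z0) * (if w \<in> K then 1 / (w - z0)\<^sup>2 else 0))"
    proof
      fix w
      show "q w = ((if w \<in> K then 1 / (w - z) else 0) - (if w \<in> K then 1 / (w - z0) else 0))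
        - (z - z0) * (if w \<in> K then 1 / (w - z0)\<^sup>2 else 0)"
      proof (cases "w \<in> K")
        case True
        then have "w - z \<noteq> 0" "w - z0 \<noteq> 0" using bd(2)[OF z, of w] d(2)[of w] d(1) by auto
        moreover have "1 / a - 1 / b - (b - a) * (1 / b\<^sup>2) = (b - a)\<^sup>2 / (a * b\<^sup>2)"
          if "a \<noteq> 0" "b \<noteq> 0" for a b :: complex
          using that by (simp add: field_simps power2_eq_square)
        ultimately have "1 / (w - z) - 1 / (w - z0) - ((w - z0) - (w - z)) * (1 / (w - z0)\<^sup>2) =
            ((w - z0) - (w - z))\<^sup>2 / ((w - z) * (w - z0)\<^sup>2)"
          by blast
        then show ?thesis using True by (simp add: q_def)
      qed (simp add: q_def)
    qed
    have meas: "(\<lambda>w. if w \<in> K then 1 / (w - z) else 0) \<in> borel_measurable borel" for z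
      by (rule measurable_if_K) measurable
    have meas2: "(\<lambda>w. if w \<in> K then 1 / (w - z0)\<^sup>2 else 0) \<in> borel_measurable borel"
      by (rule measurable_if_K) measurable
    have "Lam q = cauchy_K z - cauchy_K z0 - (z - z0) * D"
      unfolding q cauchy_K_def D_def Lam_cmult[symmetric]
    proof (subst Lam_diff[where C = "1 / d + 1 / d" and D = "norm (z - z0) * (1 / d\<^sup>2)"])
      show "norm ((if w \<in> K then 1 / (w - z) else 0) - (if w \<in> K then 1 / (w - z0) else 0)) \<le> 1 / d + 1 / d" for w
        using bd(1)[OF z, of w] bd(1)[of z0 w] d(1) by (intro order_trans[OF norm_triangle_ineq4] add_mono) auto
      show "norm ((z - z0) * (if w \<in> K then 1 / (w - z0)\<^sup>2 else 0)) \<le> norm (z - z0) * (1 / d\<^sup>2)" for w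
        using bd2[of w] unfolding norm_mult by (intro mult_left_mono) auto
      show "(\<lambda>w. (z - z0) * (if w \<in> K then 1 / (w - z0)\<^sup>2 else 0)) \<in> borel_measurable borel"
        "(\<lambda>w. (if w \<in> K then 1 / (w - z) else 0) - (if w \<in> K then 1 / (w - z0) else 0)) \<in> borel_measurable borel"
        using meas meas2 by measurable
      show "Lam (\<lambda>w. (if w \<in> K then 1 / (w - z) else 0) - (if w \<in> K then 1 / (w - z0) else 0))
          - Lam (\<lambda>w. (z - z0) * (if w \<in> K then 1 / (w - z0)\<^sup>2 else 0))
        = Lam (\<lambda>w. if w \<in> K then 1 / (w - z) else 0) - Lam (\<lambda>w. if w \<in> K then 1 / (w - z0) else 0)
          - Lam (\<lambda>w. (z - z0) * (if w \<in> K then 1 / (w - z0)\<^sup>2 else 0))"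
        using bd(1)[OF z] bd(1)[of z0] d(1)
        by (subst Lam_diff[where C = "1 / d" and D = "1 / d"]) (auto simp: meas)
    qed
    moreover have "norm (Lam q) \<le> mass * ((norm (z - z0))\<^sup>2 * (1 / d ^ 3))"
    proof (rule norm_Lam_le)
      show "q \<in> borel_measurable borel"
        unfolding q_def by (rule measurable_if_K) measurable
      show "norm (q w) \<le> (norm (z - z0))\<^sup>2 * (1 / d ^ 3)" for w
      proof (cases "w \<in> K")
        case True
        have "d \<le> norm (w - z)" "d \<le> norm (w - z0)" using bd(2)[OF z True] d True by force+
        then have "d * d\<^sup>2 \<le> norm (w - z) * (norm (w - z0))\<^sup>2"
          using d(1) by (intro mult_mono power_mono) auto
        then have "(norm (z - z0))\<^sup>2 / (norm (w - z) * (norm (w - z0))\<^sup>2) \<le> (norm (z - z0))\<^sup>2 / (d * d\<^sup>2)"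
          using d(1) by (intro frac_le) auto
        then show ?thesis using True
          by (simp add: q_def norm_divide norm_mult norm_power power3_eq_cube power2_eq_square)
      qed (use d(1) in \<open>simp add: q_def\<close>)
    qed
    ultimately show ?thesis by (simp add: mult_ac)
  qed
  define c where "c = mass * (1 / d ^ 3)"
  have "(cauchy_K has_field_derivative D) (at z0)"
    unfolding has_field_derivative_iff
  proof (rule LIM_zero_cancel, rule Lim_null_comparison)
    have "((\<lambda>z. c * norm (z - z0)) \<longlongrightarrow> c * norm (z0 - z0)) (at z0)"
      by (intro tendsto_intros)
    then show "((\<lambda>z. c * norm (z - z0)) \<longlongrightarrow> 0) (at z0)" by simp
    show "eventually (\<lambda>z. norm ((cauchy_K z - cauchy_K z0) / (z - z0) - D) \<le> c * norm (z - z0)) (at z0)"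
      unfolding eventually_at
    proof (intro exI[of _ d] conjI ballI impI)
      fix z assume "z \<noteq> z0 \<and> dist z z0 < d"
      then have ne: "z - z0 \<noteq> 0" and "norm (z - z0) < d" by (auto simp: dist_norm)
      have "(cauchy_K z - cauchy_K z0) / (z - z0) - D = (cauchy_K z - cauchy_K z0 - D * (z - z0)) / (z - z0)"
        using ne by (simp add: field_simps)
      also have "norm \<dots> \<le> c * (norm (z - z0))\<^sup>2 / norm (z - z0)"
        unfolding norm_divide c_def using est[OF \<open>norm (z - z0) < d\<close>] by (intro divide_right_mono) auto
      also have "\<dots> = c * norm (z - z0)" using ne by (simp add: power2_eq_square)
      finally show "norm ((cauchy_K z - cauchy_K z0) / (z - z0) - D) \<le> c * norm (z - z0)" .
    qed (rule d(1))
  qed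
  then show ?thesis unfolding field_differentiable_def by blast
qed

lemma cauchy_K_holomorphic: "cauchy_K holomorphic_on - K"
  unfolding holomorphic_on_def
  using cauchy_K_field_differentiable by (auto intro: field_differentiable_at_within)

text \<open>Off the circle the two transforms agree because the measure has no mass outside
  \<open>K\<close>; at the remaining points of the circle both sides are continuous.\<close>

lemma f_eq_cauchy_K:
  assumes "z \<notin> K"
  shows "f z = cauchy_K z"
proof -
  have off: "f z = cauchy_K z" if z: "norm z \<noteq> 1" for z
  proof -
    have "f z = Lam (\<lambda>w. (if w \<in> K then 1 / (w - z) else 0) + (if w \<in> K then 0 else 1 / (w - z)))"
      unfolding f_eq[OF z] by (rule Lam_cong) auto
    also have "\<dots> = cauchy_K z + Lam (\<lambda>w. if w \<in> K then 0 else 1 / (w - z))"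
      unfolding cauchy_K_def
    proof (rule Lam_add[where C = "1 / \<bar>1 - norm z\<bar>" and D = "1 / \<bar>1 - norm z\<bar>"])
      show "(\<lambda>w. if w \<in> K then 1 / (w - z) else 0) \<in> borel_measurable borel"
        "(\<lambda>w. if w \<in> K then 0 else 1 / (w - z)) \<in> borel_measurable borel"
        using K_borel by measurable
    qed (use norm_cauchy_le[OF _ z] in \<open>auto simp: z\<close>)
    also have "Lam (\<lambda>w. if w \<in> K then 0 else 1 / (w - z)) = 0"
    proof (rule Lam_restrict_continuous)
      show "continuous_on (sphere 0 1) (\<lambda>w. 1 / (w - z))"
        using z by (intro continuous_intros) auto
    qed measurable
    finally show ?thesis by simp
  qed
  show ?thesis
  proof (cases "norm z = 1")
    case True
    define u where "u n = of_real (1 - inverse (real (Suc (Suc n)))) * z" for n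
    have "(\<lambda>n. 1 - inverse (real (Suc (Suc n)))) \<longlonglongrightarrow> 1"
      using tendsto_diff[OF tendsto_const LIMSEQ_Suc[OF LIMSEQ_inverse_real_of_nat], of 1] by simp
    then have "u \<longlonglongrightarrow> of_real 1 * z"
      unfolding u_def by (intro tendsto_intros)
    then have u: "u \<longlonglongrightarrow> z" by simp
    have iso: "isCont g z" if "continuous_on (- K) g" for g :: "complex \<Rightarrow> complex"
      using that closed_K assms by (simp add: continuous_on_eq_continuous_at open_Compl)
    have "(\<lambda>n. f (u n)) \<longlonglongrightarrow> f z" by (rule isCont_tendsto_compose[OF iso[OF cont_f] u])
    moreover have "(\<lambda>n. cauchy_K (u n)) \<longlonglongrightarrow> cauchy_K z"
      by (rule isCont_tendsto_compose[OF iso[OF holomorphic_on_imp_continuous_on[OF cauchy_K_holomorphic]] u])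
    moreover have "f (u n) = cauchy_K (u n)" for n
    proof (rule off)
      have "norm (u n) = \<bar>1 - inverse (real (Suc (Suc n)))\<bar>"
        unfolding u_def norm_mult True norm_of_real by simp
      moreover have "0 < inverse (real (Suc (Suc n)))" "inverse (real (Suc (Suc n))) < 1"
        by (auto simp: field_simps)
      ultimately show "norm (u n) \<noteq> 1" by linarith
    qed
    ultimately show ?thesis using LIMSEQ_unique by simp
  qed (rule off)
qed

lemma compact_K: "compact K"
  using compact_Int_closed[OF compact_sphere closed_K, of 0 1] K_circle by (simp add: Int_absorb1)

lemma measurable_winding_K:
  assumes "path \<gamma>" "path_image \<gamma> \<inter> K = {}"
  shows "(\<lambda>w. if w \<in> K then c * winding_number \<gamma> w else 0) \<in> borel_measurable borel"
    and "\<exists>C. \<forall>w\<in>K. norm (c * winding_number \<gamma> w) \<le> C"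
proof -
  have cont: "continuous_on K (\<lambda>w. c * winding_number \<gamma> w)"
    by (intro continuous_intros continuous_on_subset[OF continuous_on_winding_number]) (use assms in auto)
  then show "(\<lambda>w. if w \<in> K then c * winding_number \<gamma> w else 0) \<in> borel_measurable borel"
    by (intro borel_measurable_continuous_on_if) (use closed_K in auto)
  have "bounded ((\<lambda>w. c * winding_number \<gamma> w) ` K)"
    by (intro compact_imp_bounded compact_continuous_image cont compact_K)
  then show "\<exists>C. \<forall>w\<in>K. norm (c * winding_number \<gamma> w) \<le> C"
    by (auto simp: bounded_iff)
qed

text \<open>The interchange of integrations; the inner contour integral of the Cauchy kernel is a winding
  number. Boundedness of the derivative of the path makes the double integral absolutely
  convergent.\<close>

lemma contour_integral_cauchy_K_smooth:
  assumes g: "valid_path g" "path_image g \<subseteq> - K"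
    and g': "\<And>s. (g has_vector_derivative g' s) (at s)" and cont_g': "continuous_on UNIV g'"
  shows "contour_integral g (cauchy_K) =
    Lam (\<lambda>w. if w \<in> K then - (2 * of_real pi * \<i>) * winding_number g w else 0)"
proof -
  have cont_g: "continuous_on A g" for A
    using g' by (meson continuous_at_imp_continuous_on has_vector_derivative_continuous)
  define k where "k w s = (if w \<in> K then g' s / (w - g s) else 0)" for w s
  have "compact (path_image g)" using g(1) by (simp add: compact_path_image valid_path_imp_path)
  obtain d where d: "0 < d" "\<And>w s. w \<in> K \<Longrightarrow> s \<in> {0..1} \<Longrightarrow> d \<le> norm (w - g s)"
  proof -
    obtain d where "0 < d" "\<forall>x\<in>K. \<forall>y\<in>path_image g. d \<le> dist x y"
      using separate_compact_closed[OF compact_K compact_imp_closed[OF \<open>compact (path_image g)\<close>]] g(2) by blast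
    then show ?thesis using that[of d] by (auto simp: path_image_def dist_norm)
  qed
  have "bounded (g' ` {0..1})"
    by (intro compact_imp_bounded compact_continuous_image continuous_on_subset[OF cont_g']) auto
  then obtain L where L: "\<And>s. s \<in> {0..1} \<Longrightarrow> norm (g' s) \<le> L" unfolding bounded_iff by fast
  have L0: "0 \<le> L" using order_trans[OF norm_ge_zero L[of 0]] by simp
  have k_bound: "norm (k w s) \<le> L / d" if "s \<in> {0..1}" for w s
    using d L[OF that] L0 that by (auto simp: k_def norm_divide intro!: frac_le)
  have k_meas: "case_prod k \<in> borel_measurable (borel \<Otimes>\<^sub>M borel)"
  proof -
    have [measurable]: "g \<in> borel_measurable borel" "g' \<in> borel_measurable borel"
      using cont_g cont_g' by (auto intro: borel_measurable_continuous_onI)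
    have "(\<lambda>p. if fst p \<in> K then g' (snd p) / (fst p - g (snd p)) else 0) \<in> borel_measurable (borel \<Otimes>\<^sub>M borel)"
    proof (rule measurable_If)
      have "fst -` K \<inter> space (borel \<Otimes>\<^sub>M borel) \<in> sets (borel \<Otimes>\<^sub>M (borel :: real measure))"
        by (rule measurable_sets[OF measurable_fst]) (use closed_K in auto)
      moreover have "fst -` K \<inter> space (borel \<Otimes>\<^sub>M borel) = {p \<in> space (borel \<Otimes>\<^sub>M (borel :: real measure)). fst p \<in> K}"
        by auto
      ultimately show "{p \<in> space (borel \<Otimes>\<^sub>M (borel :: real measure)). fst p \<in> K} \<in> sets (borel \<Otimes>\<^sub>M borel)"
        by simp
    qed measurable
    then show ?thesis by (simp add: k_def case_prod_beta')
  qed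
  have vd: "vector_derivative g (at s) = g' s" for s
    using g' by (rule vector_derivative_at)
  have "contour_integral g (cauchy_K) = integral {0..1} (\<lambda>s. Lam (\<lambda>w. k w s))"
  proof -
    have "cauchy_K (g s) * g' s = Lam (\<lambda>w. k w s)" for s
    proof -
      have "cauchy_K (g s) * g' s = Lam (\<lambda>w. g' s * (if w \<in> K then 1 / (w - g s) else 0))"
        unfolding Lam_cmult cauchy_K_def by simp
      also have "\<dots> = Lam (\<lambda>w. k w s)"
        by (rule Lam_cong) (simp add: k_def)
      finally show ?thesis .
    qed
    then show ?thesis unfolding contour_integral_integral vd by simp
  qed
  also have "\<dots> = (LINT s:{0..1}|lborel. Lam (\<lambda>w. k w s))"
    by (rule set_borel_integral_eq_integral(2)[symmetric], rule Lam_Fubini(2)[OF k_meas])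
      (rule k_bound)
  also have "\<dots> = Lam (\<lambda>w. LINT s:{0..1}|lborel. k w s)"
    by (rule Lam_Fubini(1)[OF k_meas]) (rule k_bound)
  also have "\<dots> = Lam (\<lambda>w. if w \<in> K then - (2 * of_real pi * \<i>) * winding_number g w else 0)"
  proof (rule Lam_cong)
    fix w
    show "(LINT s:{0..1}|lborel. k w s) = (if w \<in> K then - (2 * of_real pi * \<i>) * winding_number g w else 0)"
    proof (cases "w \<in> K")
      case True
      have "w - g s \<noteq> 0" if "s \<in> {0..1}" for s using d(1) d(2)[OF True that] by auto
      then have "continuous_on {0..1} (k w)"
        using True unfolding k_def[abs_def] by (auto intro!: continuous_intros continuous_on_subset[OF cont_g'] cont_g)
      from set_borel_integral_eq_integral(2)[OF borel_integrable_atLeastAtMost'[OF this]]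
      have "(LINT s:{0..1}|lborel. k w s) = integral {0..1} (k w)" .
      also have "\<dots> = integral {0..1} (\<lambda>s. - (1 / (g s - w) * vector_derivative g (at s)))"
      proof (rule Henstock_Kurzweil_Integration.integral_cong)
        fix s :: real
        have "k w s = g' s / - (g s - w)" using True by (simp add: k_def)
        also have "\<dots> = - (g' s / (g s - w))" by (rule minus_divide_right[symmetric])
        finally show "k w s = - (1 / (g s - w) * vector_derivative g (at s))"
          unfolding vd by simp
      qed
      also have "\<dots> = - contour_integral g (\<lambda>z. 1 / (z - w))"
        unfolding contour_integral_integral by simp
      also have "\<dots> = - (2 * of_real pi * \<i>) * winding_number g w"
      proof -
        have "w \<notin> path_image g" using True g(2) by blast
        then show ?thesis using winding_number_valid_path[OF g(1), of w] by simp
      qed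
      finally show ?thesis using True by simp
    qed (simp add: k_def set_lebesgue_integral_def)
  qed
  finally show ?thesis .
qed

text \<open>A path without bounded derivative is replaced by a nearby polynomial path, along which all
  functions holomorphic off \<open>K\<close> have the same integral; applied to the Cauchy kernels
  this also shows that the winding numbers agree.\<close>

lemma contour_integral_cauchy_K:
  assumes \<gamma>: "valid_path \<gamma>" "path_image \<gamma> \<subseteq> - K"
  shows "contour_integral \<gamma> (cauchy_K) =
    Lam (\<lambda>w. if w \<in> K then - (2 * of_real pi * \<i>) * winding_number \<gamma> w else 0)"
proof -
  have op: "open (- K)" using closed_K by (simp add: open_Compl)
  from contour_integral_nearby_ends[OF op valid_path_imp_path[OF \<gamma>(1)] \<gamma>(2)]
  obtain d where d: "0 < d" "\<And>h. valid_path h \<Longrightarrow> (\<forall>t\<in>{0..1}. norm (h t - \<gamma> t) < d) \<Longrightarrow>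
      pathstart h = pathstart \<gamma> \<Longrightarrow> pathfinish h = pathfinish \<gamma> \<Longrightarrow>
      path_image h \<subseteq> - K \<and> (\<forall>f. f holomorphic_on - K \<longrightarrow> contour_integral h f = contour_integral \<gamma> f)"
    using \<gamma>(1) by (metis diff_self norm_zero)
  obtain g where g: "polynomial_function g" "pathstart g = pathstart \<gamma>" "pathfinish g = pathfinish \<gamma>"
    "\<And>t. t \<in> {0..1} \<Longrightarrow> norm (g t - \<gamma> t) < d"
    using path_approx_polynomial_function[OF valid_path_imp_path[OF \<gamma>(1)] d(1)] by blast
  have vg: "valid_path g" by (rule valid_path_polynomial_function[OF g(1)])
  have pg: "path_image g \<subseteq> - K" and eq: "\<And>f. f holomorphic_on - K \<Longrightarrow> contour_integral g f = contour_integral \<gamma> f"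
    using d(2)[OF vg _ g(2,3)] g(4) by blast+
  obtain g' where g': "polynomial_function g'" "\<And>s. (g has_vector_derivative g' s) (at s)"
    using has_vector_derivative_polynomial_function[OF g(1)] by blast
  have "contour_integral \<gamma> (cauchy_K) = contour_integral g (cauchy_K)"
    by (rule eq[symmetric], rule cauchy_K_holomorphic)
  also have "\<dots> = Lam (\<lambda>w. if w \<in> K then - (2 * of_real pi * \<i>) * winding_number g w else 0)"
    by (rule contour_integral_cauchy_K_smooth[OF vg pg g'(2) continuous_on_polymonial_function[OF g'(1)]])
  also have "\<dots> = Lam (\<lambda>w. if w \<in> K then - (2 * of_real pi * \<i>) * winding_number \<gamma> w else 0)"
  proof (rule Lam_cong)
    fix w
    have "winding_number g w = winding_number \<gamma> w" if w: "w \<in> K"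
    proof -
      have nw: "w \<notin> path_image g" "w \<notin> path_image \<gamma>" using w pg \<gamma>(2) by blast+
      have "(\<lambda>z. 1 / (z - w)) holomorphic_on - K" using w by (intro holomorphic_intros) auto
      from eq[OF this] show ?thesis
        using winding_number_valid_path[OF vg, of w] winding_number_valid_path[OF \<gamma>(1), of w] nw by simp
    qed
    then show "(if w \<in> K then - (2 * of_real pi * \<i>) * winding_number g w else 0) =
      (if w \<in> K then - (2 * of_real pi * \<i>) * winding_number \<gamma> w else 0)" by simp
  qed
  finally show ?thesis .
qed

text \<open>On \<open>K\<close> the winding numbers add up to the indicator of \<open>A\<close>; outside
  \<open>K\<close> there is no mass, so the restriction to \<open>K\<close> can be dropped from
  the result.\<close>

lemma sum_contour_integral_eq_Lam:
  assumes \<Gamma>: "finite \<Gamma>" "\<And>\<gamma>. \<gamma> \<in> \<Gamma> \<Longrightarrow> valid_path \<gamma>" "\<And>\<gamma>. \<gamma> \<in> \<Gamma> \<Longrightarrow> path_image \<gamma> \<subseteq> - K"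
    and wind: "\<And>z. z \<in> K \<Longrightarrow> (\<Sum>\<gamma>\<in>\<Gamma>. winding_number \<gamma> z) = (if z \<in> A then 1 else 0)"
    and A: "closed A" "A \<noteq> {}"
  shows "(\<Sum>\<gamma>\<in>\<Gamma>. contour_integral \<gamma> f) = - (2 * of_real pi * \<i>) * Lam (\<lambda>z. if z \<in> A then 1 else 0)"
proof -
  let ?c = "- (2 * of_real pi * \<i>) :: complex"
  have "contour_integral \<gamma> f = contour_integral \<gamma> (cauchy_K)" if "\<gamma> \<in> \<Gamma>" for \<gamma>
    by (rule contour_integral_cong[OF refl], rule f_eq_cauchy_K)
      (use \<Gamma>(3)[OF that] in auto)
  then have "(\<Sum>\<gamma>\<in>\<Gamma>. contour_integral \<gamma> f) = (\<Sum>\<gamma>\<in>\<Gamma>. Lam (\<lambda>w. if w \<in> K then ?c * winding_number \<gamma> w else 0))"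
    using \<Gamma> contour_integral_cauchy_K by simp
  also have "\<dots> = Lam (\<lambda>w. \<Sum>\<gamma>\<in>\<Gamma>. if w \<in> K then ?c * winding_number \<gamma> w else 0)"
    using \<Gamma>
  proof (induction \<Gamma> rule: finite_induct)
    case empty
    have "Lam (\<lambda>w. 0 * 0) = 0 * Lam (\<lambda>w. 0)" by (rule Lam_cmult)
    then show ?case by simp
  next
    case (insert \<gamma> \<Gamma>)
    let ?g = "\<lambda>\<gamma> w. if w \<in> K then ?c * winding_number \<gamma> w else 0"
    have meas: "?g \<delta> \<in> borel_measurable borel" "\<exists>C. \<forall>w\<in>K. norm (?c * winding_number \<delta> w) \<le> C"
      if "\<delta> \<in> insert \<gamma> \<Gamma>" for \<delta>
      using insert.prems(2)[OF that] insert.prems(1)[OF that]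
      by (intro measurable_winding_K valid_path_imp_path; blast)+
    have "\<forall>\<delta>\<in>insert \<gamma> \<Gamma>. \<exists>C. \<forall>w\<in>K. norm (?c * winding_number \<delta> w) \<le> C" using meas(2) by blast
    then obtain C where C: "\<And>\<delta> w. \<delta> \<in> insert \<gamma> \<Gamma> \<Longrightarrow> w \<in> K \<Longrightarrow> norm (?c * winding_number \<delta> w) \<le> C \<delta>"
      by metis
    have gC: "norm (?g \<delta> w) \<le> \<bar>C \<delta>\<bar>" if "\<delta> \<in> insert \<gamma> \<Gamma>" for \<delta> w
      using C[OF that, of w] by (cases "w \<in> K") (simp_all del: norm_mult add: order_trans[OF _ abs_ge_self])
    have "(\<Sum>\<gamma>\<in>insert \<gamma> \<Gamma>. Lam (?g \<gamma>)) = Lam (?g \<gamma>) + Lam (\<lambda>w. \<Sum>\<delta>\<in>\<Gamma>. ?g \<delta> w)"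
      using insert by simp
    also have "\<dots> = Lam (\<lambda>w. ?g \<gamma> w + (\<Sum>\<delta>\<in>\<Gamma>. ?g \<delta> w))"
      by (rule Lam_add[where C = "\<bar>C \<gamma>\<bar>" and D = "\<Sum>\<delta>\<in>\<Gamma>. \<bar>C \<delta>\<bar>", symmetric])
        (use meas(1) gC in \<open>auto simp del: norm_mult intro!: borel_measurable_sum sum_norm_le\<close>)
    finally show ?case using insert by simp
  qed
  also have "\<dots> = Lam (\<lambda>w. ?c * (if w \<in> K \<inter> A then 1 else 0))"
  proof (rule Lam_cong)
    fix w
    show "(\<Sum>\<gamma>\<in>\<Gamma>. if w \<in> K then ?c * winding_number \<gamma> w else 0) = ?c * (if w \<in> K \<inter> A then 1 else 0)"
    proof (cases "w \<in> K")
      case True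
      then show ?thesis using wind[OF True] by (simp only: if_True sum_distrib_left[symmetric]) simp
    qed simp
  qed
  also have "\<dots> = ?c * Lam (\<lambda>z. if z \<in> A then 1 else 0)"
    unfolding Lam_cmult using Lam_restrict_closed[OF A] by simp
  finally show ?thesis .
qed

lemma f_holomorphic: "f holomorphic_on - K"
  by (rule holomorphic_transform[OF cauchy_K_holomorphic])
    (use f_eq_cauchy_K in auto)

end

end

context circle_functional
begin

text \<open>The functions \<open>w\<^sup>n / (w - z)\<close> integrate to another bounded solution of the
  recursion. The difference of the two solutions is geometric with ratio \<open>z\<close>, and a
  bounded one must vanish.\<close>

lemma cauchy_transform_outside:
  assumes z: "1 < norm z" and bd: "\<And>n. norm (\<phi> n) \<le> C"
    and rec: "\<And>n. \<phi> (Suc n) = z * \<phi> n + Lam (\<lambda>w. w ^ n)"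
  shows "\<phi> 0 = Lam (\<lambda>w. 1 / (w - z))"
proof -
  define \<psi> where "\<psi> n = Lam (\<lambda>w. w ^ n / (w - z))" for n
  have nz: "norm z \<noteq> 1" using z by simp
  have b: "norm (w ^ n / (w - z)) \<le> 1 / \<bar>1 - norm z\<bar>" if "norm w = 1" for n w
    using norm_cauchy_le[OF that nz] that by (simp add: norm_divide norm_power)
  have \<psi>_bd: "norm (\<psi> n) \<le> mass * (1 / \<bar>1 - norm z\<bar>)" for n
    unfolding \<psi>_def by (rule norm_Lam_le[OF _ b]) measurable
  have \<psi>_rec: "\<psi> (Suc n) = z * \<psi> n + Lam (\<lambda>w. w ^ n)" for n
  proof -
    have "\<psi> (Suc n) = Lam (\<lambda>w. z * (w ^ n / (w - z)) + w ^ n)"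
      unfolding \<psi>_def
    proof (rule Lam_cong)
      fix w :: complex assume "norm w = 1"
      then have "w - z \<noteq> 0" using nz by auto
      then show "w ^ Suc n / (w - z) = z * (w ^ n / (w - z)) + w ^ n"
        by (simp add: field_simps)
    qed
    also have "\<dots> = Lam (\<lambda>w. z * (w ^ n / (w - z))) + Lam (\<lambda>w. w ^ n)"
    proof (rule Lam_add[where C = "norm z * (1 / \<bar>1 - norm z\<bar>)" and D = 1])
      show "norm (z * (w ^ n / (w - z))) \<le> norm z * (1 / \<bar>1 - norm z\<bar>)" if "norm w = 1" for w
        unfolding norm_mult using b[OF that, of n] by (intro mult_left_mono) auto
      show "norm (w ^ n) \<le> 1" if "norm w = 1" for w :: complex
        using that by (simp add: norm_power)
    qed measurable
    also have "Lam (\<lambda>w. z * (w ^ n / (w - z))) = z * \<psi> n" unfolding \<psi>_def by (rule Lam_cmult)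
    finally show ?thesis .
  qed
  define \<delta> where "\<delta> n = \<phi> n - \<psi> n" for n
  have \<delta>: "\<delta> n = z ^ n * \<delta> 0" for n
  proof (induction n)
    case (Suc n)
    have "\<delta> (Suc n) = z * \<delta> n" by (simp add: \<delta>_def rec \<psi>_rec right_diff_distrib)
    then show ?case using Suc by simp
  qed simp
  define D where "D = C + mass * (1 / \<bar>1 - norm z\<bar>)"
  have \<delta>_le: "norm (\<delta> n) \<le> D" for n
    unfolding \<delta>_def D_def using bd \<psi>_bd by (intro order_trans[OF norm_triangle_ineq4] add_mono)
  have D: "norm z ^ n * norm (\<delta> 0) \<le> D" for n
    using \<delta>_le[of n] \<delta>[of n] by (simp add: norm_mult norm_power)
  have "\<delta> 0 = 0"
  proof (rule ccontr)
    assume "\<delta> 0 \<noteq> 0"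
    obtain n where "D / norm (\<delta> 0) < norm z ^ n" using real_arch_pow[OF z] by blast
    then show False using D[of n] \<open>\<delta> 0 \<noteq> 0\<close> by (simp add: field_simps)
  qed
  then show ?thesis by (simp add: \<delta>_def \<psi>_def)
qed

text \<open>The same argument with the powers of \<open>1 / w\<close>, which on the circle is the conjugate
  of \<open>w\<close>; here the geometric sequence runs backwards.\<close>

lemma cauchy_transform_inside:
  assumes z: "norm z < 1" and bd: "\<And>n. norm (\<phi> n) \<le> C"
    and rec: "\<And>n. \<phi> n = z * \<phi> (Suc n) + Lam (\<lambda>w. cnj w ^ Suc n)"
  shows "\<phi> 0 = Lam (\<lambda>w. 1 / (w - z))"
proof -
  define \<psi> where "\<psi> n = Lam (\<lambda>w. cnj w ^ n / (w - z))" for n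
  have nz: "norm z \<noteq> 1" using z by simp
  have b: "norm (cnj w ^ n / (w - z)) \<le> 1 / \<bar>1 - norm z\<bar>" if "norm w = 1" for n w
    using norm_cauchy_le[OF that nz] that by (simp add: norm_divide norm_power)
  have cm [measurable]: "cnj \<in> borel_measurable borel"
    by (intro borel_measurable_continuous_onI continuous_intros)
  have \<psi>_bd: "norm (\<psi> n) \<le> mass * (1 / \<bar>1 - norm z\<bar>)" for n
    unfolding \<psi>_def by (rule norm_Lam_le[OF _ b]) measurable
  have \<psi>_rec: "\<psi> n = z * \<psi> (Suc n) + Lam (\<lambda>w. cnj w ^ Suc n)" for n
  proof -
    have "\<psi> n = Lam (\<lambda>w. z * (cnj w ^ Suc n / (w - z)) + cnj w ^ Suc n)"
      unfolding \<psi>_def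
    proof (rule Lam_cong)
      fix w :: complex assume w: "norm w = 1"
      then have ne: "w - z \<noteq> 0" using nz by auto
      have "w * cnj w = 1" using complex_norm_square[of w] w by simp
      then have "cnj w ^ n = w * cnj w ^ Suc n" by (simp add: mult.assoc[symmetric])
      then have "cnj w ^ n / (w - z) = cnj w ^ Suc n * w / (w - z)" by (simp add: mult.commute)
      also have "\<dots> = z * (cnj w ^ Suc n / (w - z)) + cnj w ^ Suc n"
      proof -
        have "a * w / (w - z) = z * (a / (w - z)) + a" for a using ne by (simp add: field_simps)
        then show ?thesis .
      qed
      finally show "cnj w ^ n / (w - z) = z * (cnj w ^ Suc n / (w - z)) + cnj w ^ Suc n" .
    qed
    also have "\<dots> = Lam (\<lambda>w. z * (cnj w ^ Suc n / (w - z))) + Lam (\<lambda>w. cnj w ^ Suc n)"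
    proof (rule Lam_add[where C = "norm z * (1 / \<bar>1 - norm z\<bar>)" and D = 1])
      show "norm (z * (cnj w ^ Suc n / (w - z))) \<le> norm z * (1 / \<bar>1 - norm z\<bar>)" if "norm w = 1" for w
        unfolding norm_mult using b[OF that, of "Suc n"] by (intro mult_left_mono) auto
      show "norm (cnj w ^ Suc n) \<le> 1" if "norm w = 1" for w
        using that by (simp add: norm_mult norm_power)
    qed measurable
    also have "Lam (\<lambda>w. z * (cnj w ^ Suc n / (w - z))) = z * \<psi> (Suc n)"
      unfolding \<psi>_def by (rule Lam_cmult)
    finally show ?thesis .
  qed
  define \<delta> where "\<delta> n = \<phi> n - \<psi> n" for n
  have step: "\<delta> n = z * \<delta> (Suc n)" for n
    unfolding \<delta>_def using rec[of n] \<psi>_rec[of n] by (simp add: right_diff_distrib)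
  have \<delta>: "\<delta> 0 = z ^ n * \<delta> n" for n
  proof (induction n)
    case (Suc n)
    then show ?case using step[of n] by (simp add: mult_ac)
  qed simp
  define D where "D = C + mass * (1 / \<bar>1 - norm z\<bar>)"
  have D: "norm (\<delta> n) \<le> D" for n
    unfolding \<delta>_def D_def using bd \<psi>_bd by (intro order_trans[OF norm_triangle_ineq4] add_mono)
  have "norm (\<delta> 0) \<le> norm z ^ n * D" for n
    using D[of n] unfolding \<delta>[of n] norm_mult norm_power by (intro mult_left_mono) auto
  moreover have "(\<lambda>n. norm z ^ n * D) \<longlonglongrightarrow> 0 * D"
    by (intro tendsto_mult tendsto_const LIMSEQ_realpow_zero) (use z in auto)
  ultimately have "norm (\<delta> 0) \<le> 0 * D"
    by (intro LIMSEQ_le_const[of _ "0 * D"]) auto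
  then show ?thesis by (simp add: \<delta>_def \<psi>_def)
qed

end

section \<open>Line integrals of Banach space valued forms\<close>

text \<open>Integrate the form \<open>p dx + q dy\<close> along segments from a base point. The separating
  functionals reduce the independence of the path to scalar exactness, and continuity of the
  coefficients gives the derivative.\<close>

lemma weakly_exact_one_form_primitive:
  fixes p q :: "complex \<Rightarrow> 'b::banach" and \<Phi> :: "('b \<Rightarrow> real) set"
  assumes S: "convex S" "open S" and cont: "continuous_on S p" "continuous_on S q"
    and lin: "\<And>\<phi>. \<phi> \<in> \<Phi> \<Longrightarrow> bounded_linear \<phi>"
    and sep: "\<And>u. (\<And>\<phi>. \<phi> \<in> \<Phi> \<Longrightarrow> \<phi> u = 0) \<Longrightarrow> u = 0"
    and weak: "\<And>\<phi>. \<phi> \<in> \<Phi> \<Longrightarrow>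
      \<exists>g. \<forall>z\<in>S. (g has_derivative (\<lambda>h. Re h * \<phi> (p z) + Im h * \<phi> (q z))) (at z)"
  obtains G where "\<And>z. z \<in> S \<Longrightarrow> (G has_derivative (\<lambda>h. Re h *\<^sub>R p z + Im h *\<^sub>R q z)) (at z)"
proof (cases "S = {}")
  case True
  then show ?thesis using that by blast
next
  case False
  then obtain c where c: "c \<in> S" by blast
  define F where "F a b = integral {0..1} (\<lambda>t. Re (b - a) *\<^sub>R p (a + t *\<^sub>R (b - a)) + Im (b - a) *\<^sub>R q (a + t *\<^sub>R (b - a)))" for a b
  have seg: "a + t *\<^sub>R (b - a) \<in> S" if "a \<in> S" "b \<in> S" "t \<in> {0..1}" for a b t
    using convexD[OF S(1) that(1,2), of "1 - t" t] that(3) by (simp add: algebra_simps)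
  have cont_int: "continuous_on {0..1} (\<lambda>t. Re (b - a) *\<^sub>R p (a + t *\<^sub>R (b - a)) + Im (b - a) *\<^sub>R q (a + t *\<^sub>R (b - a)))"
    if "a \<in> S" "b \<in> S" for a b
    by (intro continuous_intros continuous_on_compose2[OF cont(1)] continuous_on_compose2[OF cont(2)])
      (use seg that in auto)
  have weak_F: "\<phi> (F a b) = g b - g a"
    if \<phi>: "\<phi> \<in> \<Phi>" and g: "\<And>z. z \<in> S \<Longrightarrow> (g has_derivative (\<lambda>h. Re h * \<phi> (p z) + Im h * \<phi> (q z))) (at z)"
      and ab: "a \<in> S" "b \<in> S" for \<phi> g a b
  proof -
    interpret bounded_linear \<phi> using lin[OF \<phi>] .
    have "((\<lambda>t. Re (b - a) * \<phi> (p (a + t *\<^sub>R (b - a))) + Im (b - a) * \<phi> (q (a + t *\<^sub>R (b - a))))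
      has_integral (g (a + 1 *\<^sub>R (b - a)) - g (a + 0 *\<^sub>R (b - a)))) {0..1}"
    proof (rule fundamental_theorem_of_calculus)
      fix t :: real assume t: "t \<in> {0..1}"
      have "((\<lambda>t. a + t *\<^sub>R (b - a)) has_derivative (\<lambda>h. h *\<^sub>R (b - a))) (at t within {0..1})"
        by (auto intro!: derivative_eq_intros)
      from has_derivative_compose[OF this g[OF seg[OF ab t]]]
      show "((\<lambda>t. g (a + t *\<^sub>R (b - a))) has_vector_derivative
          Re (b - a) * \<phi> (p (a + t *\<^sub>R (b - a))) + Im (b - a) * \<phi> (q (a + t *\<^sub>R (b - a)))) (at t within {0..1})"
        unfolding has_vector_derivative_def by (simp add: algebra_simps)
    qed simp
    moreover have "\<phi> (F a b) = integral {0..1}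
       (\<lambda>t. Re (b - a) * \<phi> (p (a + t *\<^sub>R (b - a))) + Im (b - a) * \<phi> (q (a + t *\<^sub>R (b - a))))"
      unfolding F_def
      using integral_linear[OF integrable_continuous_real[OF cont_int[OF ab]] bounded_linear_axioms]
      by (simp add: o_def add scaleR)
    ultimately show ?thesis by (simp add: integral_unique)
  qed
  have F_diff: "F c z - F c w = F w z" if "w \<in> S" "z \<in> S" for w z
  proof -
    have "F c z - F c w - F w z = 0"
    proof (rule sep)
      fix \<phi> assume \<phi>: "\<phi> \<in> \<Phi>"
      obtain g where g: "\<And>z. z \<in> S \<Longrightarrow> (g has_derivative (\<lambda>h. Re h * \<phi> (p z) + Im h * \<phi> (q z))) (at z)"
        using weak[OF \<phi>] by blast
      have "\<phi> (F c z - F c w - F w z) = \<phi> (F c z) - \<phi> (F c w) - \<phi> (F w z)"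
        using lin[OF \<phi>] by (simp add: linear_diff bounded_linear.linear)
      also have "\<dots> = 0"
        using weak_F[OF \<phi> g] c that by simp
      finally show "\<phi> (F c z - F c w - F w z) = 0" .
    qed
    then show ?thesis by simp
  qed
  have "(F c has_derivative (\<lambda>h. Re h *\<^sub>R p z + Im h *\<^sub>R q z)) (at z)" if z: "z \<in> S" for z
    unfolding has_derivative_at_alt
  proof (intro conjI allI impI)
    show "bounded_linear (\<lambda>h. Re h *\<^sub>R p z + Im h *\<^sub>R q z)"
      by (intro bounded_linear_add bounded_linear_scaleR_const bounded_linear_Re bounded_linear_Im)
    fix \<epsilon> :: real assume \<epsilon>: "0 < \<epsilon>"
    have "isCont p z" "isCont q z"
      using cont S(2) z by (simp_all add: continuous_on_eq_continuous_at)
    then have "eventually (\<lambda>w. dist (p w) (p z) < \<epsilon> / 2) (nhds z)" "eventually (\<lambda>w. dist (q w) (q z) < \<epsilon> / 2) (nhds z)"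
      using \<epsilon> tendstoD[of p "p z" "nhds z" "\<epsilon> / 2"] tendstoD[of q "q z" "nhds z" "\<epsilon> / 2"]
      by (simp_all add: isCont_def tendsto_at_iff_tendsto_nhds)
    moreover have "eventually (\<lambda>w. w \<in> S) (nhds z)" using S(2) z by (rule eventually_nhds_in_open)
    ultimately have "eventually (\<lambda>w. w \<in> S \<and> dist (p w) (p z) < \<epsilon> / 2 \<and> dist (q w) (q z) < \<epsilon> / 2) (nhds z)"
      by eventually_elim simp
    then obtain d where d: "0 < d"
      "\<And>w. dist w z < d \<Longrightarrow> w \<in> S \<and> dist (p w) (p z) < \<epsilon> / 2 \<and> dist (q w) (q z) < \<epsilon> / 2"
      unfolding eventually_nhds_metric by blast
    show "\<exists>d>0. \<forall>y. norm (y - z) < d \<longrightarrow>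
        norm (F c y - F c z - (Re (y - z) *\<^sub>R p z + Im (y - z) *\<^sub>R q z)) \<le> \<epsilon> * norm (y - z)"
    proof (intro exI[of _ d] conjI allI impI d(1))
      fix y assume "norm (y - z) < d"
      then have y: "y \<in> S" "dist y z < d" using d(2) by (auto simp: dist_norm)
      have near: "dist (z + t *\<^sub>R (y - z)) z < d" if "t \<in> {0..1}" for t
      proof -
        have "dist (z + t *\<^sub>R (y - z)) z = t * norm (y - z)" using that by (simp add: dist_norm)
        also have "\<dots> \<le> 1 * norm (y - z)" using that by (intro mult_right_mono) auto
        finally show ?thesis using y by (simp add: dist_norm)
      qed
      define h where "h t = Re (y - z) *\<^sub>R p (z + t *\<^sub>R (y - z)) + Im (y - z) *\<^sub>R q (z + t *\<^sub>R (y - z))" for t :: real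
      define h0 where "h0 = Re (y - z) *\<^sub>R p z + Im (y - z) *\<^sub>R q z"
      have hi: "(h has_integral F z y) {0..1}"
        unfolding h_def F_def by (intro integrable_integral integrable_continuous_real cont_int z y)
      have "((\<lambda>t. h t - h0) has_integral (F z y - (1 - 0) *\<^sub>R h0)) {0..1}"
        by (intro has_integral_diff hi) (use has_integral_const_real[of h0 0 1] in simp)
      then have diff: "((\<lambda>t. h t - h0) has_integral (F z y - h0)) (cbox 0 1)" by simp
      have "norm (F z y - h0) \<le> (\<epsilon> * norm (y - z)) * measure lborel (cbox 0 (1::real))"
      proof (rule has_integral_bound[OF _ diff])
        show "0 \<le> \<epsilon> * norm (y - z)" using \<epsilon> by simp
        fix t :: real assume "t \<in> cbox 0 1"
        then have t: "t \<in> {0..1}" by simp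
        define u where "u = z + t *\<^sub>R (y - z)"
        have u: "norm (p u - p z) \<le> \<epsilon> / 2" "norm (q u - q z) \<le> \<epsilon> / 2"
          using d(2)[OF near[OF t]] by (auto simp: u_def dist_norm)
        have "h t - h0 = Re (y - z) *\<^sub>R (p u - p z) + Im (y - z) *\<^sub>R (q u - q z)"
          by (simp add: h_def h0_def u_def algebra_simps)
        also have "norm \<dots> \<le> norm (y - z) * (\<epsilon> / 2) + norm (y - z) * (\<epsilon> / 2)"
        proof (rule order_trans[OF norm_triangle_ineq], rule add_mono)
          show "norm (Re (y - z) *\<^sub>R (p u - p z)) \<le> norm (y - z) * (\<epsilon> / 2)"
            unfolding norm_scaleR using u by (intro mult_mono abs_Re_le_cmod) auto
          show "norm (Im (y - z) *\<^sub>R (q u - q z)) \<le> norm (y - z) * (\<epsilon> / 2)"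
            unfolding norm_scaleR using u by (intro mult_mono abs_Im_le_cmod) auto
        qed
        finally show "norm (h t - h0) \<le> \<epsilon> * norm (y - z)" by (simp add: mult.commute)
      qed
      then show "norm (F c y - F c z - (Re (y - z) *\<^sub>R p z + Im (y - z) *\<^sub>R q z)) \<le> \<epsilon> * norm (y - z)"
        using F_diff[OF z y(1)] by (simp add: h0_def)
    qed
  qed
  then show ?thesis by (rule that)
qed

text \<open>Where a primitive exists, the composition with the path is a continuous antiderivative of the
  integrand up to finitely many points, so the gauge integral exists by the fundamental theorem of
  calculus. Local integrability suffices by compactness of the parameter interval.\<close>

lemma one_form_integrable_along_valid_path:
  fixes p q :: "complex \<Rightarrow> 'b::banach"
  assumes \<gamma>: "valid_path \<gamma>" "path_image \<gamma> \<subseteq> S" and S: "open S"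
    and prim: "\<And>z. z \<in> S \<Longrightarrow> \<exists>e>0. \<exists>G. \<forall>w\<in>ball z e. (G has_derivative (\<lambda>h. Re h *\<^sub>R p w + Im h *\<^sub>R q w)) (at w)"
  shows "(\<lambda>\<tau>. Re (vector_derivative \<gamma> (at \<tau> within {0..1})) *\<^sub>R p (\<gamma> \<tau>) +
      Im (vector_derivative \<gamma> (at \<tau> within {0..1})) *\<^sub>R q (\<gamma> \<tau>)) integrable_on {0..1}"
    (is "?f integrable_on _")
proof -
  have cont: "continuous_on {0..1} \<gamma>" using \<gamma>(1) by (simp add: valid_path_def piecewise_C1_differentiable_on_def)
  obtain X where X: "finite X" "\<gamma> C1_differentiable_on {0..1} - X"
    using \<gamma>(1) by (auto simp: valid_path_def piecewise_C1_differentiable_on_def)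
  then obtain D where D: "\<And>t. t \<in> {0..1} - X \<Longrightarrow> (\<gamma> has_vector_derivative D t) (at t)"
    unfolding C1_differentiable_on_def by blast
  have vd: "vector_derivative \<gamma> (at t within {0..1}) = D t" if "t \<in> {0..1} - X" for t
    using D[OF that] that by (intro vector_derivative_at_within_ivl) auto
  have "?f integrable_on cbox 0 1"
  proof (rule integrable_on_little_subintervals, rule ballI)
    fix x :: real assume "x \<in> cbox 0 1"
    then have x: "x \<in> {0..1}" by simp
    then have "\<gamma> x \<in> S" using \<gamma>(2) by (auto simp: path_image_def)
    from prim[OF this] obtain e G where e: "0 < e"
      and G: "\<And>w. w \<in> ball (\<gamma> x) e \<Longrightarrow> (G has_derivative (\<lambda>h. Re h *\<^sub>R p w + Im h *\<^sub>R q w)) (at w)" by blast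
    obtain d where d: "0 < d" "\<And>t. t \<in> {0..1} \<Longrightarrow> dist t x < d \<Longrightarrow> dist (\<gamma> t) (\<gamma> x) < e"
      using cont x e unfolding continuous_on_iff by blast
    show "\<exists>d>0. \<forall>u v. x \<in> cbox u v \<and> cbox u v \<subseteq> ball x d \<and> cbox u v \<subseteq> cbox 0 1 \<longrightarrow> ?f integrable_on cbox u v"
    proof (intro exI[of _ d] conjI allI impI d(1))
      fix u v :: real assume uv: "x \<in> cbox u v \<and> cbox u v \<subseteq> ball x d \<and> cbox u v \<subseteq> cbox 0 1"
      have sub: "t \<in> {0..1}" "dist t x < d" if "t \<in> {u..v}" for t
      proof -
        have "t \<in> cbox u v" using that by simp
        then have "t \<in> ball x d" "t \<in> cbox 0 1" using uv by blast+
        then show "t \<in> {0..1}" "dist t x < d" by (auto simp: dist_commute)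
      qed
      have inb: "\<gamma> t \<in> ball (\<gamma> x) e" if "t \<in> {u..v}" for t
        using d(2)[OF sub[OF that]] by (simp add: dist_commute)
      have "(?f has_integral (G (\<gamma> v) - G (\<gamma> u))) {u..v}"
      proof (rule fundamental_theorem_of_calculus_interior_strong[where S = X])
        show "u \<le> v" using uv by auto
        have "continuous_on (ball (\<gamma> x) e) G"
          using G by (meson continuous_at_imp_continuous_on has_derivative_continuous)
        then show "continuous_on {u..v} (\<lambda>t. G (\<gamma> t))"
          by (rule continuous_on_compose2) (use inb sub continuous_on_subset[OF cont] in auto)
        fix t assume t: "t \<in> {u<..<v} - X"
        then have t': "t \<in> {u..v}" "t \<in> {0..1} - X" using sub by auto
        have "(\<gamma> has_derivative (\<lambda>h. h *\<^sub>R D t)) (at t)"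
          using D[OF t'(2)] by (simp add: has_vector_derivative_def)
        from has_derivative_compose[OF this G[OF inb[OF t'(1)]]]
        show "((\<lambda>t. G (\<gamma> t)) has_vector_derivative ?f t) (at t)"
          unfolding has_vector_derivative_def vd[OF t'(2)] by (simp add: scaleR_right_distrib)
      qed (rule X(1))
      then show "?f integrable_on cbox u v" by auto
    qed
  qed
  then show ?thesis by simp
qed

section \<open>Quaternionic inner products\<close>

lemma qcnj_sel [simp]: "qre (qcnj a) = qre a" "qi (qcnj a) = - qi a" "qj (qcnj a) = - qj a" "qk (qcnj a) = - qk a"
  by (simp_all add: qcnj_def)

lemma qcnj_add: "qcnj (a + b) = qcnj a + qcnj b"
  by (simp add: quat_eq_iff)

lemma qcnj_mult: "qcnj (a * b) = qcnj b * qcnj a"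
  by (simp add: quat_eq_iff algebra_simps)

lemma qcnj_qcnj [simp]: "qcnj (qcnj a) = a"
  by (simp add: quat_eq_iff)

lemma norm_quat_power2: "(norm a)\<^sup>2 = (qre a)\<^sup>2 + (qi a)\<^sup>2 + (qj a)\<^sup>2 + (qk a)\<^sup>2" for a :: quat
  by (simp add: norm_quat_def)

lemma qcnj_mult_self: "qcnj a * a = of_real ((norm a)\<^sup>2)"
  unfolding norm_quat_power2 by (simp add: quat_eq_iff power2_eq_square)

lemma norm_qcnj [simp]: "norm (qcnj a) = norm a"
  by (simp add: norm_quat_def)

lemma of_real_commute_quat: "of_real r * a = a * of_real r" for a :: quat
  by (simp add: quat_eq_iff)

lemma qinner_add_right: "qinner x (y + z) = qinner x y + qinner x z" for x :: "'a::quat_hilbert"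
  by (metis qinner_add_left qinner_cnj qcnj_add)

lemma qinner_scaleQ_right: "qinner x (y *\<^sub>Q a) = qcnj a * qinner x y" for x :: "'a::quat_hilbert"
  by (metis qinner_scaleQ_left qinner_cnj qcnj_mult)

lemma qinner_scaleR_left: "qinner (r *\<^sub>R x) y = r *\<^sub>R qinner x y" for x :: "'a::quat_hilbert"
  using qinner_scaleQ_left[of x "of_real r" y] by (simp add: scaleQ_of_real quat_eq_iff)

lemma qinner_scaleR_right: "qinner x (r *\<^sub>R y) = r *\<^sub>R qinner x y" for x :: "'a::quat_hilbert"
  using qinner_scaleQ_right[of x y "of_real r"] by (simp add: scaleQ_of_real quat_eq_iff)

lemma additive_qinner_left: "Modules.additive (\<lambda>x. qinner x y)" for y :: "'a::quat_hilbert"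
  by (simp add: Modules.additive_def qinner_add_left)

lemma additive_qinner_right: "Modules.additive (\<lambda>y. qinner x y)" for x :: "'a::quat_hilbert"
  by (simp add: Modules.additive_def qinner_add_right)

lemma additive_scaleQ_left: "Modules.additive (\<lambda>x. x *\<^sub>Q a)" for a :: quat
  by (simp add: Modules.additive_def scaleQ_add_left)

lemma additive_scaleQ_right: "Modules.additive (\<lambda>a. x *\<^sub>Q a)" for x :: "'a::quat_hilbert"
  by (simp add: Modules.additive_def scaleQ_add_right)

lemmas qinner_zero_left = Modules.additive.zero[OF additive_qinner_left]
  and qinner_diff_left = Modules.additive.diff[OF additive_qinner_left]
  and qinner_sum_left = Modules.additive.sum[OF additive_qinner_left]
  and qinner_sum_right = Modules.additive.sum[OF additive_qinner_right]
  and scaleQ_diff_left = Modules.additive.diff[OF additive_scaleQ_left]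
  and scaleQ_zero_right = Modules.additive.zero[OF additive_scaleQ_right]
  and scaleQ_diff_right = Modules.additive.diff[OF additive_scaleQ_right]

lemma scaleR_scaleQ: "(r *\<^sub>R x) *\<^sub>Q a = r *\<^sub>R (x *\<^sub>Q a)" for x :: "'a::quat_hilbert"
  unfolding scaleQ_of_real[symmetric] scaleQ_scaleQ of_real_commute_quat ..

lemma norm_scaleQ: "norm (x *\<^sub>Q a) = norm x * norm a" for x :: "'a::quat_hilbert"
proof -
  have "of_real ((norm (x *\<^sub>Q a))\<^sup>2) = qcnj a * (of_real ((norm x)\<^sup>2) * a)"
    unfolding qinner_self[symmetric] qinner_scaleQ_left qinner_scaleQ_right by (simp add: mult.assoc)
  also have "\<dots> = of_real ((norm x)\<^sup>2) * (qcnj a * a)"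
    unfolding of_real_commute_quat by (simp add: mult.assoc)
  also have "\<dots> = of_real ((norm x * norm a)\<^sup>2)"
    unfolding qcnj_mult_self by (simp add: power_mult_distrib)
  finally have "(norm (x *\<^sub>Q a))\<^sup>2 = (norm x * norm a)\<^sup>2"
    by (simp only: of_real_eq_iff)
  then show ?thesis by (simp add: power2_eq_iff_nonneg)
qed

lemma norm_add_power2:
  "(norm (x + y))\<^sup>2 = (norm x)\<^sup>2 + 2 * qre (qinner x y) + (norm y)\<^sup>2" for x y :: "'a::quat_hilbert"
proof -
  have n: "qre (qinner z z) = (norm z)\<^sup>2" for z :: 'a unfolding qinner_self by (simp del: of_real_power)
  have "qre (qinner y x) = qre (qinner x y)" using qinner_cnj[of y x] by simp
  then show ?thesis
    unfolding n[symmetric] qinner_add_left qinner_add_right by simp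
qed

lemma abs_qre_qinner_le: "\<bar>qre (qinner x y)\<bar> \<le> norm x * norm y" for x y :: "'a::quat_hilbert"
proof (cases "y = 0")
  case True
  have "qinner x 0 = 0" using Modules.additive.zero[OF additive_qinner_right] .
  then show ?thesis using True by simp
next
  case False
  define i where "i = qre (qinner x y)"
  \<comment> \<open>The minimiser of the norm of \<open>x + t y\<close>.\<close>
  define t where "t = - i / (norm y)\<^sup>2"
  have "0 \<le> (norm (x + t *\<^sub>R y))\<^sup>2" by simp
  also have "\<dots> = (norm x)\<^sup>2 + 2 * t * i + t\<^sup>2 * (norm y)\<^sup>2"
    unfolding norm_add_power2 qinner_scaleR_right by (simp add: i_def power_mult_distrib)
  also have "\<dots> = (norm x)\<^sup>2 - i\<^sup>2 / (norm y)\<^sup>2"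
    using False by (simp add: t_def field_simps power2_eq_square)
  finally have "i\<^sup>2 \<le> (norm x * norm y)\<^sup>2"
    using False by (simp add: field_simps power_mult_distrib)
  then show ?thesis
    using power2_le_iff_abs_le[of "norm x * norm y" "qre (qinner x y)"] by (simp add: i_def)
qed

text \<open>Multiplying \<open>x\<close> by the conjugate of the inner product makes the inner product real,
  which reduces the claim to the Cauchy-Schwarz inequality for the real part.\<close>

lemma norm_qinner_le: "norm (qinner x y) \<le> norm x * norm y" for x y :: "'a::quat_hilbert"
proof (cases "qinner x y = 0")
  case False
  define q where "q = qinner x y"
  have "(norm q)\<^sup>2 = qre (qcnj (qcnj q) * qcnj q)"
    unfolding qcnj_mult_self by (simp del: of_real_power)
  also have "\<dots> = qre (qinner (x *\<^sub>Q qcnj q) y)"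
    by (simp add: qinner_scaleQ_left q_def)
  also have "\<dots> \<le> norm x * norm q * norm y"
    using abs_qre_qinner_le[of "x *\<^sub>Q qcnj q" y] by (simp add: norm_scaleQ)
  finally have "norm q * norm q \<le> (norm x * norm y) * norm q"
    by (simp add: power2_eq_square mult_ac)
  then show ?thesis using False by (simp add: q_def)
qed simp

lemma bounded_linear_qinner_left: "bounded_linear (\<lambda>x. qinner x y)" for y :: "'a::quat_hilbert"
  by (rule bounded_linear_intro[where K = "norm y"])
    (simp_all add: qinner_add_left qinner_scaleR_left norm_qinner_le)

lemma qinner_eq_imp_eq:
  fixes x y :: "'a::quat_hilbert"
  assumes "\<And>z. qinner x z = qinner y z"
  shows "x = y"
proof -
  have "qinner (x - y) (x - y) = 0" using assms[of "x - y"] by (simp add: qinner_diff_left)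
  then have "qre (qinner (x - y) (x - y)) = 0" by simp
  then show ?thesis unfolding qinner_self by (simp del: of_real_power)
qed

lemma norm_orthonormal_sum:
  fixes c :: "'a::quat_hilbert \<Rightarrow> quat"
  assumes F: "finite F" and on: "\<And>b b'. b \<in> F \<Longrightarrow> b' \<in> F \<Longrightarrow> qinner b b' = (if b = b' then 1 else 0)"
  shows "(norm (\<Sum>b\<in>F. b *\<^sub>Q c b))\<^sup>2 = (\<Sum>b\<in>F. (norm (c b))\<^sup>2)"
proof -
  have "qinner (\<Sum>b\<in>F. b *\<^sub>Q c b) b' = c b'" if "b' \<in> F" for b'
  proof -
    have "qinner (\<Sum>b\<in>F. b *\<^sub>Q c b) b' = (\<Sum>b\<in>F. if b = b' then c b else 0)"
      unfolding qinner_sum_left by (rule sum.cong) (use on that in \<open>auto simp: qinner_scaleQ_left\<close>)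
    then show ?thesis using F that by simp
  qed
  then have "qinner (\<Sum>b\<in>F. b *\<^sub>Q c b) (\<Sum>b\<in>F. b *\<^sub>Q c b) = (\<Sum>b\<in>F. qcnj (c b) * c b)"
    unfolding qinner_sum_right qinner_scaleQ_right by (intro sum.cong) auto
  then have "of_real ((norm (\<Sum>b\<in>F. b *\<^sub>Q c b))\<^sup>2) = (of_real (\<Sum>b\<in>F. (norm (c b))\<^sup>2) :: quat)"
    unfolding qinner_self qcnj_mult_self by simp
  then show ?thesis by (simp only: of_real_eq_iff)
qed

text \<open>Both sides are differences of finite orthonormal expansions, whose norms only involve the norms
  of the coefficients. For this reason a Cauchy net of partial sums remains one when the
  coefficients are multiplied by \<open>s\<close>.\<close>

lemma norm_diff_orthonormal_sums:
  fixes c :: "'a::quat_hilbert \<Rightarrow> quat"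
  assumes B: "\<And>b b'. b \<in> B \<Longrightarrow> b' \<in> B \<Longrightarrow> qinner b b' = (if b = b' then 1 else 0)"
    and F: "finite F" "F \<subseteq> B" and G: "finite G" "G \<subseteq> B"
  shows "norm ((\<Sum>b\<in>F. b *\<^sub>Q (s * c b)) - (\<Sum>b\<in>G. b *\<^sub>Q (s * c b))) =
    norm s * norm ((\<Sum>b\<in>F. b *\<^sub>Q c b) - (\<Sum>b\<in>G. b *\<^sub>Q c b))"
proof -
  define d where "d b = (if b \<in> F then c b else 0) - (if b \<in> G then c b else 0)" for b
  have eq: "(\<Sum>b\<in>F. b *\<^sub>Q (u * c b)) - (\<Sum>b\<in>G. b *\<^sub>Q (u * c b)) = (\<Sum>b\<in>F \<union> G. b *\<^sub>Q (u * d b))" for u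
  proof -
    have "(\<Sum>b\<in>F. b *\<^sub>Q (u * c b)) = (\<Sum>b\<in>F \<union> G. b *\<^sub>Q (u * (if b \<in> F then c b else 0)))"
      by (rule sum.mono_neutral_cong_left) (use F G in \<open>auto simp: scaleQ_zero_right\<close>)
    moreover have "(\<Sum>b\<in>G. b *\<^sub>Q (u * c b)) = (\<Sum>b\<in>F \<union> G. b *\<^sub>Q (u * (if b \<in> G then c b else 0)))"
      by (rule sum.mono_neutral_cong_left) (use F G in \<open>auto simp: scaleQ_zero_right\<close>)
    ultimately show ?thesis
      by (simp add: d_def right_diff_distrib scaleQ_diff_right sum_subtractf)
  qed
  have sq: "(norm (\<Sum>b\<in>F \<union> G. b *\<^sub>Q e b))\<^sup>2 = (\<Sum>b\<in>F \<union> G. (norm (e b))\<^sup>2)" for e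
  proof (rule norm_orthonormal_sum)
    fix b b' assume "b \<in> F \<union> G" "b' \<in> F \<union> G"
    with F G have "b \<in> B" "b' \<in> B" by blast+
    then show "qinner b b' = (if b = b' then 1 else 0)" by (rule B)
  qed (use F G in blast)
  have "(norm (\<Sum>b\<in>F \<union> G. b *\<^sub>Q (s * d b)))\<^sup>2 = (norm s * norm (\<Sum>b\<in>F \<union> G. b *\<^sub>Q d b))\<^sup>2"
    unfolding power_mult_distrib sq norm_mult by (simp add: power_mult_distrib sum_distrib_left)
  then have "norm (\<Sum>b\<in>F \<union> G. b *\<^sub>Q (s * d b)) = norm s * norm (\<Sum>b\<in>F \<union> G. b *\<^sub>Q d b)"
    by (simp add: power2_eq_iff_nonneg)
  then show ?thesis using eq[of s] eq[of 1] by simp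
qed

section \<open>Left multiplication and slices\<close>

text \<open>Convergence of the defining series: its partial sums inherit the Cauchy property from the basis
  expansion of \<open>x\<close>, with distances multiplied by the norm of \<open>s\<close>.\<close>

lemma left_mult_has_sum:
  fixes B :: "'a::quat_hilbert set"
  assumes B: "hilbert_basis B"
  shows "((\<lambda>b. b *\<^sub>Q (s * qinner x b)) has_sum left_mult B s x) B"
    and "norm (left_mult B s x) = norm s * norm x"
proof -
  let ?F = "finite_subsets_at_top B"
  let ?f = "\<lambda>u b. b *\<^sub>Q (u * qinner x b)"
  have on: "\<And>b b'. b \<in> B \<Longrightarrow> b' \<in> B \<Longrightarrow> qinner b b' = (if b = b' then 1 else 0)"
    and x: "((\<lambda>b. b *\<^sub>Q qinner x b) has_sum x) B"
    using B by (auto simp: hilbert_basis_def)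
  have diff: "norm (sum (?f s) F - sum (?f s) G) = norm s * norm (sum (?f 1) F - sum (?f 1) G)"
    if "finite F" "F \<subseteq> B" "finite G" "G \<subseteq> B" for F G
    using norm_diff_orthonormal_sums[OF on that, of s "qinner x"] by simp
  have x1: "(sum (?f 1) \<longlongrightarrow> x) ?F" using x by (simp add: has_sum_def)
  have ev: "eventually (\<lambda>F. finite F \<and> F \<subseteq> B) ?F" by (rule eventually_finite_subsets_at_top_weakI) simp
  have "cauchy_filter (filtermap (sum (?f s)) ?F)"
    unfolding cauchy_filter_metric_filtermap
  proof (intro allI impI)
    fix \<epsilon> :: real assume \<epsilon>: "0 < \<epsilon>"
    define \<delta> where "\<delta> = \<epsilon> / (norm s + 1)"
    have pos: "0 < norm s + 1" using norm_ge_zero[of s] by linarith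
    then have "0 < \<delta>" using \<epsilon> by (simp add: \<delta>_def)
    moreover have "cauchy_filter (filtermap (sum (?f 1)) ?F)"
      using x1 by (intro nhds_imp_cauchy_filter) (simp add: filterlim_def)
    ultimately obtain P where P: "eventually P ?F" "\<And>F G. P F \<Longrightarrow> P G \<Longrightarrow> dist (sum (?f 1) F) (sum (?f 1) G) < \<delta>"
      unfolding cauchy_filter_metric_filtermap by meson
    show "\<exists>P. eventually P ?F \<and> (\<forall>F G. P F \<and> P G \<longrightarrow> dist (sum (?f s) F) (sum (?f s) G) < \<epsilon>)"
    proof (intro exI[of _ "\<lambda>F. P F \<and> finite F \<and> F \<subseteq> B"] conjI allI impI)
      show "eventually (\<lambda>F. P F \<and> finite F \<and> F \<subseteq> B) ?F" using P(1) ev by eventually_elim simp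
      fix F G assume FG: "(P F \<and> finite F \<and> F \<subseteq> B) \<and> (P G \<and> finite G \<and> G \<subseteq> B)"
      have "dist (sum (?f s) F) (sum (?f s) G) = norm s * dist (sum (?f 1) F) (sum (?f 1) G)"
        unfolding dist_norm using diff FG by blast
      also have "\<dots> \<le> norm s * \<delta>"
        using P(2)[of F G] FG by (intro mult_left_mono) auto
      also have "\<dots> < \<epsilon>" using \<epsilon> pos by (simp add: \<delta>_def field_simps)
      finally show "dist (sum (?f s) F) (sum (?f s) G) < \<epsilon>" .
    qed
  qed
  moreover have "complete (UNIV :: 'a set)" by (rule complete_UNIV)
  ultimately obtain L where L: "(sum (?f s) \<longlongrightarrow> L) ?F"
    using complete_uniform[where S = "UNIV :: 'a set"] by (force simp: filterlim_def)
  then have hs: "(?f s has_sum L) B" by (simp add: has_sum_def)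
  then show "(?f s has_sum left_mult B s x) B"
    unfolding left_mult_def by (simp add: infsumI)
  have "L = left_mult B s x" unfolding left_mult_def using hs by (simp add: infsumI)
  moreover have "norm L = norm s * norm x"
  proof (rule tendsto_unique[OF finite_subsets_at_top_neq_bot])
    show "((\<lambda>F. norm (sum (?f s) F)) \<longlongrightarrow> norm L) ?F" by (rule tendsto_norm[OF L])
    have "((\<lambda>F. norm s * norm (sum (?f 1) F)) \<longlongrightarrow> norm s * norm x) ?F"
      by (intro tendsto_mult tendsto_const tendsto_norm x1)
    moreover have "eventually (\<lambda>F. norm s * norm (sum (?f 1) F) = norm (sum (?f s) F)) ?F"
      using ev by eventually_elim (use diff[where G = "{}"] in simp)
    ultimately show "((\<lambda>F. norm (sum (?f s) F)) \<longlongrightarrow> norm s * norm x) ?F"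
      by (rule Lim_transform_eventually)
  qed
  ultimately show "norm (left_mult B s x) = norm s * norm x" by simp
qed

lemma qinner_left_mult:
  assumes B: "hilbert_basis B" and b: "b \<in> B"
  shows "qinner (left_mult B s x) b = s * qinner x b"
proof -
  have "((\<lambda>b'. qinner (b' *\<^sub>Q (s * qinner x b')) b) has_sum qinner (left_mult B s x) b) B"
    using has_sum_bounded_linear[OF bounded_linear_qinner_left left_mult_has_sum(1)[OF B]] by (simp add: o_def)
  moreover have "((\<lambda>b'. qinner (b' *\<^sub>Q (s * qinner x b')) b) has_sum (s * qinner x b)) {b}"
    using B b by (intro has_sum_finiteI) (auto simp: hilbert_basis_def qinner_scaleQ_left)
  moreover have "((\<lambda>b'. qinner (b' *\<^sub>Q (s * qinner x b')) b) has_sum (s * qinner x b)) {b} \<longleftrightarrow>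
      ((\<lambda>b'. qinner (b' *\<^sub>Q (s * qinner x b')) b) has_sum (s * qinner x b)) B"
    using B b by (intro has_sum_cong_neutral) (auto simp: hilbert_basis_def qinner_scaleQ_left)
  ultimately show ?thesis using has_sum_unique by blast
qed

lemma left_mult_left_mult:
  assumes B: "hilbert_basis B"
  shows "left_mult B s (left_mult B u x) = left_mult B (s * u) x"
  unfolding left_mult_def[of B s] left_mult_def[of B "s * u"]
  by (rule infsum_cong) (simp add: qinner_left_mult[OF B] mult.assoc)

lemma left_mult_add:
  assumes B: "hilbert_basis B"
  shows "left_mult B (s + u) x = left_mult B s x + left_mult B u x"
    and "left_mult B s (x + y) = left_mult B s x + left_mult B s y"
proof -
  note hs = left_mult_has_sum(1)[OF B]
  have "((\<lambda>b. b *\<^sub>Q ((s + u) * qinner x b)) has_sum (left_mult B s x + left_mult B u x)) B"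
    using has_sum_add[OF hs[of s x] hs[of u x]] by (simp add: scaleQ_add_right distrib_right)
  then show "left_mult B (s + u) x = left_mult B s x + left_mult B u x"
    using hs has_sum_unique by blast
  have "((\<lambda>b. b *\<^sub>Q (s * qinner (x + y) b)) has_sum (left_mult B s x + left_mult B s y)) B"
    using has_sum_add[OF hs[of s x] hs[of s y]] by (simp add: scaleQ_add_right distrib_left qinner_add_left)
  then show "left_mult B s (x + y) = left_mult B s x + left_mult B s y"
    using hs has_sum_unique by blast
qed

lemma left_mult_of_real:
  assumes B: "hilbert_basis B"
  shows "left_mult B (of_real r) x = r *\<^sub>R x"
proof -
  have "((\<lambda>b. b *\<^sub>Q qinner x b) has_sum x) B" using B by (simp add: hilbert_basis_def)
  then have "((\<lambda>b. r *\<^sub>R (b *\<^sub>Q qinner x b)) has_sum r *\<^sub>R x) B"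
    using has_sum_bounded_linear[OF bounded_linear_scaleR_right] by (fastforce simp: o_def)
  then have "((\<lambda>b. b *\<^sub>Q (of_real r * qinner x b)) has_sum r *\<^sub>R x) B"
    by (simp add: of_real_commute_quat scaleQ_scaleQ[symmetric] scaleQ_of_real)
  then show ?thesis
    using left_mult_has_sum(1)[OF B] has_sum_unique by blast
qed

lemma left_mult_scaleR:
  assumes B: "hilbert_basis B"
  shows "left_mult B s (r *\<^sub>R x) = r *\<^sub>R left_mult B s x"
proof -
  have "left_mult B s (left_mult B (of_real r) x) = left_mult B (of_real r) (left_mult B s x)"
    unfolding left_mult_left_mult[OF B] by (simp add: of_real_commute_quat)
  then show ?thesis unfolding left_mult_of_real[OF B] .
qed

lemma bounded_linear_left_mult:
  assumes B: "hilbert_basis B"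
  shows "bounded_linear (left_mult B s)"
  by (rule bounded_linear_intro[where K = "norm s"])
    (simp_all add: left_mult_add[OF B] left_mult_scaleR[OF B] left_mult_has_sum(2)[OF B] mult.commute)

lemma left_mult_emb:
  assumes B: "hilbert_basis B"
  shows "left_mult B (emb I z) x = Re z *\<^sub>R x + Im z *\<^sub>R left_mult B I x"
  unfolding emb_def left_mult_add(1)[OF B] left_mult_left_mult[OF B, symmetric]
    left_mult_of_real[OF B] left_mult_scaleR[OF B] ..

lemma emb_mult:
  assumes "I \<in> imag_sphere" shows "emb I (z * w) = emb I z * emb I w"
proof -
  have I: "qre I = 0" "qi I * qi I + qj I * qj I + qk I * qk I = 1"
    using assms norm_quat_power2[of I] by (auto simp: imag_sphere_def power2_eq_square)
  have "qre (emb I z * emb I w) = Re z * Re w - (qi I * qi I + qj I * qj I + qk I * qk I) * (Im z * Im w)"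
    using I(1) by (simp add: emb_def algebra_simps)
  then have "qre (emb I z * emb I w) = qre (emb I (z * w))"
    using I by (simp add: emb_def)
  then show ?thesis
    using I(1) by (simp add: quat_eq_iff emb_def algebra_simps)
qed

lemma emb_uminus: "emb I (- z) = - emb I z"
  by (simp add: emb_def)

lemma emb_imag_unit [simp]: "emb I \<i> = I"
  by (simp add: emb_def)

lemma emb_sphere_sel:
  assumes "I \<in> imag_sphere"
  shows "qre (emb I z) = Re z" and "norm (emb I z) = norm z" and "qcnj (emb I z) = emb I (cnj z)"
proof -
  have I: "qre I = 0" "(qi I)\<^sup>2 + (qj I)\<^sup>2 + (qk I)\<^sup>2 = 1"
    using assms norm_quat_power2[of I] by (auto simp: imag_sphere_def)
  show "qre (emb I z) = Re z" using I by (simp add: emb_def)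
  have "(norm (emb I z))\<^sup>2 = (Re z)\<^sup>2 + ((qi I)\<^sup>2 + (qj I)\<^sup>2 + (qk I)\<^sup>2) * (Im z)\<^sup>2"
    unfolding norm_quat_power2 using I(1) by (simp add: emb_def power_mult_distrib algebra_simps)
  then have "(norm (emb I z))\<^sup>2 = (norm z)\<^sup>2" using I by (simp add: cmod_power2)
  then show "norm (emb I z) = norm z" by (simp add: power2_eq_iff_nonneg)
  show "qcnj (emb I z) = emb I (cnj z)" using I by (simp add: emb_def quat_eq_iff)
qed

lemma emb_cnj_eq: "emb I (cnj z) = emb (- I) z"
  by (simp add: emb_def)

lemma bounded_linear_emb: "bounded_linear (emb I)"
proof -
  have "bounded_linear (\<lambda>z. Re z *\<^sub>R (1 :: quat) + Im z *\<^sub>R I)"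
    by (intro bounded_linear_add bounded_linear_scaleR_const bounded_linear_Re bounded_linear_Im)
  moreover have "(\<lambda>z. Re z *\<^sub>R (1 :: quat) + Im z *\<^sub>R I) = emb I"
    by (auto simp: emb_def quat_eq_iff)
  ultimately show ?thesis by simp
qed

section \<open>The resolvent of a unitary operator\<close>

lemma right_linearD:
  assumes "right_linear T"
  shows "T (x + y) = T x + T y" "T (x *\<^sub>Q a) = T x *\<^sub>Q a" "T (r *\<^sub>R x) = r *\<^sub>R T x"
    "T 0 = 0" "T (- x) = - T x" "T (x - y) = T x - T y"
proof -
  show add: "T (x + y) = T x + T y" for x y using assms by (simp add: right_linear_def)
  show "T (x *\<^sub>Q a) = T x *\<^sub>Q a" using assms by (simp add: right_linear_def)
  show "T (r *\<^sub>R x) = r *\<^sub>R T x"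
    using assms by (simp add: right_linear_def scaleQ_of_real[symmetric])
  have "Modules.additive T" using add by (simp add: Modules.additive_def)
  then show "T 0 = 0" "T (- x) = - T x" "T (x - y) = T x - T y"
    by (simp_all add: Modules.additive.zero Modules.additive.minus Modules.additive.diff)
qed

lemma op_invertible_iff:
  fixes T :: "'a::quat_hilbert \<Rightarrow> 'a"
  assumes T: "right_linear T"
  shows "op_invertible T \<longleftrightarrow> surj T \<and> (\<exists>\<delta>>0. \<forall>x. \<delta> * norm x \<le> norm (T x))"
proof
  assume "op_invertible T"
  then obtain S where S: "right_linear S" "bounded_linear S" "\<And>x. S (T x) = x" "\<And>x. T (S x) = x"
    unfolding op_invertible_def by blast
  obtain M where M: "0 < M" "\<And>x. norm (S x) \<le> norm x * M" using bounded_linear.pos_bounded[OF S(2)] by blast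
  have "(1 / M) * norm x \<le> norm (T x)" for x
    using M(2)[of "T x"] M(1) by (simp add: S field_simps)
  then show "surj T \<and> (\<exists>\<delta>>0. \<forall>x. \<delta> * norm x \<le> norm (T x))"
    using M(1) by (intro conjI exI[of _ "1 / M"] surjI[of T S, OF S(4)]) auto
next
  assume "surj T \<and> (\<exists>\<delta>>0. \<forall>x. \<delta> * norm x \<le> norm (T x))"
  then obtain \<delta> where "surj T" and \<delta>: "0 < \<delta>" "\<And>x. \<delta> * norm x \<le> norm (T x)" by blast
  have "x = y" if "T x = T y" for x y
    using \<delta>(2)[of "x - y"] \<delta>(1) that by (simp add: right_linearD[OF T] mult_le_0_iff)
  then have inj: "inj T" by (rule injI)
  have TS: "T (inv T x) = x" for x by (rule surj_f_inv_f[OF \<open>surj T\<close>])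
  have ST: "inv T (T x) = x" for x by (rule inv_f_f[OF inj])
  have rl: "right_linear (inv T)"
    unfolding right_linear_def
  proof (intro conjI allI)
    show "inv T (x + y) = inv T x + inv T y" for x y
      using ST[of "inv T x + inv T y"] by (simp add: right_linearD[OF T] TS)
    show "inv T (x *\<^sub>Q a) = inv T x *\<^sub>Q a" for x a
      using ST[of "inv T x *\<^sub>Q a"] by (simp add: right_linearD[OF T] TS)
  qed
  moreover have "bounded_linear (inv T)"
  proof (rule bounded_linear_intro[where K = "1 / \<delta>"])
    show "norm (inv T x) \<le> norm x * (1 / \<delta>)" for x
      using \<delta>(2)[of "inv T x"] \<delta>(1) by (simp add: TS field_simps)
  qed (simp_all add: right_linearD[OF rl])
  ultimately show "op_invertible T" unfolding op_invertible_def using TS ST by blast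
qed

lemma inv_op_invertible:
  fixes T :: "'a::quat_hilbert \<Rightarrow> 'a"
  assumes "op_invertible T"
  shows "right_linear (inv T)" "bounded_linear (inv T)" "inv T (T x) = x" "T (inv T x) = x"
proof -
  obtain S where S: "right_linear S" "bounded_linear S" "\<And>x. S (T x) = x" "\<And>x. T (S x) = x"
    using assms unfolding op_invertible_def by blast
  have "inv T = S" by (rule inv_unique_comp) (auto simp: S o_def)
  then show "right_linear (inv T)" "bounded_linear (inv T)" "inv T (T x) = x" "T (inv T x) = x"
    using S by auto
qed

text \<open>To solve \<open>T x = y\<close> apply Banach's fixed point theorem to \<open>x \<mapsto>
  T0\<inverse> (y + T0 x - T x)\<close>, which contracts by \<open>\<eta> / \<delta>\<close>.\<close>

lemma op_invertible_perturbation: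
  fixes T T0 :: "'a::quat_hilbert \<Rightarrow> 'a"
  assumes T: "right_linear T" and T0: "right_linear T0" "op_invertible T0"
    and \<delta>: "0 < \<delta>" "\<And>x. \<delta> * norm x \<le> norm (T0 x)" and \<eta>: "0 \<le> \<eta>" "\<eta> < \<delta>" "\<And>x. norm (T0 x - T x) \<le> \<eta> * norm x"
  shows "op_invertible T"
  unfolding op_invertible_iff[OF T]
proof (intro conjI exI[of _ "\<delta> - \<eta>"] allI)
  note S = inv_op_invertible[OF T0(2)]
  show "0 < \<delta> - \<eta>" using \<eta> by simp
  show "(\<delta> - \<eta>) * norm x \<le> norm (T x)" for x
  proof -
    have "norm (T0 x) \<le> norm (T x) + norm (T0 x - T x)"
      using norm_triangle_ineq[of "T x" "T0 x - T x"] by simp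
    then show ?thesis using \<delta>(2)[of x] \<eta>(3)[of x] by (simp add: left_diff_distrib)
  qed
  show "surj T"
    unfolding surj_def
  proof
    fix y
    define g where "g x = inv T0 (y + (T0 x - T x))" for x
    have "\<exists>!x. g x = x"
    proof (rule banach_fix_type)
      show "0 \<le> \<eta> / \<delta>" "\<eta> / \<delta> < 1" using \<delta> \<eta> by auto
      show "\<forall>x z. dist (g x) (g z) \<le> \<eta> / \<delta> * dist x z"
      proof (intro allI)
        fix x z
        have "T0 (g x - g z) = T0 (x - z) - T (x - z)"
          unfolding right_linearD(6)[OF T0(1)] right_linearD(6)[OF T] g_def S(4) by simp
        then have "\<delta> * norm (g x - g z) \<le> \<eta> * norm (x - z)"
          using \<delta>(2)[of "g x - g z"] \<eta>(3)[of "x - z"] by simp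
        then show "dist (g x) (g z) \<le> \<eta> / \<delta> * dist x z"
          using \<delta>(1) by (simp add: dist_norm field_simps)
      qed
    qed
    then obtain x where "g x = x" by blast
    then have "T0 x = y + (T0 x - T x)" using S(4) unfolding g_def by metis
    then show "\<exists>x. y = T x" by (intro exI[of _ x]) simp
  qed
qed

locale quat_unitary =
  fixes U :: "'a::quat_hilbert \<Rightarrow> 'a"
  assumes U: "unitary U"
begin

lemma rl_U: "right_linear U" and bij_U: "bij U"
  using U by (auto simp: unitary_def)

lemma inv_U: "inv U (U x) = x" "U (inv U x) = x"
  using bij_U by (simp_all add: bij_is_inj bij_is_surj surj_f_inv_f)

lemma rl_inv_U: "right_linear (inv U)"
  unfolding right_linear_def
proof (intro conjI allI)
  show "inv U (x + y) = inv U x + inv U y" for x y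
    using inv_U(1)[of "inv U x + inv U y"] by (simp add: right_linearD[OF rl_U] inv_U)
  show "inv U (x *\<^sub>Q a) = inv U x *\<^sub>Q a" for x a
    using inv_U(1)[of "inv U x *\<^sub>Q a"] by (simp add: right_linearD[OF rl_U] inv_U)
qed

lemma norm_U [simp]: "norm (U x) = norm x"
proof -
  have "qinner (U x) (U x) = qinner x x" using U by (simp add: unitary_def inv_U)
  then have "(norm (U x))\<^sup>2 = (norm x)\<^sup>2" unfolding qinner_self by (simp only: of_real_eq_iff)
  then show ?thesis by (simp add: power2_eq_iff_nonneg)
qed

lemma norm_inv_U [simp]: "norm (inv U x) = norm x"
  using norm_U[of "inv U x"] by (simp add: inv_U)

lemmas U_simps = right_linearD[OF rl_U]

text \<open>The value of \<open>S_pencil U\<close> at \<open>emb I z\<close> for any imaginary unit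
  \<open>I\<close>. Accordingly the S-spectrum meets all slices in the same set
  \<open>spec\<close> of complex numbers.\<close>

definition pencil :: "complex \<Rightarrow> 'a \<Rightarrow> 'a" where
  "pencil z x = U (U x) - (2 * Re z) *\<^sub>R U x + (norm z)\<^sup>2 *\<^sub>R x"

definition spec :: "complex set" where
  "spec = {z. \<not> op_invertible (pencil z)}"

abbreviation Rs :: "complex \<Rightarrow> 'a \<Rightarrow> 'a" where "Rs z \<equiv> inv (pencil z)"

lemma rl_pencil: "right_linear (pencil z)"
  unfolding right_linear_def pencil_def
  by (simp add: U_simps scaleQ_add_left scaleQ_diff_left scaleR_scaleQ algebra_simps)

lemma pencil_cnj: "pencil (cnj z) = pencil z"
  by (simp add: pencil_def fun_eq_iff)

lemma spec_cnj: "cnj z \<in> spec \<longleftrightarrow> z \<in> spec"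
  by (simp add: spec_def pencil_cnj)

lemma pencil_factor: "pencil z x = U (U x - Re z *\<^sub>R x) - Re z *\<^sub>R (U x - Re z *\<^sub>R x) + (Im z)\<^sup>2 *\<^sub>R x"
proof -
  have "(2 * Re z) *\<^sub>R U x = Re z *\<^sub>R U x + Re z *\<^sub>R U x"
    unfolding scaleR_left_distrib[symmetric] by simp
  then show ?thesis
    unfolding pencil_def cmod_power2 by (simp only: U_simps) (simp add: algebra_simps power2_eq_square)
qed

lemma Rs:
  assumes "z \<notin> spec"
  shows "right_linear (Rs z)" "bounded_linear (Rs z)" "Rs z (pencil z x) = x" "pencil z (Rs z x) = x"
    "U (Rs z x) = Rs z (U x)"
proof -
  have inv: "op_invertible (pencil z)" using assms by (simp add: spec_def)
  show R: "right_linear (Rs z)" "bounded_linear (Rs z)" "\<And>x. Rs z (pencil z x) = x" "\<And>x. pencil z (Rs z x) = x"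
    using inv_op_invertible[OF inv] by auto
  have "pencil z (U (Rs z x)) = U (pencil z (Rs z x))" by (simp add: pencil_def U_simps)
  then show "U (Rs z x) = Rs z (U x)" using R(3)[of "U (Rs z x)"] by (simp add: R(4))
qed

lemma pencil_diff_le:
  "norm (pencil z0 x - pencil z x) \<le> (2 * \<bar>Re z - Re z0\<bar> + \<bar>(norm z)\<^sup>2 - (norm z0)\<^sup>2\<bar>) * norm x"
proof -
  have "pencil z0 x - pencil z x = (2 * (Re z - Re z0)) *\<^sub>R U x - ((norm z)\<^sup>2 - (norm z0)\<^sup>2) *\<^sub>R x"
    by (simp add: pencil_def algebra_simps)
  also have "norm \<dots> \<le> norm ((2 * (Re z - Re z0)) *\<^sub>R U x) + norm (((norm z)\<^sup>2 - (norm z0)\<^sup>2) *\<^sub>R x)"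
    by (rule norm_triangle_ineq4)
  also have "\<dots> = (2 * \<bar>Re z - Re z0\<bar> + \<bar>(norm z)\<^sup>2 - (norm z0)\<^sup>2\<bar>) * norm x"
    unfolding norm_scaleR norm_U abs_mult by (simp add: distrib_right)
  finally show ?thesis .
qed

text \<open>Openness of the resolvent set together with a lower bound that is uniform in a neighbourhood;
  the latter is what makes the inverse depend continuously on \<open>z\<close>.\<close>

lemma pencil_near:
  assumes z0: "z0 \<notin> spec"
  shows "\<exists>\<delta>>0. eventually (\<lambda>z. z \<notin> spec \<and> (\<forall>x. \<delta> / 2 * norm x \<le> norm (pencil z x))) (nhds z0)"
proof -
  have inv: "op_invertible (pencil z0)" using z0 by (simp add: spec_def)
  then obtain \<delta> where \<delta>: "0 < \<delta>" "\<And>x. \<delta> * norm x \<le> norm (pencil z0 x)"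
    unfolding op_invertible_iff[OF rl_pencil] by blast
  define \<eta> where "\<eta> z = 2 * \<bar>Re z - Re z0\<bar> + \<bar>(norm z)\<^sup>2 - (norm z0)\<^sup>2\<bar>" for z
  have "(\<eta> \<longlongrightarrow> 2 * \<bar>Re z0 - Re z0\<bar> + \<bar>(norm z0)\<^sup>2 - (norm z0)\<^sup>2\<bar>) (nhds z0)"
    unfolding \<eta>_def by (intro tendsto_intros filterlim_ident)
  then have "eventually (\<lambda>z. \<eta> z < \<delta> / 2) (nhds z0)"
    by (rule order_tendstoD) (use \<delta> in simp)
  then have "eventually (\<lambda>z. z \<notin> spec \<and> (\<forall>x. \<delta> / 2 * norm x \<le> norm (pencil z x))) (nhds z0)"
  proof eventually_elim
    case (elim z)
    have \<eta>: "0 \<le> \<eta> z" "\<eta> z < \<delta>" "norm (pencil z0 x - pencil z x) \<le> \<eta> z * norm x" for x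
      using elim \<delta>(1) pencil_diff_le[of z0 x z] by (auto simp: \<eta>_def)
    have "op_invertible (pencil z)"
      by (rule op_invertible_perturbation[OF rl_pencil rl_pencil inv \<delta> \<eta>])
    moreover have "\<delta> / 2 * norm x \<le> norm (pencil z x)" for x
    proof -
      have "norm (pencil z0 x) \<le> norm (pencil z x) + norm (pencil z0 x - pencil z x)"
        using norm_triangle_ineq[of "pencil z x" "pencil z0 x - pencil z x"] by simp
      moreover have "\<eta> z * norm x \<le> \<delta> / 2 * norm x" using elim by (intro mult_right_mono) auto
      ultimately show ?thesis using \<delta>(2)[of x] \<eta>(3)[of x] by (simp add: field_simps)
    qed
    ultimately show ?case by (simp add: spec_def)
  qed
  with \<delta>(1) show ?thesis by (intro exI[of _ \<delta>] conjI)
qed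

lemma closed_spec: "closed spec"
proof -
  have "open (- spec)"
  proof (subst open_subopen, rule ballI)
    fix z0 assume "z0 \<in> - spec"
    then have "z0 \<notin> spec" by simp
    from pencil_near[OF this] obtain \<delta> where
      ev: "eventually (\<lambda>z. z \<notin> spec \<and> (\<forall>x. \<delta> / 2 * norm x \<le> norm (pencil z x))) (nhds z0)"
      by (elim exE conjE)
    from ev have "eventually (\<lambda>z. z \<notin> spec) (nhds z0)" by (rule eventually_mono) (erule conjunct1)
    then obtain T where "open T" "z0 \<in> T" "\<forall>z\<in>T. z \<notin> spec" unfolding eventually_nhds by blast
    then show "\<exists>T. open T \<and> z0 \<in> T \<and> T \<subseteq> - spec" by (intro exI[of _ T]) auto
  qed
  then show ?thesis by (simp add: closed_def)
qed

lemma continuous_Rs: "continuous_on (- spec) (\<lambda>z. Rs z x)"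
proof -
  have "isCont (\<lambda>z. Rs z x) z0" if z0: "z0 \<notin> spec" for z0
  proof -
    from pencil_near[OF z0] obtain \<delta> where \<delta>: "0 < \<delta>"
      "eventually (\<lambda>z. z \<notin> spec \<and> (\<forall>x. \<delta> / 2 * norm x \<le> norm (pencil z x))) (nhds z0)"
      by (elim exE conjE)
    define \<eta> where "\<eta> z = 2 * \<bar>Re z - Re z0\<bar> + \<bar>(norm z)\<^sup>2 - (norm z0)\<^sup>2\<bar>" for z
    have "((\<lambda>z. Rs z x - Rs z0 x) \<longlongrightarrow> 0) (nhds z0)"
    proof (rule Lim_null_comparison)
      show "eventually (\<lambda>z. norm (Rs z x - Rs z0 x) \<le> 2 / \<delta> * (\<eta> z * norm (Rs z0 x))) (nhds z0)"
        using \<delta>(2)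
      proof eventually_elim
        case (elim z)
        then have z: "z \<notin> spec" by blast
        have "pencil z (Rs z x - Rs z0 x) = pencil z0 (Rs z0 x) - pencil z (Rs z0 x)"
          unfolding right_linearD(6)[OF rl_pencil] Rs(4)[OF z] Rs(4)[OF z0] ..
        then have "norm (pencil z (Rs z x - Rs z0 x)) \<le> \<eta> z * norm (Rs z0 x)"
          using pencil_diff_le[of z0 "Rs z0 x" z] unfolding \<eta>_def by (simp only:)
        moreover have "\<delta> / 2 * norm (Rs z x - Rs z0 x) \<le> norm (pencil z (Rs z x - Rs z0 x))"
          by (rule conjunct2[OF elim, THEN spec])
        ultimately have "\<delta> / 2 * norm (Rs z x - Rs z0 x) \<le> \<eta> z * norm (Rs z0 x)"
          by (rule order_trans[rotated])
        then show ?case using \<delta>(1) by (simp add: field_simps)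
      qed
      have "((\<lambda>z. 2 / \<delta> * (\<eta> z * norm (Rs z0 x))) \<longlongrightarrow>
          2 / \<delta> * ((2 * \<bar>Re z0 - Re z0\<bar> + \<bar>(norm z0)\<^sup>2 - (norm z0)\<^sup>2\<bar>) * norm (Rs z0 x))) (nhds z0)"
        unfolding \<eta>_def by (intro tendsto_intros filterlim_ident)
      then show "((\<lambda>z. 2 / \<delta> * (\<eta> z * norm (Rs z0 x))) \<longlongrightarrow> 0) (nhds z0)" by simp
    qed
    then have "((\<lambda>z. Rs z x) \<longlongrightarrow> Rs z0 x) (nhds z0)" by (rule LIM_zero_cancel)
    then show ?thesis unfolding isCont_def by (rule tendsto_mono[OF at_within_le_nhds])
  qed
  then show ?thesis by (intro continuous_at_imp_continuous_on) auto
qed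

end

text \<open>Pairs of vectors represent the complexification, with complex scalars acting by
  \<open>complex_scale\<close>.\<close>

definition complex_scale :: "complex \<Rightarrow> 'a \<times> 'a \<Rightarrow> 'a \<times> 'a::real_vector" where
  "complex_scale z p = (Re z *\<^sub>R fst p - Im z *\<^sub>R snd p, Re z *\<^sub>R snd p + Im z *\<^sub>R fst p)"

lemma complex_scale_diff: "complex_scale z (p - q) = complex_scale z p - complex_scale z q"
  by (simp add: complex_scale_def algebra_simps prod_eq_iff)

lemma complex_scale_complex_scale: "complex_scale z (complex_scale w p) = complex_scale (z * w) p"
  by (simp add: complex_scale_def algebra_simps prod_eq_iff)

lemma complex_scale_one [simp]: "complex_scale 1 p = p"
  by (simp add: complex_scale_def)

text \<open>The cross terms cancel because the real part of the inner product is symmetric.\<close>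

lemma norm_complex_scale: "norm (complex_scale z p) = norm z * norm p" for p :: "'a::quat_hilbert \<times> 'a"
proof -
  have sym: "qre (qinner (snd p) (fst p)) = qre (qinner (fst p) (snd p))"
    using qinner_cnj[of "snd p" "fst p"] by simp
  have n: "(norm p)\<^sup>2 = (norm (fst p))\<^sup>2 + (norm (snd p))\<^sup>2" for p :: "'a \<times> 'a"
    by (simp add: norm_prod_def)
  have "complex_scale z p = (Re z *\<^sub>R fst p + (- Im z) *\<^sub>R snd p, Re z *\<^sub>R snd p + Im z *\<^sub>R fst p)"
    by (simp add: complex_scale_def)
  then have "(norm (complex_scale z p))\<^sup>2 = (norm z * norm p)\<^sup>2"
    unfolding power_mult_distrib n cmod_power2
    by (simp only: fst_conv snd_conv norm_add_power2 qinner_scaleR_left qinner_scaleR_right norm_scaleR quat_sel_mult sym)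
      (simp add: power_mult_distrib algebra_simps)
  then show ?thesis by (simp add: power2_eq_iff_nonneg)
qed

context quat_unitary
begin

definition pair_U :: "'a \<times> 'a \<Rightarrow> 'a \<times> 'a" where
  "pair_U p = (U (fst p), U (snd p))"

lemma norm_pair_U: "norm (pair_U p) = norm p"
  by (simp add: pair_U_def norm_prod_def)

lemma pair_U_diff: "pair_U (p - q) = pair_U p - pair_U q"
  by (simp add: pair_U_def U_simps prod_eq_iff)

text \<open>The pencil is \<open>(U - z) (U - cnj z)\<close> on the complexification.\<close>

lemma pair_U_factor_pencil:
  "pair_U (pair_U p - complex_scale (cnj z) p) - complex_scale z (pair_U p - complex_scale (cnj z) p) = (pencil z (fst p), pencil z (snd p))"
proof -
  have two: "(2 * Re z) *\<^sub>R v = Re z *\<^sub>R v + Re z *\<^sub>R v" for v :: 'a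
    unfolding scaleR_left_distrib[symmetric] by simp
  show ?thesis
    unfolding pencil_def two cmod_power2
    by (simp add: pair_U_def complex_scale_def U_simps prod_eq_iff algebra_simps power2_eq_square)
qed

lemma pair_U_lower: "\<bar>1 - norm z\<bar> * norm p \<le> norm (pair_U p - complex_scale z p)"
proof -
  have "\<bar>norm (pair_U p) - norm (complex_scale z p)\<bar> \<le> norm (pair_U p - complex_scale z p)" by (rule norm_triangle_ineq3)
  moreover have "norm p - norm z * norm p = (1 - norm z) * norm p" by (simp add: left_diff_distrib)
  ultimately show ?thesis by (simp only: norm_pair_U norm_complex_scale abs_mult abs_norm_cancel)
qed

text \<open>On the complexification \<open>U\<close> is isometric and bijective, so one of the fixed point
  equations \<open>p = U\<inverse> (y + z p)\<close> and \<open>p = (U p - y) / z\<close> is a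
  contraction.\<close>

lemma pair_U_surj:
  assumes z: "norm z \<noteq> 1"
  shows "\<exists>p. pair_U p - complex_scale z p = y"
proof (cases "norm z < 1")
  case True
  define V where "V p = (inv U (fst p), inv U (snd p))" for p :: "'a \<times> 'a"
  have nV: "norm (V p) = norm p" for p by (simp add: V_def norm_prod_def)
  have UV: "pair_U (V p) = p" for p by (simp add: pair_U_def V_def inv_U)
  have Vd: "V (p - q) = V p - V q" for p q by (simp add: V_def right_linearD[OF rl_inv_U] prod_eq_iff)
  have "\<exists>!p. V (y + complex_scale z p) = p"
  proof (rule banach_fix_type)
    show "\<forall>p q. dist (V (y + complex_scale z p)) (V (y + complex_scale z q)) \<le> norm z * dist p q"
      unfolding dist_norm Vd[symmetric] nV by (simp add: complex_scale_diff[symmetric] norm_complex_scale)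
  qed (use True in auto)
  then obtain p where "V (y + complex_scale z p) = p" by blast
  then have "pair_U p = y + complex_scale z p" using UV by metis
  then show ?thesis by (intro exI[of _ p]) simp
next
  case False
  with z have z1: "1 < norm z" by simp
  then have z0: "z \<noteq> 0" by auto
  have "\<exists>!p. complex_scale (1 / z) (pair_U p - y) = p"
  proof (rule banach_fix_type)
    show "\<forall>p q. dist (complex_scale (1 / z) (pair_U p - y)) (complex_scale (1 / z) (pair_U q - y)) \<le> 1 / norm z * dist p q"
      unfolding dist_norm complex_scale_diff[symmetric] norm_complex_scale by (simp add: pair_U_diff[symmetric] norm_pair_U norm_divide)
  qed (use z1 in \<open>auto simp: divide_less_eq_1\<close>)
  then obtain p where p: "complex_scale (1 / z) (pair_U p - y) = p" by blast
  have "complex_scale z p = complex_scale z (complex_scale (1 / z) (pair_U p - y))" using p by simp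
  also have "\<dots> = pair_U p - y" using z0 by (simp add: complex_scale_complex_scale)
  finally show ?thesis by (intro exI[of _ p]) simp
qed

text \<open>Surjectivity and the lower bound of \<open>U - z\<close> and of \<open>U - cnj z\<close> pass to
  their product, which acts as the pencil on both components.\<close>

lemma off_circle_notin_spec:
  assumes z: "norm z \<noteq> 1"
  shows "z \<notin> spec"
proof -
  have "surj (pencil z)"
    unfolding surj_def
  proof
    fix y
    obtain q where q: "pair_U q - complex_scale z q = (y, 0)" using pair_U_surj[OF z] by blast
    have "norm (cnj z) \<noteq> 1" using z by simp
    then obtain p where p: "pair_U p - complex_scale (cnj z) p = q" using pair_U_surj by blast
    have "(y, 0) = (pencil z (fst p), pencil z (snd p))"
      using pair_U_factor_pencil[of p z] unfolding p q .
    then show "\<exists>x. y = pencil z x" by auto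
  qed
  moreover have "(1 - norm z)\<^sup>2 * norm x \<le> norm (pencil z x)" for x
  proof -
    have "(1 - norm z)\<^sup>2 * norm x = \<bar>1 - norm z\<bar> * (\<bar>1 - norm (cnj z)\<bar> * norm (x, 0 :: 'a))"
      by (simp add: power2_eq_square abs_mult_self_eq mult.assoc[symmetric] norm_prod_def)
    also have "\<dots> \<le> \<bar>1 - norm z\<bar> * norm (pair_U (x, 0) - complex_scale (cnj z) (x, 0))"
      by (intro mult_left_mono pair_U_lower) simp
    also have "\<dots> \<le> norm (pair_U (pair_U (x, 0) - complex_scale (cnj z) (x, 0)) - complex_scale z (pair_U (x, 0) - complex_scale (cnj z) (x, 0)))"
      by (rule pair_U_lower)
    also have "\<dots> = norm (pencil z x)"
      unfolding pair_U_factor_pencil by (simp add: norm_prod_def right_linearD[OF rl_pencil])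
    finally show ?thesis .
  qed
  moreover have "0 < (1 - norm z)\<^sup>2" using z by simp
  ultimately have "op_invertible (pencil z)" unfolding op_invertible_iff[OF rl_pencil] by blast
  then show ?thesis by (simp add: spec_def)
qed

lemma spec_subset_circle: "spec \<subseteq> sphere 0 1"
proof
  fix z assume "z \<in> spec"
  then have "norm z = 1" using off_circle_notin_spec by blast
  then show "z \<in> sphere 0 1" by simp
qed

text \<open>The vectors \<open>res_re x z\<close> and \<open>res_im x z\<close> are the real and imaginary
  part of \<open>(U - z)\<inverse> x\<close>.\<close>

definition res_re :: "'a \<Rightarrow> complex \<Rightarrow> 'a" where
  "res_re x z = U (Rs z x) - Re z *\<^sub>R Rs z x"

definition res_im :: "'a \<Rightarrow> complex \<Rightarrow> 'a" where
  "res_im x z = Im z *\<^sub>R Rs z x"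

lemma resolvent_equation:
  assumes z: "z \<notin> spec"
  shows "U (res_re x z) = Re z *\<^sub>R res_re x z - Im z *\<^sub>R res_im x z + x"
    and "U (res_im x z) = Re z *\<^sub>R res_im x z + Im z *\<^sub>R res_re x z"
proof -
  have "x = U (res_re x z) - Re z *\<^sub>R res_re x z + (Im z)\<^sup>2 *\<^sub>R Rs z x"
    using Rs(4)[OF z, of x] unfolding pencil_factor res_re_def by simp
  then show "U (res_re x z) = Re z *\<^sub>R res_re x z - Im z *\<^sub>R res_im x z + x"
    by (simp add: res_im_def power2_eq_square algebra_simps)
  show "U (res_im x z) = Re z *\<^sub>R res_im x z + Im z *\<^sub>R res_re x z"
    by (simp add: res_im_def res_re_def U_simps algebra_simps)
qed

lemma continuous_res:
  "continuous_on (- spec) (res_re x)" "continuous_on (- spec) (res_im x)"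
proof -
  have "bounded_linear U"
    by (rule bounded_linear_intro[where K = 1]) (simp_all add: U_simps)
  then have "continuous_on (- spec) (\<lambda>z. U (Rs z x))"
    by (rule bounded_linear.continuous_on[OF _ continuous_Rs])
  then show "continuous_on (- spec) (res_re x)"
    unfolding res_re_def[abs_def] by (intro continuous_intros continuous_Rs)
  show "continuous_on (- spec) (res_im x)"
    unfolding res_im_def[abs_def] by (intro continuous_intros continuous_Rs)
qed

lemma res_cnj: "res_re x (cnj z) = res_re x z" "res_im x (cnj z) = - res_im x z"
  by (simp_all add: res_re_def res_im_def pencil_cnj)

end

context quat_unitary
begin

text \<open>Along the orbit of \<open>(U - z)\<inverse> x\<close> under \<open>U\<close>, or under its
  inverse when \<open>z\<close> lies inside the disc, the pairing is a bounded sequence satisfying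
  the recursion that determines the Cauchy transform.\<close>

lemma resolvent_pairing_eq_Lam:
  fixes h :: "quat \<Rightarrow> complex"
  assumes cf: "circle_functional S \<mu> e" and h: "bounded_linear h"
    and pos: "\<And>n. h (qinner ((U ^^ n) x) y) = circle_functional.Lam S wgt \<mu> e (\<lambda>w. w ^ n)"
    and neg: "\<And>n. h (qinner ((inv U ^^ n) x) y) = circle_functional.Lam S wgt \<mu> e (\<lambda>w. cnj w ^ n)"
    and z: "norm z \<noteq> 1"
  shows "h (qinner (res_re x z) y) + \<i> * h (qinner (res_im x z) y)
    = circle_functional.Lam S wgt \<mu> e (\<lambda>w. 1 / (w - z))"
proof -
  interpret circle_functional S wgt \<mu> e by (rule cf)
  interpret h: bounded_linear h by (rule h)
  define H where "H u v = h (qinner u y) + \<i> * h (qinner v y)" for u v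
  define a where "a = res_re x z"
  define b where "b = res_im x z"
  note eq = resolvent_equation[OF off_circle_notin_spec[OF z], of x, folded a_def b_def]
  have H_rec: "H (Re z *\<^sub>R u - Im z *\<^sub>R v + w) (Re z *\<^sub>R v + Im z *\<^sub>R u) = z * H u v + h (qinner w y)" for u v w
    unfolding H_def
    by (simp add: qinner_add_left qinner_diff_left qinner_scaleR_left h.add h.diff h.scaleR
        complex_eq_iff algebra_simps)
  obtain M where M: "0 < M" "\<And>q. norm (h q) \<le> norm q * M" using h.pos_bounded by blast
  have H_bd: "norm (H u v) \<le> (norm u * norm y + norm v * norm y) * M" for u v
  proof -
    have "norm (h (qinner t y)) \<le> norm t * norm y * M" for t
      by (rule order_trans[OF M(2) mult_right_mono[OF norm_qinner_le]]) (use M(1) in simp)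
    then show ?thesis
      unfolding H_def by (intro order_trans[OF norm_triangle_ineq]) (simp add: norm_mult distrib_right add_mono)
  qed
  have pow_rl: "right_linear (T ^^ n)" if "right_linear T" for T :: "'a \<Rightarrow> 'a" and n
    by (induction n) (use that in \<open>auto simp: right_linear_def\<close>)
  have pow_norm: "norm ((T ^^ n) u) = norm u" if "\<And>u. norm (T u) = norm u" for T :: "'a \<Rightarrow> 'a" and n u
    by (induction n) (simp_all add: that)
  have "H a b = Lam (\<lambda>w. 1 / (w - z))"
  proof (cases "1 < norm z")
    case True
    note P = right_linearD[OF pow_rl[OF rl_U]]
    have "H ((U ^^ 0) a) ((U ^^ 0) b) = Lam (\<lambda>w. 1 / (w - z))"
    proof (rule cauchy_transform_outside[OF True, where \<phi> = "\<lambda>n. H ((U ^^ n) a) ((U ^^ n) b)"])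
      show "norm (H ((U ^^ n) a) ((U ^^ n) b)) \<le> (norm a * norm y + norm b * norm y) * M" for n
        using H_bd[of "(U ^^ n) a" "(U ^^ n) b"] by (simp add: pow_norm)
      show "H ((U ^^ Suc n) a) ((U ^^ Suc n) b) = z * H ((U ^^ n) a) ((U ^^ n) b) + Lam (\<lambda>w. w ^ n)" for n
        unfolding funpow_Suc_right o_apply eq P H_rec pos ..
    qed
    then show ?thesis by simp
  next
    case False
    with z have z1: "norm z < 1" by simp
    note P = right_linearD[OF pow_rl[OF rl_inv_U]]
    have step_back: "(inv U ^^ n) u = (inv U ^^ Suc n) (U u)" for n u
      unfolding funpow_Suc_right o_apply inv_U ..
    have "H ((inv U ^^ 0) a) ((inv U ^^ 0) b) = Lam (\<lambda>w. 1 / (w - z))"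
    proof (rule cauchy_transform_inside[OF z1, where \<phi> = "\<lambda>n. H ((inv U ^^ n) a) ((inv U ^^ n) b)"])
      show "norm (H ((inv U ^^ n) a) ((inv U ^^ n) b)) \<le> (norm a * norm y + norm b * norm y) * M" for n
        using H_bd[of "(inv U ^^ n) a" "(inv U ^^ n) b"] by (simp add: pow_norm)
      show "H ((inv U ^^ n) a) ((inv U ^^ n) b) =
          z * H ((inv U ^^ Suc n) a) ((inv U ^^ Suc n) b) + Lam (\<lambda>w. cnj w ^ Suc n)" for n
        unfolding step_back[of n] eq P H_rec neg ..
    qed
    then show ?thesis by simp
  qed
  then show ?thesis by (simp add: H_def a_def b_def)
qed

end

section \<open>The measures of matrix coefficients\<close>

definition qcomp :: "nat \<Rightarrow> quat \<Rightarrow> real" where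
  "qcomp c q = (if c = 0 then qre q else if c = 1 then qi q else if c = 2 then qj q else qk q)"

definition qunit :: "nat \<Rightarrow> quat" where
  "qunit c = (if c = 0 then 1 else if c = 1 then Quat 0 1 0 0 else if c = 2 then Quat 0 0 1 0 else Quat 0 0 0 1)"

lemma sum_lessThan_4: "(\<Sum>c<4::nat. g c) = g 0 + g 1 + g 2 + g 3" for g :: "nat \<Rightarrow> 'b::comm_monoid_add"
  by (simp add: eval_nat_numeral add.assoc)

lemma quat_eq_sum_units: "q = (\<Sum>c<4. qcomp c q *\<^sub>R qunit c)"
  by (simp add: sum_lessThan_4 qcomp_def qunit_def quat_eq_iff)

lemma bounded_linear_qcomp: "bounded_linear (qcomp c)"
proof (rule bounded_linear_intro[where K = 1])
  show "norm (qcomp c q) \<le> norm q * 1" for q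
  proof -
    have "(qcomp c q)\<^sup>2 \<le> (norm q)\<^sup>2" unfolding norm_quat_power2 by (simp add: qcomp_def)
    then show ?thesis using power2_le_iff_abs_le[of "norm q" "qcomp c q"] by simp
  qed
qed (simp_all add: qcomp_def)

lemma signed_measure_qcomp:
  assumes "quat_measure M \<nu>"
  shows "signed_measure M (\<lambda>A. qcomp c (\<nu> A))"
  unfolding signed_measure_def
  using assms bounded_linear.sums[OF bounded_linear_qcomp] unfolding quat_measure_def by blast

text \<open>The complex valued coordinate of \<open>q\<close> that is linear over the plane of
  \<open>I\<close> and has real part \<open>qre (q * p)\<close>. These coordinates, for all
  \<open>p\<close>, separate quaternions.\<close>

definition slice_functional :: "quat \<Rightarrow> quat \<Rightarrow> quat \<Rightarrow> complex" where
  "slice_functional I p q = Complex (qre (q * p)) (- qre (I * (q * p)))"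

lemma slice_functional_emb:
  assumes "I \<in> imag_sphere"
  shows "slice_functional I p (emb I z * q) = z * slice_functional I p q"
proof -
  have e: "emb I z * q * p = Re z *\<^sub>R (q * p) + Im z *\<^sub>R (I * (q * p))"
    by (simp add: emb_def distrib_right mult.assoc scaleR_conv_of_real of_real_commute_quat)
  have "I * I = - 1" using emb_mult[OF assms, of \<i> \<i>] by (simp add: emb_def)
  then have II: "I * (I * u) = - u" for u by (simp add: mult.assoc[symmetric])
  have s: "I * (emb I z * q * p) = Re z *\<^sub>R (I * (q * p)) - Im z *\<^sub>R (q * p)"
    unfolding e by (simp add: distrib_left II)
  have qre_comb: "qre (a *\<^sub>R u + b *\<^sub>R v) = a * qre u + b * qre v"
    "qre (a *\<^sub>R u - b *\<^sub>R v) = a * qre u - b * qre v" for a b u v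
    by simp_all
  show ?thesis
    unfolding slice_functional_def s
    unfolding e qre_comb complex_eq_iff by (simp del: quat_sel_mult)
qed

lemma bounded_linear_slice_functional: "bounded_linear (slice_functional I p)"
proof -
  have re: "bounded_linear qre" using bounded_linear_qcomp[of 0] by (simp add: qcomp_def[abs_def])
  have "bounded_linear (\<lambda>q. qre (q * p) *\<^sub>R 1 + (- qre (I * (q * p))) *\<^sub>R \<i>)"
    by (intro bounded_linear_add bounded_linear_scaleR_const bounded_linear_minus
        bounded_linear_compose[OF re] bounded_linear_const_mult bounded_linear_mult_left)
  moreover have "(\<lambda>q. qre (q * p) *\<^sub>R 1 + (- qre (I * (q * p))) *\<^sub>R \<i>) = slice_functional I p"
    by (auto simp: slice_functional_def complex_eq_iff)
  ultimately show ?thesis by simp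
qed

text \<open>The index \<open>(c, s)\<close> selects one of the four real components of \<open>\<nu>\<close>
  and its positive or negative part.\<close>

definition part_measure :: "(real set \<Rightarrow> quat) \<Rightarrow> nat \<times> bool \<Rightarrow> real measure" where
  "part_measure \<nu> = (\<lambda>(c, s). upper_variation circle_borel
     (if s then (\<lambda>A. qcomp c (\<nu> A)) else (\<lambda>A. - qcomp c (\<nu> A))))"

definition part_weight :: "quat \<Rightarrow> quat \<Rightarrow> nat \<times> bool \<Rightarrow> complex" where
  "part_weight I p = (\<lambda>(c, s). (if s then 1 else - 1) * slice_functional I p (qunit c))"

abbreviation part_index :: "(nat \<times> bool) set" where
  "part_index \<equiv> {..<4} \<times> UNIV"

lemma space_circle_borel: "space circle_borel = {0..<2 * pi}"
  by (simp add: space_restrict_space)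

lemma circle_functional_parts:
  assumes "quat_measure circle_borel \<nu>"
  shows "circle_functional part_index (part_measure \<nu>) cis"
proof (rule circle_functional.intro)
  show "finite part_index" by simp
  fix i :: "nat \<times> bool" assume "i \<in> part_index"
  obtain c s where i: "i = (c, s)" by force
  have "signed_measure circle_borel (if s then (\<lambda>A. qcomp c (\<nu> A)) else (\<lambda>A. - qcomp c (\<nu> A)))"
    using signed_measure_qcomp[OF assms] signed_measure_uminus by auto
  from finite_upper_variation[OF this] show "finite_measure (part_measure \<nu> i)"
    by (simp add: i part_measure_def)
  have "cis \<in> borel_measurable borel" by (intro borel_measurable_continuous_onI continuous_intros)
  then have "cis \<in> borel_measurable circle_borel" by (rule measurable_restrict_space1)
  moreover have "sets (part_measure \<nu> i) = sets circle_borel" by (simp add: i part_measure_def)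
  ultimately show "cis \<in> borel_measurable (part_measure \<nu> i)"
    using measurable_cong_sets by blast
qed simp

abbreviation parts_Lam :: "quat \<Rightarrow> quat \<Rightarrow> (real set \<Rightarrow> quat) \<Rightarrow> (complex \<Rightarrow> complex) \<Rightarrow> complex" where
  "parts_Lam I p \<nu> \<equiv> circle_functional.Lam part_index (part_weight I p) (part_measure \<nu>) cis"

lemma parts_Lam_eq:
  assumes \<nu>: "quat_measure circle_borel \<nu>"
  shows "parts_Lam I p \<nu> g = (\<Sum>c<4. slice_functional I p (qunit c) *
    ((\<integral>t. g (cis t) \<partial>part_measure \<nu> (c, True)) - (\<integral>t. g (cis t) \<partial>part_measure \<nu> (c, False))))"
proof -
  interpret circle_functional part_index "part_weight I p" "part_measure \<nu>" cis
    by (rule circle_functional_parts[OF \<nu>])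
  have "Lam g = (\<Sum>c<4. \<Sum>s\<in>UNIV. part_weight I p (c, s) * (\<integral>t. g (cis t) \<partial>part_measure \<nu> (c, s)))"
    unfolding Lam_def by (simp add: sum.cartesian_product)
  also have "\<dots> = (\<Sum>c<4. slice_functional I p (qunit c) *
    ((\<integral>t. g (cis t) \<partial>part_measure \<nu> (c, True)) - (\<integral>t. g (cis t) \<partial>part_measure \<nu> (c, False))))"
    by (intro sum.cong refl) (simp add: UNIV_bool part_weight_def algebra_simps)
  finally show ?thesis .
qed

text \<open>The integrand stands to the left of the measure and takes values in the plane of
  \<open>I\<close>, so it can be pulled out of a functional that is linear over this plane.\<close>

lemma slice_functional_quat_integral:
  assumes I: "I \<in> imag_sphere" and \<nu>: "quat_measure circle_borel \<nu>"
    and g: "g \<in> borel_measurable borel" "\<And>z. norm z = 1 \<Longrightarrow> norm (g z) \<le> C"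
  shows "slice_functional I p (quat_integral circle_borel \<nu> (\<lambda>t. emb I (g (cis t)))) = parts_Lam I p \<nu> g"
proof -
  interpret circle_functional part_index "part_weight I p" "part_measure \<nu>" cis
    by (rule circle_functional_parts[OF \<nu>])
  interpret h: bounded_linear "slice_functional I p" by (rule bounded_linear_slice_functional)
  define G where "G i = (\<integral>t. g (cis t) \<partial>part_measure \<nu> i)" for i
  have G: "(\<integral>t. emb I (g (cis t)) \<partial>part_measure \<nu> i) = emb I (G i)" if "i \<in> part_index" for i
    unfolding G_def by (rule integral_bounded_linear[OF bounded_linear_emb integrable_on_circle[OF that g]])
  have si: "signed_integral circle_borel (\<lambda>A. qcomp c (\<nu> A)) (\<lambda>t. emb I (g (cis t))) =
      emb I (G (c, True) - G (c, False))" if "c < 4" for c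
    using G[of "(c, True)"] G[of "(c, False)"] that
    by (simp add: signed_integral_def part_measure_def linear_diff[OF bounded_linear.linear[OF bounded_linear_emb]])
  have "quat_integral circle_borel \<nu> (\<lambda>t. emb I (g (cis t))) =
      (\<Sum>c<4. signed_integral circle_borel (\<lambda>A. qcomp c (\<nu> A)) (\<lambda>t. emb I (g (cis t))) * qunit c)"
    unfolding quat_integral_def by (simp add: sum_lessThan_4 qcomp_def qunit_def)
  also have "\<dots> = (\<Sum>c<4. emb I (G (c, True) - G (c, False)) * qunit c)"
    by (rule sum.cong) (simp_all add: si)
  finally have "slice_functional I p (quat_integral circle_borel \<nu> (\<lambda>t. emb I (g (cis t)))) =
      (\<Sum>c<4. (G (c, True) - G (c, False)) * slice_functional I p (qunit c))"
    by (simp add: h.sum slice_functional_emb[OF I])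
  then show ?thesis unfolding parts_Lam_eq[OF \<nu>] G_def by (simp add: mult.commute)
qed

lemma parts_Lam_indicator:
  assumes \<nu>: "quat_measure circle_borel \<nu>" and A: "closed A"
  shows "parts_Lam I p \<nu> (\<lambda>z. if z \<in> A then 1 else 0) =
    slice_functional I p (\<nu> {t \<in> {0..<2 * pi}. cis t \<in> A})"
proof -
  interpret h: bounded_linear "slice_functional I p" by (rule bounded_linear_slice_functional)
  define T where "T = {t \<in> {0..<2 * pi}. cis t \<in> A}"
  have "cis \<in> borel_measurable borel" by (intro borel_measurable_continuous_onI continuous_intros)
  then have "cis \<in> borel_measurable circle_borel" by (rule measurable_restrict_space1)
  then have "cis -` A \<inter> space circle_borel \<in> sets circle_borel"
    by (rule measurable_sets) (use A in simp)
  moreover have "cis -` A \<inter> space circle_borel = T" unfolding space_circle_borel T_def by auto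
  ultimately have T: "T \<in> sets circle_borel" by simp
  have int: "(\<integral>t. (if cis t \<in> A then 1 else 0 :: complex) \<partial>part_measure \<nu> i) = of_real (measure (part_measure \<nu> i) T)"
    if i: "i \<in> part_index" for i
  proof -
    interpret finite_measure "part_measure \<nu> i"
      using circle_functional.finite_\<mu>[OF circle_functional_parts[OF \<nu>] i] .
    have sp: "space (part_measure \<nu> i) = {0..<2 * pi}" "sets (part_measure \<nu> i) = sets circle_borel"
      by (auto simp: part_measure_def space_circle_borel split: prod.split)
    have "(\<integral>t. (if cis t \<in> A then 1 else 0 :: complex) \<partial>part_measure \<nu> i) =
        (\<integral>t. complex_of_real (indicator T t) \<partial>part_measure \<nu> i)"
      by (rule Bochner_Integration.integral_cong) (auto simp: sp T_def indicator_def)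
    also have "\<dots> = complex_of_real (measure (part_measure \<nu> i) (T \<inter> space (part_measure \<nu> i)))"
      by simp
    finally show ?thesis using T sp sets.sets_into_space[OF T] by (simp add: Int_absorb2 space_circle_borel scaleR_conv_of_real)
  qed
  have "parts_Lam I p \<nu> (\<lambda>z. if z \<in> A then 1 else 0) =
      (\<Sum>c<4. slice_functional I p (qunit c) * of_real (qcomp c (\<nu> T)))"
    unfolding parts_Lam_eq[OF \<nu>]
  proof (intro sum.cong refl arg_cong2[where f = "(*)"])
    fix c :: nat assume "c \<in> {..<4}"
    then have i: "(c, s) \<in> part_index" for s by simp
    show "(\<integral>t. (if cis t \<in> A then 1 else 0 :: complex) \<partial>part_measure \<nu> (c, True)) -
        (\<integral>t. (if cis t \<in> A then 1 else 0) \<partial>part_measure \<nu> (c, False)) = of_real (qcomp c (\<nu> T))"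
      unfolding int[OF i] using Jordan_decomposition[OF signed_measure_qcomp[OF \<nu>] T, of c]
      by (simp add: part_measure_def)
  qed
  also have "\<dots> = slice_functional I p (\<Sum>c<4. qcomp c (\<nu> T) *\<^sub>R qunit c)"
    unfolding h.sum h.scaleR by (simp add: scaleR_conv_of_real mult.commute)
  also have "\<dots> = slice_functional I p (\<nu> T)" using quat_eq_sum_units[of "\<nu> T"] by simp
  finally show ?thesis unfolding T_def .
qed

text \<open>The negative powers appear as powers of the conjugate, since the functional only sees the
  circle.\<close>

lemma parts_Lam_moments:
  assumes I: "I \<in> imag_sphere" and mm: "moment_measure I U x y \<nu>"
  shows "slice_functional I p (qinner ((U ^^ n) x) y) = parts_Lam I p \<nu> (\<lambda>w. w ^ n)"
    and "slice_functional I p (qinner ((inv U ^^ n) x) y) = parts_Lam I p \<nu> (\<lambda>w. cnj w ^ n)"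
proof -
  have \<nu>: "quat_measure circle_borel \<nu>"
    and mom: "\<And>n::int. qinner (op_int_power U n x) y = quat_integral circle_borel \<nu> (\<lambda>t. emb I (cis (of_int n * t)))"
    using mm by (auto simp: moment_measure_def)
  have cm [measurable]: "cnj \<in> borel_measurable borel"
    by (intro borel_measurable_continuous_onI continuous_intros)
  have "qinner ((U ^^ n) x) y = quat_integral circle_borel \<nu> (\<lambda>t. emb I (cis t ^ n))"
  proof -
    have "cis (of_int (int n) * t) = cis t ^ n" for t
      using Complex.DeMoivre[of t n] by simp
    then show ?thesis using mom[of "int n"] by (simp only:) (simp add: op_int_power_def)
  qed
  moreover have "slice_functional I p (quat_integral circle_borel \<nu> (\<lambda>t. emb I (cis t ^ n))) =
      parts_Lam I p \<nu> (\<lambda>w. w ^ n)"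
    by (rule slice_functional_quat_integral[OF I \<nu>, where C = 1]) (simp_all add: norm_power)
  ultimately show "slice_functional I p (qinner ((U ^^ n) x) y) = parts_Lam I p \<nu> (\<lambda>w. w ^ n)" by simp
  have "op_int_power U (- int n) = inv U ^^ n"
    by (cases "n = 0") (auto simp: op_int_power_def)
  then have "qinner ((inv U ^^ n) x) y = quat_integral circle_borel \<nu> (\<lambda>t. emb I (cnj (cis t) ^ n))"
  proof -
    have "cis (of_int (- int n) * t) = cnj (cis t) ^ n" for t
      by (simp add: cis_cnj Complex.DeMoivre)
    then show ?thesis using mom[of "- int n"] \<open>op_int_power U (- int n) = inv U ^^ n\<close> by (simp only:)
  qed
  moreover have "slice_functional I p (quat_integral circle_borel \<nu> (\<lambda>t. emb I (cnj (cis t) ^ n))) =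
      parts_Lam I p \<nu> (\<lambda>w. cnj w ^ n)"
    by (rule slice_functional_quat_integral[OF I \<nu>, where C = 1]) (simp_all add: norm_power)
  ultimately show "slice_functional I p (qinner ((inv U ^^ n) x) y) = parts_Lam I p \<nu> (\<lambda>w. cnj w ^ n)" by simp
qed

section \<open>Riesz projectors\<close>

text \<open>Conjugating weights and points yields the measure whose Cauchy transform is the reflection
  \<open>z \<mapsto> cnj (f (cnj z))\<close> of the original one.\<close>

lemma circle_functional_cnj:
  assumes "circle_functional S \<mu> e"
  shows "circle_functional S \<mu> (\<lambda>t. cnj (e t))"
    and "circle_functional.Lam S (\<lambda>i. cnj (wgt i)) \<mu> (\<lambda>t. cnj (e t)) g =
      cnj (circle_functional.Lam S wgt \<mu> e (\<lambda>w. cnj (g (cnj w))))"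
proof -
  interpret circle_functional S wgt \<mu> e by (rule assms)
  have "cnj \<in> borel_measurable borel" by (intro borel_measurable_continuous_onI continuous_intros)
  then show c: "circle_functional S \<mu> (\<lambda>t. cnj (e t))"
    by (intro circle_functional.intro finite_S finite_\<mu> measurable_compose[OF e_measurable]) (auto simp: norm_e)
  show "circle_functional.Lam S (\<lambda>i. cnj (wgt i)) \<mu> (\<lambda>t. cnj (e t)) g = cnj (Lam (\<lambda>w. cnj (g (cnj w))))"
    unfolding circle_functional.Lam_def[OF c] Lam_def cnj_sum complex_cnj_mult
    by (simp flip: integral_cnj)
qed

context quat_unitary
begin

definition pairing :: "'a \<Rightarrow> 'a \<Rightarrow> quat \<Rightarrow> complex \<Rightarrow> complex" where
  "pairing x y p z = Complex (qre (qinner (res_re x z) y * p)) (qre (qinner (res_im x z) y * p))"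

text \<open>With \<open>f\<close> the pairing under \<open>slice_functional I p\<close> and
  \<open>f'\<close> its reflection, the real part \<open>res_re\<close> is even and the imaginary
  part \<open>res_im\<close> is odd under conjugation of \<open>z\<close>. Hence the mean of
  \<open>f\<close> and \<open>f'\<close> only sees the real part of the functional. Both functions
  are Cauchy transforms, and the symmetry of the arc on the spectrum makes their contour integrals
  conjugate up to the factor \<open>- 2\<pi>\<i>\<close>.\<close>

lemma pairing_contour:
  assumes I: "I \<in> imag_sphere" and mm: "moment_measure I U x y \<nu>"
    and \<Gamma>: "finite \<Gamma>" "\<And>\<gamma>. \<gamma> \<in> \<Gamma> \<Longrightarrow> valid_path \<gamma>" "\<And>\<gamma>. \<gamma> \<in> \<Gamma> \<Longrightarrow> path_image \<gamma> \<subseteq> - spec"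
    and wind: "\<And>z. z \<in> spec \<Longrightarrow> (\<Sum>\<gamma>\<in>\<Gamma>. winding_number \<gamma> z) = (if z \<in> A then 1 else 0)"
    and A: "closed A" "A \<noteq> {}" and sym: "\<And>z. z \<in> spec \<Longrightarrow> cnj z \<in> A \<longleftrightarrow> z \<in> A"
  shows "pairing x y p holomorphic_on - spec"
    and "(\<Sum>\<gamma>\<in>\<Gamma>. contour_integral \<gamma> (pairing x y p)) =
      - (2 * of_real pi * \<i>) * of_real (qre (\<nu> {t \<in> {0..<2 * pi}. cis t \<in> A} * p))"
proof -
  have \<nu>: "quat_measure circle_borel \<nu>" using mm by (simp add: moment_measure_def)
  define h where "h = slice_functional I p"
  interpret h: bounded_linear h unfolding h_def by (rule bounded_linear_slice_functional)
  note cf = circle_functional_parts[OF \<nu>]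
  define f where "f z = h (qinner (res_re x z) y) + \<i> * h (qinner (res_im x z) y)" for z
  have cont_f: "continuous_on (- spec) f"
    unfolding f_def
    by (intro continuous_intros h.continuous_on bounded_linear.continuous_on[OF bounded_linear_qinner_left] continuous_res)
  have f_eq: "f z = parts_Lam I p \<nu> (\<lambda>w. 1 / (w - z))" if "norm z \<noteq> 1" for z
    unfolding f_def h_def
    by (rule resolvent_pairing_eq_Lam[OF cf bounded_linear_slice_functional _ _ that])
      (use parts_Lam_moments[OF I mm] in auto)
  note cf' = circle_functional_cnj[OF cf]
  define f' where "f' z = cnj (f (cnj z))" for z
  have cont_f': "continuous_on (- spec) f'"
    unfolding f'_def
    by (intro continuous_on_cnj continuous_on_compose2[OF cont_f] continuous_intros) (auto simp: spec_cnj)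
  have f'_eq: "f' z = circle_functional.Lam part_index (\<lambda>i. cnj (part_weight I p i)) (part_measure \<nu>) (\<lambda>t. cnj (cis t))
      (\<lambda>w. 1 / (w - z))" if "norm z \<noteq> 1" for z
    unfolding f'_def cf'(2) using that by (simp add: f_eq)
  have pair: "pairing x y p z = (f z + f' z) / 2" for z
    unfolding pairing_def f'_def f_def h_def res_cnj
    by (simp add: slice_functional_def complex_eq_iff Modules.additive.minus[OF additive_qinner_left])
  have hol: "f holomorphic_on - spec" "f' holomorphic_on - spec"
    using circle_functional.f_holomorphic[OF cf closed_spec spec_subset_circle cont_f f_eq]
      circle_functional.f_holomorphic[OF cf'(1) closed_spec spec_subset_circle cont_f' f'_eq] by auto
  then show "pairing x y p holomorphic_on - spec"
    unfolding pair[abs_def] by (intro holomorphic_intros) auto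
  define \<Lambda> where "\<Lambda> = h (\<nu> {t \<in> {0..<2 * pi}. cis t \<in> A})"
  let ?c = "- (2 * of_real pi * \<i>) :: complex"
  have sum_f: "(\<Sum>\<gamma>\<in>\<Gamma>. contour_integral \<gamma> f) = ?c * \<Lambda>"
    using circle_functional.sum_contour_integral_eq_Lam[OF cf closed_spec spec_subset_circle cont_f f_eq \<Gamma> wind A]
    unfolding parts_Lam_indicator[OF \<nu> A(1)] \<Lambda>_def h_def by simp
  have sum_f': "(\<Sum>\<gamma>\<in>\<Gamma>. contour_integral \<gamma> f') = ?c * cnj \<Lambda>"
  proof -
    have "(\<Sum>\<gamma>\<in>\<Gamma>. contour_integral \<gamma> f') = ?c *
      circle_functional.Lam part_index (\<lambda>i. cnj (part_weight I p i)) (part_measure \<nu>) (\<lambda>t. cnj (cis t))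
        (\<lambda>w. if w \<in> cnj ` A then 1 else 0)"
    proof (rule circle_functional.sum_contour_integral_eq_Lam[OF cf'(1) closed_spec spec_subset_circle cont_f' f'_eq \<Gamma>])
      show "closed (cnj ` A)"
      proof -
        have "cnj ` A = cnj -` A" by (auto simp: image_iff) (metis complex_cnj_cnj)
        then show ?thesis using A(1) by (simp add: continuous_closed_vimage continuous_on_cnj)
      qed
      show "(\<Sum>\<gamma>\<in>\<Gamma>. winding_number \<gamma> z) = (if z \<in> cnj ` A then 1 else 0)" if "z \<in> spec" for z
      proof -
        have "z \<in> cnj ` A \<longleftrightarrow> cnj z \<in> A" by (auto simp: image_iff) (metis complex_cnj_cnj)
        then show ?thesis using wind[OF that] sym[OF that] by simp
      qed
    qed (use A in auto)
    also have "circle_functional.Lam part_index (\<lambda>i. cnj (part_weight I p i)) (part_measure \<nu>) (\<lambda>t. cnj (cis t))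
        (\<lambda>w. if w \<in> cnj ` A then 1 else 0) = cnj (parts_Lam I p \<nu> (\<lambda>w. cnj (if cnj w \<in> cnj ` A then 1 else 0)))"
      by (rule cf'(2))
    also have "(\<lambda>w. cnj (if cnj w \<in> cnj ` A then 1 else 0)) = (\<lambda>w. if w \<in> A then 1 else 0 :: complex)"
      by (auto simp: image_iff)
    finally show ?thesis
      unfolding parts_Lam_indicator[OF \<nu> A(1)] \<Lambda>_def h_def .
  qed
  have "(\<Sum>\<gamma>\<in>\<Gamma>. contour_integral \<gamma> (pairing x y p)) = (\<Sum>\<gamma>\<in>\<Gamma>. (contour_integral \<gamma> f + contour_integral \<gamma> f') / 2)"
  proof (rule sum.cong[OF refl])
    fix \<gamma> assume \<gamma>: "\<gamma> \<in> \<Gamma>"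
    have "open (- spec)" using closed_spec by (simp add: open_Compl)
    then have "f contour_integrable_on \<gamma>" "f' contour_integrable_on \<gamma>"
      using hol \<Gamma>(2,3)[OF \<gamma>] by (auto intro: contour_integrable_holomorphic_simple)
    then show "contour_integral \<gamma> (pairing x y p) = (contour_integral \<gamma> f + contour_integral \<gamma> f') / 2"
      unfolding pair[abs_def] by (simp add: contour_integral_div contour_integral_add contour_integrable_add)
  qed
  also have "\<dots> = (?c * \<Lambda> + ?c * cnj \<Lambda>) / 2"
    unfolding sum_f[symmetric] sum_f'[symmetric] sum.distrib[symmetric] sum_divide_distrib ..
  also have "\<dots> = ?c * of_real (Re \<Lambda>)"
    by (simp add: complex_eq_iff)
  also have "Re \<Lambda> = qre (\<nu> {t \<in> {0..<2 * pi}. cis t \<in> A} * p)"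
    by (simp add: \<Lambda>_def h_def slice_functional_def)
  finally show "(\<Sum>\<gamma>\<in>\<Gamma>. contour_integral \<gamma> (pairing x y p)) =
      ?c * of_real (qre (\<nu> {t \<in> {0..<2 * pi}. cis t \<in> A} * p))" .
qed

end

context quat_unitary
begin

text \<open>The density of the real part of \<open>c R(z) x dz\<close> along the path; the values \<open>-
  \<i>\<close> and \<open>- 1\<close> of \<open>c\<close> give the real and the imaginary part of
  \<open>- \<i> R(z) x dz\<close>.\<close>

definition resolvent_form :: "complex \<Rightarrow> 'a \<Rightarrow> (real \<Rightarrow> complex) \<Rightarrow> real \<Rightarrow> 'a" where
  "resolvent_form c x \<gamma> \<tau> = (let d = vector_derivative \<gamma> (at \<tau> within {0..1}) in
    Re d *\<^sub>R (Re c *\<^sub>R res_re x (\<gamma> \<tau>) - Im c *\<^sub>R res_im x (\<gamma> \<tau>)) +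
    Im d *\<^sub>R (- Im c *\<^sub>R res_re x (\<gamma> \<tau>) - Re c *\<^sub>R res_im x (\<gamma> \<tau>)))"

lemma bounded_linear_qre_qinner: "bounded_linear (\<lambda>u. qre (qinner u y * p))" for y :: 'a
proof -
  have re: "bounded_linear qre" using bounded_linear_qcomp[of 0] by (simp add: qcomp_def[abs_def])
  show ?thesis
    by (rule bounded_linear_compose[OF re bounded_linear_compose[OF bounded_linear_mult_left bounded_linear_qinner_left]])
qed

text \<open>Tested against the functionals \<open>u \<mapsto> qre (qinner u y * p)\<close> the form is the
  real part of a holomorphic form, hence locally exact.\<close>

lemma resolvent_form_integrable:
  assumes hol: "\<And>y p. pairing x y p holomorphic_on - spec"
    and \<gamma>: "valid_path \<gamma>" "path_image \<gamma> \<subseteq> - spec"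
  shows "resolvent_form c x \<gamma> integrable_on {0..1}"
proof -
  define P where "P w = Re c *\<^sub>R res_re x w - Im c *\<^sub>R res_im x w" for w
  define Q where "Q w = - Im c *\<^sub>R res_re x w - Re c *\<^sub>R res_im x w" for w
  define \<Phi> where "\<Phi> = {\<lambda>u :: 'a. qre (qinner u y * p) | y p. True}"
  have op: "open (- spec)" using closed_spec by (simp add: open_Compl)
  have lin: "bounded_linear \<phi>" if "\<phi> \<in> \<Phi>" for \<phi>
    using that bounded_linear_qre_qinner by (auto simp: \<Phi>_def)
  have sep: "u = 0" if "\<And>\<phi>. \<phi> \<in> \<Phi> \<Longrightarrow> \<phi> u = 0" for u
  proof -
    \<comment> \<open>The functional with \<open>y = u\<close> and \<open>p = 1\<close> has the value \<open>(norm u)\<^sup>2\<close> at \<open>u\<close>.\<close>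
    have "(\<lambda>v. qre (qinner v u * 1)) \<in> \<Phi>" unfolding \<Phi>_def by blast
    from that[OF this] have "qre (qinner u u) = 0" by simp
    then show ?thesis unfolding qinner_self by (simp del: of_real_power)
  qed
  have cont: "continuous_on (- spec) P" "continuous_on (- spec) Q"
    unfolding P_def Q_def by (intro continuous_intros continuous_res)+
  have weak: "\<exists>g. \<forall>w\<in>ball z r. (g has_derivative (\<lambda>h. Re h * \<phi> (P w) + Im h * \<phi> (Q w))) (at w)"
    if \<phi>: "\<phi> \<in> \<Phi>" and sub: "ball z r \<subseteq> - spec" for \<phi> z r
  proof -
    interpret \<phi>: bounded_linear \<phi> by (rule lin[OF \<phi>])
    obtain y p where \<phi>_eq: "\<phi> = (\<lambda>u. qre (qinner u y * p))" using \<phi> by (auto simp: \<Phi>_def)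
    obtain g where "\<And>w. w \<in> ball z r \<Longrightarrow> (g has_field_derivative pairing x y p w) (at w within ball z r)"
      using holomorphic_convex_primitive'[OF convex_ball open_ball holomorphic_on_subset[OF hol sub]] by blast
    then have g: "(g has_derivative (\<lambda>h. pairing x y p w * h)) (at w)" if "w \<in> ball z r" for w
      using that unfolding has_field_derivative_def by (metis at_within_open open_ball)
    have pair: "pairing x y p w = Complex (\<phi> (res_re x w)) (\<phi> (res_im x w))" for w
      unfolding pairing_def \<phi>_eq ..
    show ?thesis
    proof (intro exI[of _ "\<lambda>w. Re (c * g w)"] ballI)
      fix w assume "w \<in> ball z r"
      from has_derivative_Re[OF has_derivative_mult_right[OF g[OF this], of c]]
      show "((\<lambda>w. Re (c * g w)) has_derivative (\<lambda>h. Re h * \<phi> (P w) + Im h * \<phi> (Q w))) (at w)"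
        unfolding P_def Q_def \<phi>.diff \<phi>.scaleR pair by (simp add: algebra_simps)
    qed
  qed
  have "(\<lambda>\<tau>. Re (vector_derivative \<gamma> (at \<tau> within {0..1})) *\<^sub>R P (\<gamma> \<tau>) +
      Im (vector_derivative \<gamma> (at \<tau> within {0..1})) *\<^sub>R Q (\<gamma> \<tau>)) integrable_on {0..1}"
  proof (rule one_form_integrable_along_valid_path[OF \<gamma> op])
    fix z assume "z \<in> - spec"
    then obtain r where r: "0 < r" "ball z r \<subseteq> - spec" using op open_contains_ball by blast
    obtain G where "\<And>w. w \<in> ball z r \<Longrightarrow> (G has_derivative (\<lambda>h. Re h *\<^sub>R P w + Im h *\<^sub>R Q w)) (at w)"
      by (rule weakly_exact_one_form_primitive[OF convex_ball open_ball continuous_on_subset[OF cont(1) r(2)]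
            continuous_on_subset[OF cont(2) r(2)] lin sep weak[OF _ r(2)]]) blast+
    then show "\<exists>r>0. \<exists>G. \<forall>w\<in>ball z r. (G has_derivative (\<lambda>h. Re h *\<^sub>R P w + Im h *\<^sub>R Q w)) (at w)"
      using r(1) by blast
  qed
  then show ?thesis by (simp add: resolvent_form_def[abs_def] P_def Q_def Let_def)
qed

lemma resolvent_form_integral_pairing:
  assumes hol: "\<And>y p. pairing x y p holomorphic_on - spec"
    and \<gamma>: "valid_path \<gamma>" "path_image \<gamma> \<subseteq> - spec"
  shows "qre (qinner (integral {0..1} (resolvent_form c x \<gamma>)) y * p) = Re (c * contour_integral \<gamma> (pairing x y p))"
proof -
  interpret \<phi>: bounded_linear "\<lambda>u. qre (qinner u y * p)" by (rule bounded_linear_qre_qinner)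
  have "open (- spec)" using closed_spec by (simp add: open_Compl)
  then have "pairing x y p contour_integrable_on \<gamma>"
    using hol \<gamma> by (intro contour_integrable_holomorphic_simple)
  then have "((\<lambda>\<tau>. pairing x y p (\<gamma> \<tau>) * vector_derivative \<gamma> (at \<tau> within {0..1}))
      has_integral contour_integral \<gamma> (pairing x y p)) {0..1}"
    using has_contour_integral_integral has_contour_integral_def by blast
  note ci = has_integral_Re[OF has_integral_mult_right[OF this, of c]]
  have "qre (qinner (integral {0..1} (resolvent_form c x \<gamma>)) y * p) =
      integral {0..1} (\<lambda>\<tau>. qre (qinner (resolvent_form c x \<gamma> \<tau>) y * p))"
    using integral_linear[OF resolvent_form_integrable[OF hol \<gamma>] \<phi>.bounded_linear_axioms] by (simp add: o_def)
  also have "\<dots> = Re (c * contour_integral \<gamma> (pairing x y p))"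
  proof (rule integral_unique, rule has_integral_eq[OF _ ci])
    fix \<tau> :: real
    show "Re (c * (pairing x y p (\<gamma> \<tau>) * vector_derivative \<gamma> (at \<tau> within {0..1}))) =
        qre (qinner (resolvent_form c x \<gamma> \<tau>) y * p)"
      unfolding resolvent_form_def Let_def \<phi>.add \<phi>.diff \<phi>.scaleR
      by (simp add: pairing_def algebra_simps del: quat_sel_mult)
  qed
  finally show ?thesis .
qed

lemma S_pencil_emb:
  assumes "I \<in> imag_sphere" shows "S_pencil U (emb I z) = pencil z"
  by (simp add: S_pencil_def pencil_def fun_eq_iff emb_sphere_sel[OF assms])

lemma slice_form_emb:
  assumes "I \<in> imag_sphere"
  shows "slice_form I \<gamma> \<tau> = emb I (- (vector_derivative \<gamma> (at \<tau> within {0..1}) * \<i>))"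
  unfolding slice_form_def emb_uminus emb_mult[OF assms] by simp

text \<open>With \<open>d\<close> the derivative of the path, the density of \<open>- ds I\<close> is
  \<open>emb I w\<close> for \<open>w = - \<i> d\<close>. Expanding left multiplications as
  \<open>Re + Im L\<close> and moving the real operators past the inverse of the pencil leaves
  \<open>w (U - cnj z)\<close> times that inverse, split into real and imaginary part.\<close>

lemma resolvent_forms:
  assumes B: "hilbert_basis B" and I: "I \<in> imag_sphere" and z: "\<gamma> \<tau> \<notin> spec"
  shows "S_resolvent_left B U (emb I (\<gamma> \<tau>)) (left_mult B (slice_form I \<gamma> \<tau>) x) =
      - (resolvent_form (- \<i>) x \<gamma> \<tau> + resolvent_form (- 1) (left_mult B I x) \<gamma> \<tau>)"
    and "left_mult B (slice_form I \<gamma> \<tau>) (S_resolvent_right B U (emb I (\<gamma> \<tau>)) x) =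
      - (resolvent_form (- \<i>) x \<gamma> \<tau> + left_mult B I (resolvent_form (- 1) x \<gamma> \<tau>))"
proof -
  define d where "d = vector_derivative \<gamma> (at \<tau> within {0..1})"
  define z where "z = \<gamma> \<tau>"
  define L where "L = left_mult B I"
  have z: "z \<notin> spec" using assms(3) by (simp add: z_def)
  note R = right_linearD[OF Rs(1)[OF z]]
  note LL = left_mult_left_mult[OF B]
  interpret L: bounded_linear L unfolding L_def by (rule bounded_linear_left_mult[OF B])
  define w where "w = - (d * \<i>)"
  have w: "Re w = Im d" "Im w = - Re d" by (simp_all add: w_def)
  have zw: "Re (cnj z * w) = Re z * Im d - Im z * Re d" "Im (cnj z * w) = - (Re z * Re d) - Im z * Im d"
    by (simp_all add: w)
  have sf: "slice_form I \<gamma> \<tau> = emb I w" unfolding slice_form_emb[OF I] w_def d_def ..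
  have Lw: "left_mult B (emb I u) v = Re u *\<^sub>R v + Im u *\<^sub>R L v" for u v
    unfolding L_def by (rule left_mult_emb[OF B])
  have cz: "left_mult B (qcnj (emb I z)) (left_mult B (emb I w) x) = left_mult B (emb I (cnj z * w)) x"
    "left_mult B (emb I w) (left_mult B (qcnj (emb I z)) x) = left_mult B (emb I (cnj z * w)) x" for x
    unfolding LL emb_sphere_sel(3)[OF I] emb_mult[OF I, symmetric] by (simp_all add: mult.commute)
  have UR: "Rs z (U v) = U (Rs z v)" for v using Rs(5)[OF z] by simp
  have fr: "resolvent_form (- \<i>) v \<gamma> \<tau> = Im d *\<^sub>R U (Rs z v) - (Re z * Im d - Im z * Re d) *\<^sub>R Rs z v" for v
    unfolding resolvent_form_def Let_def d_def[symmetric] z_def[symmetric] res_re_def res_im_def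
    by (simp add: algebra_simps)
  have fi: "resolvent_form (- 1) v \<gamma> \<tau> = (- Re d) *\<^sub>R U (Rs z v) - (- (Re z * Re d) - Im z * Im d) *\<^sub>R Rs z v" for v
    unfolding resolvent_form_def Let_def d_def[symmetric] z_def[symmetric] res_re_def res_im_def
    by (simp add: algebra_simps)
  have "S_resolvent_left B U (emb I z) (left_mult B (emb I w) x) =
      - Rs z (U (left_mult B (emb I w) x) - left_mult B (emb I (cnj z * w)) x)"
    unfolding S_resolvent_left_def S_pencil_emb[OF I] cz ..
  also have "\<dots> = - (resolvent_form (- \<i>) x \<gamma> \<tau> + resolvent_form (- 1) (L x) \<gamma> \<tau>)"
    unfolding Lw fr fi w zw by (simp add: R U_simps UR algebra_simps)
  finally show "S_resolvent_left B U (emb I (\<gamma> \<tau>)) (left_mult B (slice_form I \<gamma> \<tau>) x) =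
      - (resolvent_form (- \<i>) x \<gamma> \<tau> + resolvent_form (- 1) (left_mult B I x) \<gamma> \<tau>)"
    unfolding sf z_def L_def .
  have "left_mult B (emb I w) (S_resolvent_right B U (emb I z) x) =
      - (left_mult B (emb I w) (U (Rs z x)) - left_mult B (emb I (cnj z * w)) (Rs z x))"
    unfolding S_resolvent_right_def S_pencil_emb[OF I] cz(2)[symmetric]
    using bounded_linear.linear[OF bounded_linear_left_mult[OF B, of "emb I w"]]
    by (simp only: linear_neg linear_diff)
  also have "\<dots> = - (resolvent_form (- \<i>) x \<gamma> \<tau> + L (resolvent_form (- 1) x \<gamma> \<tau>))"
    unfolding Lw fr fi w zw L.diff L.scaleR by (simp add: algebra_simps)
  finally show "left_mult B (slice_form I \<gamma> \<tau>) (S_resolvent_right B U (emb I (\<gamma> \<tau>)) x) =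
      - (resolvent_form (- \<i>) x \<gamma> \<tau> + left_mult B I (resolvent_form (- 1) x \<gamma> \<tau>))"
    unfolding sf z_def L_def .
qed

end

lemma quat_eqI_qre_mult:
  assumes "\<And>p. qre (a * p) = qre (b * p)" shows "a = b"
proof -
  have "qre ((a - b) * qcnj (a - b)) = 0"
    using assms[of "qcnj (a - b)"] by (simp only: left_diff_distrib quat_sel_add)
  moreover have "qre (c * qcnj c) = (norm c)\<^sup>2" for c
    unfolding norm_quat_power2 by (simp add: power2_eq_square)
  ultimately have "(norm (a - b))\<^sup>2 = 0" by metis
  then show ?thesis by simp
qed

theorem theorem4p3:
  fixes I J :: quat
    and U :: "'a::quat_hilbert \<Rightarrow> 'a"
    and B :: "'a set"
    and \<nu> :: "'a \<Rightarrow> 'a \<Rightarrow> real set \<Rightarrow> quat"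
    and \<sigma>\<^sub>0 \<Omega> :: "quat set"
    and \<Gamma> :: "(real \<Rightarrow> complex) set"
    and t\<^sub>0 t\<^sub>1 :: real
  assumes "I \<in> imag_sphere" and "J \<in> imag_sphere" and "I * J = - (J * I)"
    and "hilbert_basis B"
    and "unitary U"
    and "\<And>x y. moment_measure I U x y (\<nu> x y)"
    and "spectral_set U \<sigma>\<^sub>0"
    and "t\<^sub>0 \<le> t\<^sub>1"
    and "slice I \<sigma>\<^sub>0 \<subseteq> circle_arc t\<^sub>0 t\<^sub>1"
    and "slice I (S_spectrum U) \<inter> circle_arc t\<^sub>0 t\<^sub>1 \<subseteq> slice I \<sigma>\<^sub>0"
    and "riesz_domain U \<sigma>\<^sub>0 \<Omega>"
    and "jordan_boundary \<Gamma> (slice I \<Omega>)"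
  shows "riesz_projector_left B I U \<Gamma> = spectral_measure \<nu> (arc_params t\<^sub>0 t\<^sub>1) \<and>
    riesz_projector_right B I U \<Gamma> = spectral_measure \<nu> (arc_params t\<^sub>0 t\<^sub>1)"
proof -
  note I = assms(1) and B = assms(4) and mm = assms(6)
  interpret quat_unitary U by (rule quat_unitary.intro) (rule assms(5))
  define A where "A = circle_arc t\<^sub>0 t\<^sub>1"
  define D where "D = slice I \<Omega>"
  define T where "T = arc_params t\<^sub>0 t\<^sub>1"
  have spec_slice: "spec = slice I (S_spectrum U)"
    by (simp add: spec_def slice_def S_spectrum_def S_pencil_emb[OF I])
  have A: "closed A" "A \<noteq> {}"
  proof -
    have "compact A" unfolding A_def circle_arc_def
      by (intro compact_continuous_image continuous_intros compact_Icc)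
    then show "closed A" by (rule compact_imp_closed)
    show "A \<noteq> {}" using assms(8) by (simp add: A_def circle_arc_def)
  qed
  have T: "T = {t \<in> {0..<2 * pi}. cis t \<in> A}" by (simp add: T_def A_def arc_params_def)
  have rd: "axially_symmetric \<Omega>" "\<Omega> \<inter> S_spectrum U = \<sigma>\<^sub>0" "emb I ` frontier D \<subseteq> S_resolvent_set U"
    using assms(11) I by (auto simp: riesz_domain_def D_def)
  have AD: "z \<in> A \<longleftrightarrow> z \<in> D" if "z \<in> spec" for z
    using assms(9,10) that rd(2) unfolding spec_slice A_def D_def slice_def by blast
  have mI: "- I \<in> imag_sphere" using I by (simp add: imag_sphere_def)
  have D_cnj: "cnj z \<in> D" if "z \<in> D" for z
  proof -
    have "emb (- I) z \<in> \<Omega>"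
      using rd(1) I mI that unfolding axially_symmetric_def D_def slice_def by blast
    then show ?thesis by (simp add: D_def slice_def emb_cnj_eq)
  qed
  have sym: "cnj z \<in> A \<longleftrightarrow> z \<in> A" if "z \<in> spec" for z
    using AD[OF that] AD[of "cnj z"] D_cnj[of z] D_cnj[of "cnj z"] that by (auto simp: spec_cnj)
  have jb: "finite \<Gamma>" "\<And>\<gamma>. \<gamma> \<in> \<Gamma> \<Longrightarrow> valid_path \<gamma>" "(\<Union>\<gamma>\<in>\<Gamma>. path_image \<gamma>) = frontier D"
    "\<And>z. z \<notin> frontier D \<Longrightarrow> (\<Sum>\<gamma>\<in>\<Gamma>. winding_number \<gamma> z) = (if z \<in> D then 1 else 0)"
    using assms(12) by (auto simp: jordan_boundary_def D_def)
  have frontier_D: "frontier D \<subseteq> - spec"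
    using rd(3) unfolding spec_slice slice_def S_resolvent_set_def by auto
  have path: "path_image \<gamma> \<subseteq> - spec" if "\<gamma> \<in> \<Gamma>" for \<gamma>
    using frontier_D jb(3) that by blast
  have wind: "(\<Sum>\<gamma>\<in>\<Gamma>. winding_number \<gamma> z) = (if z \<in> A then 1 else 0)" if "z \<in> spec" for z
  proof -
    have "z \<notin> frontier D" using frontier_D that by blast
    from jb(4)[OF this] show ?thesis using AD[OF that] by simp
  qed
  have hol: "pairing x y p holomorphic_on - spec" for x y p
    by (rule pairing_contour(1)[OF I mm jb(1,2) path wind A sym])
  have pairing_sum: "(\<Sum>\<gamma>\<in>\<Gamma>. contour_integral \<gamma> (pairing x y p)) =
      - (2 * of_real pi * \<i>) * of_real (qre (\<nu> x y T * p))" for x y p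
    unfolding T by (rule pairing_contour(2)[OF I mm jb(1,2) path wind A sym])
  note fi = resolvent_form_integrable[OF hol jb(2) path]
  note fp = resolvent_form_integral_pairing[OF hol jb(2) path]
  \<comment> \<open>The boundary integrals of the real and the imaginary part of \<open>- \<i> R(z) x dz\<close>.\<close>
  define SA where "SA x = (\<Sum>\<gamma>\<in>\<Gamma>. integral {0..1} (resolvent_form (- \<i>) x \<gamma>))" for x
  define SB where "SB x = (\<Sum>\<gamma>\<in>\<Gamma>. integral {0..1} (resolvent_form (- 1) x \<gamma>))" for x
  have qre_qinner_sum: "qre (qinner (\<Sum>\<gamma>\<in>\<Gamma>. g \<gamma>) y * p) = (\<Sum>\<gamma>\<in>\<Gamma>. qre (qinner (g \<gamma>) y * p))" for g :: "_ \<Rightarrow> 'a" and y p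
    using linear_sum[OF bounded_linear.linear[OF bounded_linear_qre_qinner]] .
  have SA: "qre (qinner (SA x) y * p) = - (2 * pi) * qre (\<nu> x y T * p)" for x y p
  proof -
    have "qre (qinner (SA x) y * p) = Im (\<Sum>\<gamma>\<in>\<Gamma>. contour_integral \<gamma> (pairing x y p))"
      unfolding SA_def qre_qinner_sum Im_sum by (rule sum.cong) (simp_all add: fp del: quat_sel_mult)
    then show ?thesis unfolding pairing_sum by simp
  qed
  have SB: "SB x = 0" for x
  proof (rule qinner_eq_imp_eq, rule quat_eqI_qre_mult)
    fix y p
    have "qre (qinner (SB x) y * p) = - Re (\<Sum>\<gamma>\<in>\<Gamma>. contour_integral \<gamma> (pairing x y p))"
      unfolding SB_def qre_qinner_sum Re_sum sum_negf[symmetric] by (rule sum.cong) (simp_all add: fp del: quat_sel_mult)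
    then show "qre (qinner (SB x) y * p) = qre (qinner 0 y * p)"
      unfolding pairing_sum by (simp add: qinner_zero_left)
  qed
  define P where "P x = (1 / (2 * pi)) *\<^sub>R (- SA x)" for x
  have P: "\<nu> x y T = qinner (P x) y" for x y
  proof (rule quat_eqI_qre_mult)
    fix p
    interpret \<phi>: bounded_linear "\<lambda>u :: 'a. qre (qinner u y * p)" by (rule bounded_linear_qre_qinner)
    show "qre (\<nu> x y T * p) = qre (qinner (P x) y * p)"
      unfolding P_def \<phi>.scaleR linear_neg[OF \<phi>.linear] SA by simp
  qed
  have "spectral_measure \<nu> T = P"
    unfolding spectral_measure_def
  proof (rule the_equality)
    fix Q assume Q: "\<forall>x y. \<nu> x y T = qinner (Q x) y"
    show "Q = P"
      by (rule ext, rule qinner_eq_imp_eq) (use P Q in metis)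
  qed (use P in blast)
  have not_spec: "\<gamma> \<tau> \<notin> spec" if "\<gamma> \<in> \<Gamma>" "\<tau> \<in> {0..1}" for \<gamma> \<tau>
  proof -
    have "\<gamma> \<tau> \<in> path_image \<gamma>" using that(2) by (simp add: path_image_def)
    then show ?thesis using path[OF that(1)] by blast
  qed
  note rf = resolvent_forms[OF B I not_spec]
  have "riesz_projector_left B I U \<Gamma> x = P x" for x
  proof -
    have "integral {0..1} (\<lambda>\<tau>. S_resolvent_left B U (emb I (\<gamma> \<tau>)) (left_mult B (slice_form I \<gamma> \<tau>) x)) =
        - (integral {0..1} (resolvent_form (- \<i>) x \<gamma>) + integral {0..1} (resolvent_form (- 1) (left_mult B I x) \<gamma>))" if \<gamma>: "\<gamma> \<in> \<Gamma>" for \<gamma>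
    proof -
      have "integral {0..1} (\<lambda>\<tau>. S_resolvent_left B U (emb I (\<gamma> \<tau>)) (left_mult B (slice_form I \<gamma> \<tau>) x)) =
          integral {0..1} (\<lambda>\<tau>. - (resolvent_form (- \<i>) x \<gamma> \<tau> + resolvent_form (- 1) (left_mult B I x) \<gamma> \<tau>))"
        by (rule Henstock_Kurzweil_Integration.integral_cong) (rule rf(1)[OF \<gamma>])
      also have "\<dots> = - (integral {0..1} (resolvent_form (- \<i>) x \<gamma>) + integral {0..1} (resolvent_form (- 1) (left_mult B I x) \<gamma>))"
        unfolding Henstock_Kurzweil_Integration.integral_neg
        using Henstock_Kurzweil_Integration.integral_add[OF fi[OF \<gamma> \<gamma>] fi[OF \<gamma> \<gamma>]] by simp
      finally show ?thesis .
    qed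
    then have "riesz_projector_left B I U \<Gamma> x = (1 / (2 * pi)) *\<^sub>R (- (SA x + SB (left_mult B I x)))"
      unfolding riesz_projector_left_def SA_def SB_def by (simp add: sum_negf sum_subtractf)
    then show ?thesis by (simp add: SB P_def)
  qed
  moreover have "riesz_projector_right B I U \<Gamma> x = P x" for x
  proof -
    interpret L: bounded_linear "left_mult B I" by (rule bounded_linear_left_mult[OF B])
    have "integral {0..1} (\<lambda>\<tau>. left_mult B (slice_form I \<gamma> \<tau>) (S_resolvent_right B U (emb I (\<gamma> \<tau>)) x)) =
        - (integral {0..1} (resolvent_form (- \<i>) x \<gamma>) + left_mult B I (integral {0..1} (resolvent_form (- 1) x \<gamma>)))" if \<gamma>: "\<gamma> \<in> \<Gamma>" for \<gamma>
    proof -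
      have "integral {0..1} (\<lambda>\<tau>. left_mult B (slice_form I \<gamma> \<tau>) (S_resolvent_right B U (emb I (\<gamma> \<tau>)) x)) =
          integral {0..1} (\<lambda>\<tau>. - (resolvent_form (- \<i>) x \<gamma> \<tau> + left_mult B I (resolvent_form (- 1) x \<gamma> \<tau>)))"
        by (rule Henstock_Kurzweil_Integration.integral_cong) (rule rf(2)[OF \<gamma>])
      also have "\<dots> = - (integral {0..1} (resolvent_form (- \<i>) x \<gamma>) + integral {0..1} (\<lambda>\<tau>. left_mult B I (resolvent_form (- 1) x \<gamma> \<tau>)))"
        unfolding Henstock_Kurzweil_Integration.integral_neg
        using Henstock_Kurzweil_Integration.integral_add[OF fi[OF \<gamma> \<gamma>]
          integrable_linear[OF fi[OF \<gamma> \<gamma>] L.bounded_linear_axioms]]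
        by (simp add: o_def)
      also have "integral {0..1} (\<lambda>\<tau>. left_mult B I (resolvent_form (- 1) x \<gamma> \<tau>)) = left_mult B I (integral {0..1} (resolvent_form (- 1) x \<gamma>))"
        using integral_linear[OF fi[OF \<gamma> \<gamma>] L.bounded_linear_axioms] by (simp add: o_def)
      finally show ?thesis .
    qed
    then have "riesz_projector_right B I U \<Gamma> x = (1 / (2 * pi)) *\<^sub>R (- (SA x + left_mult B I (SB x)))"
      unfolding riesz_projector_right_def SA_def SB_def by (simp add: sum_negf sum_subtractf L.sum)
    then show ?thesis by (simp add: SB P_def L.zero)
  qed
  ultimately show ?thesis using \<open>spectral_measure \<nu> T = P\<close> by (auto simp: T_def)
qed

end
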